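(* Let $\psi,\phi\in\mathscr L$ satisfy $\mathtt{Var}_\infty(\psi)$ and $\mathtt{Var}_\infty(\phi)$. Suppose that $\beta_\phi\le\beta_\psi$ and let $q\in(0,1)$. Let $\mathbf a=(a_n)_{n\in\mathbb N}$ be a fixed sequence of positive real numbers such that $\lim_{n\to\infty}a_n=\infty$. Below, $\mathbf b=(b_n)_{n\in\mathbb N}$ stands for a sequence of positive real numbers such that $\lim_{n\to\infty}b_n=\infty$ and $\boldsymbol\mu=(\mu_n)_{n\in\mathbb N}$ for a sequence of probability measures on $\mathbb N$ such that $\mu_n(0)+\mu_n(1)<1$ and $\sum_{k\in\mathbb N}k\mu_n(k)=1$ for all $n$. Then: (i) If $\mathtt{Sheu}(\psi)$ and $\mathtt{Sheu}(\phi)$ hold true, then there are $\mathbf b$ and $\boldsymbol\mu$ satisfying $\text{Łuka}(\mathbf a,\mathbf b,\boldsymbol\mu,\psi)$, $\lim_{n\to\infty}\mu_n(1)=q$, $b_n\asymp_\infty\phi(a_n)$ and $\mathtt{Sheu}(\mathbf a,\mathbf b,\boldsymbol\mu)$. (ii) If $\mathtt{Grey}(\psi)$ and $\mathtt{Grey}(\phi)$ hold true but not $\mathtt{Sheu}(\phi)$, then there are $\mathbf b$ and $\boldsymbol\mu$ satisfying $\text{Łuka}(\mathbf a,\mathbf b,\boldsymbol\mu,\psi)$, $\lim_{n\to\infty}\mu_n(1)=q$, $b_n\asymp_\infty\phi(a_n)$, $\mathtt{Grey}(\mathbf a,\mathbf b,\boldsymbol\mu)$ but not $\mathtt{Sheu}(\mathbf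 a,\mathbf b,\boldsymbol\mu)$. (iii) If $\mathtt{Grey}(\phi)$ does not hold, then there are $\mathbf b$ and $\boldsymbol\mu$ that satisfy $\text{Łuka}(\mathbf a,\mathbf b,\boldsymbol\mu,\psi)$, $\lim_{n\to\infty}\mu_n(1)=q$, $b_n\asymp_\infty\phi(a_n)$ but not $\mathtt{Grey}(\mathbf a,\mathbf b,\boldsymbol\mu)$.
   Context: $\mathbb N=\{0,1,2,\dots\}$, $\mathbb R_+^*=(0,\infty)$. $\mathscr L$ is the set of functions $\psi:\mathbb R_+\to\mathbb R_+$ of the form $\psi(z)=\beta_\psi z^2+\int_{\mathbb R_+^*}(e^{-zx}-1+zx)\,\pi_\psi(dx)$, where $\beta_\psi\ge0$ and $\pi_\psi$ is a Borel measure on $\mathbb R_+^*$ with $\int(x\wedge x^2)\,\pi_\psi(dx)<\infty$. For $\psi\in\mathscr L$: $\mathtt{Var}_\infty(\psi)$: either $\beta_\psi>0$ or $\int_{(0,1)}x\,\pi_\psi(dx)=\infty$. $\mathtt{Grey}(\psi)$: $\int_1^\infty\frac{dz}{\psi(z)}<\infty$. $\mathtt{Sheu}(\psi)$: $\int_1^\infty\frac{ds}{\sqrt{\int_0^s\psi(r)\,dr}}<\infty$. Let $(V^n_k)_{k\in\mathbb N}$ be the random walk started at $0$ with i.i.d. jumps of law $\nu_n(k)=\mu_n(k+1)$, $k\in\{-1\}\cup\mathbb N$, and let $X_1$ be a real random variable with $\mathbf E[e^{-\lambda X_1}]=e^{\psi(\lambda)}$, $\lambda\ge0$ (the value at time $1$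 of the spectrally positive Lévy process with Laplace exponent $\psi$). $\text{Łuka}(\mathbf a,\mathbf b,\boldsymbol\mu,\psi)$: $\frac1{a_n}V^n_{\lfloor b_n\rfloor}\to X_1$ in law as $n\to\infty$. Set $g_{\mu_n}(r)=\sum_{k}r^k\mu_n(k)$ and $\psi_n(\lambda)=b_n\big(g_{\mu_n}(1-\frac\lambda{a_n})-1+\frac\lambda{a_n}\big)$, $\lambda\in[0,a_n]$. $\mathtt{Grey}(\mathbf a,\mathbf b,\boldsymbol\mu)$: $\lim_{y\to\infty}\limsup_{n\to\infty}\int_y^{a_n}\frac{ds}{\psi_n(s)}=0$. $\mathtt{Sheu}(\mathbf a,\mathbf b,\boldsymbol\mu)$: $\lim_{y\to\infty}\limsup_{n\to\infty}\int_y^{a_n}\frac{ds}{\sqrt{\int_0^s\psi_n(r)\,dr}}=0$. $b_n\asymp_\infty\phi(a_n)$ means that there is $C\in[1,\infty)$ such that $C^{-1}b_n\le\phi(a_n)\le Cb_n$ for all sufficiently large $n$. *)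

theory Defs
  imports "HOL-Probability.Probability"
begin

text \<open>
  Functions on \<open>[0, \<infinity>)\<close> are rendered as total functions on the reals of which only the
  restriction to \<open>[0, \<infinity>)\<close> is ever used.  All integrals of reciprocals are taken in
  \<^typ>\<open>ennreal\<close>, where \<open>1 / 0 = \<infinity>\<close>.

  The predicate \<open>class_L \<psi> \<beta> \<pi>\<close> says that \<open>\<psi>\<close> is in the class \<open>\<L>\<close> with \<open>\<beta>\<^sub>\<psi> = \<beta>\<close> and
  \<open>\<pi>\<^sub>\<psi> = \<pi>\<close>.  A function in the class determines both parameters, so a statement about
  \<open>\<psi> \<in> \<L>\<close>, \<open>\<beta>\<^sub>\<psi>\<close> and \<open>\<pi>\<^sub>\<psi>\<close> is a statement about all triples satisfying the predicate.
\<close>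

definition class_L :: "(real \<Rightarrow> real) \<Rightarrow> real \<Rightarrow> real measure \<Rightarrow> bool" where
  "class_L \<psi> \<beta> \<pi> \<longleftrightarrow>
     0 \<le> \<beta> \<and>
     sets \<pi> = sets (restrict_space borel {0<..}) \<and>
     (\<integral>\<^sup>+x. ennreal (min x (x\<^sup>2)) \<partial>\<pi>) < \<infinity> \<and>
     (\<forall>z\<ge>0. \<psi> z = \<beta> * z\<^sup>2 + (\<integral>x. exp (- z * x) - 1 + z * x \<partial>\<pi>))"

definition Var_infty :: "real \<Rightarrow> real measure \<Rightarrow> bool" where
  "Var_infty \<beta> \<pi> \<longleftrightarrow> \<beta> > 0 \<or> (\<integral>\<^sup>+x\<in>{0<..<1}. ennreal x \<partial>\<pi>) = \<infinity>"

definition Grey :: "(real \<Rightarrow> real) \<Rightarrow> bool" where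
  "Grey \<psi> \<longleftrightarrow> (\<integral>\<^sup>+z\<in>{1..}. 1 / ennreal (\<psi> z) \<partial>lborel) < \<infinity>"

definition Sheu :: "(real \<Rightarrow> real) \<Rightarrow> bool" where
  "Sheu \<psi> \<longleftrightarrow>
     (\<integral>\<^sup>+s\<in>{1..}. 1 / ennreal (sqrt (LINT r:{0..s}|lborel. \<psi> r)) \<partial>lborel) < \<infinity>"

definition critical_offspring :: "nat pmf \<Rightarrow> bool" where
  "critical_offspring p \<longleftrightarrow>
     pmf p 0 + pmf p 1 < 1 \<and> (\<lambda>k. real k * pmf p k) sums 1"

text \<open>The random walk with jump law \<open>\<nu>(k) = p(k + 1)\<close>, \<open>k \<ge> -1\<close>, on the canonical space of
  i.i.d. sequences of jumps.\<close>

definition jump_space :: "nat pmf \<Rightarrow> (nat \<Rightarrow> int) measure" where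
  "jump_space p = Pi\<^sub>M UNIV (\<lambda>_. measure_pmf (map_pmf (\<lambda>k. int k - 1) p))"

definition walk :: "nat \<Rightarrow> (nat \<Rightarrow> int) \<Rightarrow> int" where
  "walk k \<xi> = (\<Sum>i<k. \<xi> i)"

text \<open>\<open>value_at_one \<psi> X\<close> says that \<open>X\<close> is the law of \<open>X\<^sub>1\<close>.\<close>

definition value_at_one :: "(real \<Rightarrow> real) \<Rightarrow> real measure \<Rightarrow> bool" where
  "value_at_one \<psi> X \<longleftrightarrow>
     real_distribution X \<and>
     (\<forall>l\<ge>0. has_bochner_integral X (\<lambda>x. exp (- l * x)) (exp (\<psi> l)))"

text \<open>For \<open>\<psi>\<close> in the class, the law of \<open>X\<^sub>1\<close> exists and is unique; the existential quantifier
  keeps the condition from being vacuous without appealing to this.\<close>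

definition Luka ::
  "(nat \<Rightarrow> real) \<Rightarrow> (nat \<Rightarrow> real) \<Rightarrow> (nat \<Rightarrow> nat pmf) \<Rightarrow> (real \<Rightarrow> real) \<Rightarrow> bool" where
  "Luka a b \<mu> \<psi> \<longleftrightarrow>
     (\<exists>X. value_at_one \<psi> X \<and>
        weak_conv_m
          (\<lambda>n. distr (jump_space (\<mu> n)) borel
                 (\<lambda>\<xi>. 1 / a n * real_of_int (walk (nat \<lfloor>b n\<rfloor>) \<xi>)))
          X)"

definition pgf :: "nat pmf \<Rightarrow> real \<Rightarrow> real" where
  "pgf p r = (\<Sum>k. r ^ k * pmf p k)"

definition psi_n ::
  "(nat \<Rightarrow> real) \<Rightarrow> (nat \<Rightarrow> real) \<Rightarrow> (nat \<Rightarrow> nat pmf) \<Rightarrow> nat \<Rightarrow> real \<Rightarrow> real" where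
  "psi_n a b \<mu> n l = b n * (pgf (\<mu> n) (1 - l / a n) - 1 + l / a n)"

text \<open>For fixed \<open>y\<close> the interval \<open>{y..a n}\<close> may be empty, but only for finitely many \<open>n\<close>
  when \<open>a\<close> tends to infinity.\<close>

definition Grey_seq ::
  "(nat \<Rightarrow> real) \<Rightarrow> (nat \<Rightarrow> real) \<Rightarrow> (nat \<Rightarrow> nat pmf) \<Rightarrow> bool" where
  "Grey_seq a b \<mu> \<longleftrightarrow>
     ((\<lambda>y::real. limsup (\<lambda>n. \<integral>\<^sup>+s\<in>{y..a n}. 1 / ennreal (psi_n a b \<mu> n s) \<partial>lborel))
        \<longlongrightarrow> 0) at_top"

definition Sheu_seq ::
  "(nat \<Rightarrow> real) \<Rightarrow> (nat \<Rightarrow> real) \<Rightarrow> (nat \<Rightarrow> nat pmf) \<Rightarrow> bool" where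
  "Sheu_seq a b \<mu> \<longleftrightarrow>
     ((\<lambda>y::real. limsup (\<lambda>n. \<integral>\<^sup>+s\<in>{y..a n}.
          1 / ennreal (sqrt (LINT r:{0..s}|lborel. psi_n a b \<mu> n r)) \<partial>lborel))
        \<longlongrightarrow> 0) at_top"

text \<open>\<open>asymp_infty u v\<close> is \<open>u\<^sub>n \<asymp>\<^sub>\<infinity> v\<^sub>n\<close>.\<close>

definition asymp_infty :: "(nat \<Rightarrow> real) \<Rightarrow> (nat \<Rightarrow> real) \<Rightarrow> bool" where
  "asymp_infty u v \<longleftrightarrow>
     (\<exists>C\<ge>1. \<forall>\<^sub>F n in sequentially. inverse C * u n \<le> v n \<and> v n \<le> C * u n)"

text \<open>The requirements imposed throughout on the sequences \<open>\<^bold>b\<close> and \<open>\<^bold>\<mu>\<close>.\<close>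

definition admissible_seqs :: "(nat \<Rightarrow> real) \<Rightarrow> (nat \<Rightarrow> nat pmf) \<Rightarrow> bool" where
  "admissible_seqs b \<mu> \<longleftrightarrow>
     (\<forall>n. b n > 0) \<and> filterlim b at_top sequentially \<and> (\<forall>n. critical_offspring (\<mu> n))"

end

theory Submission imports Defs begin

text \<open>
  All three parts follow from one construction.

  If \<open>\<Psi>\<close> is a Laplace exponent in the class, then \<open>r + \<Psi> (a (1 - r)) / b\<close> is a power series in \<open>r\<close> with
  total mass 1 and mean 1, whose coefficients are nonnegative except possibly that of \<open>r\<close>.  One can
  choose \<open>b\<close> so that the latter equals \<open>q\<close>, and then \<open>(1 - q) b\<close> lies between \<open>\<Psi> a\<close> and \<open>2 \<Psi> a\<close>
  (\<open>offspring_law_of_branching_coeffs\<close>).  For the offspring law so obtained, the function \<open>\<psi>\<^sub>n\<close>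
  of the statement is \<open>\<Psi>\<close> itself (\<open>psi_n_eq\<close>).  Everything is thereby reduced to finding exponents
  \<open>\<Psi>\<^sub>n\<close> that converge to \<open>\<psi>\<close>, are comparable to \<open>\<phi>\<close> at \<open>a\<^sub>n\<close>, and have the right integrals.

  Put \<open>\<Psi>\<^sub>n = C + S\<close>.  For \<open>C\<close>, remove \<open>\<beta>\<^sub>\<phi> z\<^sup>2\<close> from \<open>\<psi>\<close> and replace the remaining quadratic part and all
  jumps smaller than \<open>e\<close> by jumps of size \<open>e\<close>, preserving second moments.  This changes the exponent
  by at most a factor 2 on \<open>[0, 1 / e]\<close>, but makes it grow only linearly.  For \<open>S\<close>, remove from \<open>\<phi>\<close> all
  jumps of size at least \<open>d\<close>.  As jumps with infinite variation have a superlinear exponent, \<open>S\<close> is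
  between \<open>\<phi> / 2\<close> and \<open>\<phi>\<close> at infinity, and \<open>C \<le> \<phi>\<close> from some \<open>t\<close> on.  When \<open>e\<close> and \<open>d\<close> tend to 0,
  \<open>C\<close> tends to \<open>\<psi> - \<beta>\<^sub>\<phi> z\<^sup>2\<close> and \<open>S\<close> to \<open>\<beta>\<^sub>\<phi> z\<^sup>2\<close>, so that \<open>\<Psi>\<^sub>n\<close> tends to \<open>\<psi>\<close>.

  With \<open>e\<close> small enough compared to \<open>d\<close>, at every point \<open>2 \<Psi>\<^sub>n\<close> is above \<open>\<psi>\<close> or above \<open>\<phi>\<close>.  So
  \<open>1 / \<Psi>\<^sub>n\<close> is dominated by \<open>2 / \<psi> + 2 / \<phi>\<close>, which transfers convergent integrals.  On the other hand
  \<open>\<Psi>\<^sub>n \<le> 2 \<phi>\<close> on \<open>[t, a\<^sub>n]\<close>, and if \<open>e\<close> and \<open>d\<close> tend to 0 slowly with respect to \<open>a\<^sub>n\<close>, these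
  intervals carry a fixed amount of any divergent integral (\<open>mixing_scales\<close>, \<open>slow_index\<close>), which
  transfers divergence.  The tests with \<open>\<integral>\<^sub>0\<^sup>s \<psi>\<close> in place of \<open>\<psi>\<close> behave in the same way, because
  \<open>s f s / 8 \<le> \<integral>\<^sub>0\<^sup>s f \<le> s f s\<close> for all exponents \<open>f\<close> that occur.

  For the convergence in law, the Laplace transforms of the rescaled walk converge to
  \<open>exp (\<psi> z)\<close> on the closed right half-plane.  This gives tightness, the uniqueness of the limit
  (through the imaginary axis) and its Laplace transform (\<open>weak_limit_of_laplace_transforms\<close>); in
  particular the law of \<open>X\<^sub>1\<close> is obtained as the limit.
\<close>

section \<open>The kernel \<open>exp (- z) - 1 + z\<close>\<close>

text \<open>
  The kernel of the Laplace exponents.  It is needed on the reals, where all inequalities live, and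
  on the complex half-plane \<open>Re z \<ge> 0\<close>, where characteristic functions live.
\<close>

definition kern :: "'a::{real_normed_field,banach} \<Rightarrow> 'a" where
  "kern z = exp (- z) - 1 + z"

lemma kern_of_real: "kern (of_real u) = of_real (kern u)"
  by (simp add: kern_def exp_of_real flip: of_real_minus)

lemma kern_0 [simp]: "kern 0 = 0"
  by (simp add: kern_def)

lemma continuous_on_kern [continuous_intros]:
  "continuous_on S f \<Longrightarrow> continuous_on S (\<lambda>x. kern (f x))"
  by (simp add: kern_def continuous_intros)

lemma tendsto_kern [tendsto_intros]:
  "(f \<longlongrightarrow> l) F \<Longrightarrow> ((\<lambda>x. kern (f x)) \<longlongrightarrow> kern l) F"
  unfolding kern_def by (intro tendsto_intros)

lemma borel_measurable_kern [measurable]: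
  "(kern :: 'a::{real_normed_field,banach,second_countable_topology} \<Rightarrow> 'a) \<in> borel_measurable borel"
  by (intro borel_measurable_continuous_onI continuous_on_kern continuous_on_id)

text \<open>
  On the half-plane \<open>Re z \<ge> 0\<close> every derivative of \<open>exp (- z)\<close> has modulus at most 1 and the domain
  is convex, so Taylor's formula at 0 gives a remainder without exponential factors.
\<close>

lemma norm_exp_remainder_halfplane:
  assumes "0 \<le> Re z"
  shows "cmod (exp (- z) - (\<Sum>i\<le>n. (- z) ^ i / fact i)) \<le> cmod z ^ Suc n / fact n"
proof -
  let ?f = "\<lambda>i w. (- 1) ^ i * exp (- w) :: complex"
  have "cmod (?f 0 z - (\<Sum>i\<le>n. ?f i 0 * (z - 0) ^ i / fact i)) \<le> 1 * cmod (z - 0) ^ Suc n / fact n"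
  proof (rule complex_Taylor[where S = "{w. 0 \<le> Re w}"])
    show "convex {w. 0 \<le> Re w}" by (rule convex_halfspace_Re_ge)
    show "(?f i has_field_derivative ?f (Suc i) x) (at x within {w. 0 \<le> Re w})" for i x
      by (auto intro!: derivative_eq_intros)
    show "cmod (?f (Suc n) x) \<le> 1" if "x \<in> {w. 0 \<le> Re w}" for x
      using that by (simp add: norm_mult norm_power)
  qed (use assms in auto)
  also have "(\<Sum>i\<le>n. ?f i 0 * (z - 0) ^ i / fact i) = (\<Sum>i\<le>n. (- z) ^ i / fact i)"
    by (intro sum.cong refl) (simp add: power_minus[of z])
  finally show ?thesis by simp
qed

lemma norm_kern_le_linear: "0 \<le> Re z \<Longrightarrow> cmod (kern z) \<le> 2 * cmod z"
  using norm_exp_remainder_halfplane[of z 0] norm_triangle_ineq[of "exp (- z) - 1" z]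
  by (simp add: kern_def)

lemma norm_kern_le_square: "0 \<le> Re z \<Longrightarrow> cmod (kern z) \<le> cmod z ^ 2"
  using norm_exp_remainder_halfplane[of z 1]
  by (simp add: kern_def algebra_simps power2_eq_square)

lemma norm_kern_minus_square: "0 \<le> Re z \<Longrightarrow> cmod (kern z - z ^ 2 / 2) \<le> cmod z ^ 3"
proof -
  assume "0 \<le> Re z"
  then have "cmod (exp (- z) - (\<Sum>i\<le>2. (- z) ^ i / fact i)) \<le> cmod z ^ 3 / 2"
    using norm_exp_remainder_halfplane[of z 2] by (simp add: numeral_3_eq_3)
  also have "exp (- z) - (\<Sum>i\<le>2. (- z) ^ i / fact i) = kern z - z ^ 2 / 2"
    by (simp add: kern_def numeral_2_eq_2 algebra_simps)
  also have "cmod z ^ 3 / 2 \<le> cmod z ^ 3" by simp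
  finally show ?thesis .
qed

lemma kern_mono_real:
  assumes "0 \<le> u" "u \<le> (v::real)"
  shows "kern u \<le> kern v"
proof (rule DERIV_nonneg_imp_nondecreasing[OF assms(2)])
  fix x :: real assume "u \<le> x"
  then show "\<exists>y. (kern has_real_derivative y) (at x) \<and> 0 \<le> y"
    unfolding kern_def[abs_def] using assms(1)
    by (intro exI[of _ "1 - exp (-x)"]) (auto intro!: derivative_eq_intros)
qed

lemma kern_nonneg: "0 \<le> u \<Longrightarrow> 0 \<le> kern (u::real)"
  using exp_ge_add_one_self[of "-u"] by (simp add: kern_def)

lemma kern_le_linear: "0 \<le> u \<Longrightarrow> kern u \<le> (u::real)"
  by (simp add: kern_def)

text \<open>
  This is the inequality behind the doubling bound below: \<open>kern (2u) - 2 kern u\<close> is exactly the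
  square \<open>(1 - exp (- u))\<^sup>2\<close>.
\<close>

lemma square_one_minus_exp_le: "0 \<le> u \<Longrightarrow> (1 - exp (- u))\<^sup>2 \<le> 2 * kern (u::real)"
proof -
  assume u: "0 \<le> u"
  let ?h = "\<lambda>u. 2 * kern u - (1 - exp (- u))\<^sup>2 :: real"
  have "?h 0 \<le> ?h u"
  proof (rule DERIV_nonneg_imp_nondecreasing[OF u])
    fix x :: real assume "0 \<le> x"
    have "(?h has_real_derivative 2 * (1 - exp (- x))\<^sup>2) (at x)"
      unfolding kern_def[abs_def]
      by (auto intro!: derivative_eq_intros simp: algebra_simps power2_eq_square)
    then show "\<exists>y. (?h has_real_derivative y) (at x) \<and> 0 \<le> y"
      by (intro exI conjI) auto
  qed
  then show ?thesis by simp
qed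

lemma kern_double_le: "0 \<le> u \<Longrightarrow> kern (2 * u) \<le> 4 * kern (u::real)"
proof -
  assume "0 \<le> u"
  moreover have "kern (2 * u) = 2 * kern u + (1 - exp (- u))\<^sup>2"
    by (simp add: kern_def power2_eq_square algebra_simps flip: exp_add)
  ultimately show ?thesis using square_one_minus_exp_le[of u] by simp
qed

lemma kern_le_half_square: "0 \<le> u \<Longrightarrow> kern u \<le> (u::real)\<^sup>2 / 2"
proof -
  assume u: "0 \<le> u"
  let ?h = "\<lambda>u. u\<^sup>2 / 2 - kern u :: real"
  have "?h 0 \<le> ?h u"
  proof (rule DERIV_nonneg_imp_nondecreasing[OF u])
    fix x :: real assume "0 \<le> x"
    then show "\<exists>y. (?h has_real_derivative y) (at x) \<and> 0 \<le> y"
      unfolding kern_def[abs_def] using exp_ge_add_one_self[of "-x"]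
      by (intro exI[of _ "x - (1 - exp (-x))"]) (auto intro!: derivative_eq_intros)
  qed
  then show ?thesis by simp
qed

text \<open>
  Together with \<open>kern_le_half_square\<close>, this says that below 1 the kernel is a square up to a factor 2;
  this is why jumps shorter than \<open>e\<close> can be lumped together without affecting arguments
  up to \<open>1 / e\<close> by more than a factor 2.
\<close>

lemma kern_ge_quarter_square: "\<lbrakk>0 \<le> u; u \<le> 1\<rbrakk> \<Longrightarrow> (u::real)\<^sup>2 / 4 \<le> kern u"
proof -
  assume u: "0 \<le> u" "u \<le> 1"
  let ?h = "\<lambda>u. kern u - u\<^sup>2 / 4 :: real"
  have "?h 0 \<le> ?h u"
  proof (rule DERIV_nonneg_imp_nondecreasing[OF u(1)])
    fix x :: real assume x: "0 \<le> x" "x \<le> u"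
    have "(1 + x) * (1 - x / 2) \<ge> 1" using x u mult_mono[of x 1 x x] by (simp add: algebra_simps)
    moreover have "exp (- x) * (1 + x) \<le> 1"
      using exp_ge_add_one_self[of x] by (simp add: exp_minus field_simps)
    ultimately have "exp (- x) * (1 + x) \<le> (1 - x / 2) * (1 + x)" by (simp add: mult.commute)
    then have "exp (- x) \<le> 1 - x / 2" using x by (simp add: mult_le_cancel_right)
    then show "\<exists>y. (?h has_real_derivative y) (at x) \<and> 0 \<le> y"
      unfolding kern_def[abs_def]
      by (intro exI[of _ "1 - exp (-x) - x / 2"]) (auto intro!: derivative_eq_intros)
  qed
  then show ?thesis by simp
qed

lemma kern_ge_half: "2 \<le> u \<Longrightarrow> (u::real) / 2 \<le> kern u"
  using exp_gt_zero[of "-u"] unfolding kern_def by linarith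

text \<open>
  The coefficients of \<open>r \<mapsto> kern (u (1 - r))\<close>, that is of \<open>exp (- u) exp (u r) - 1 + u - u r\<close>: Poisson
  weights with a correction at 0 and 1.
\<close>

definition kern_coeff :: "real \<Rightarrow> nat \<Rightarrow> real" where
  "kern_coeff u k = exp (- u) * (u ^ k / fact k) + (if k = 0 then u - 1 else if k = 1 then - u else 0)"

lemma kern_coeff_nonneg: "\<lbrakk>0 \<le> u; k \<noteq> 1\<rbrakk> \<Longrightarrow> 0 \<le> kern_coeff u k"
  using kern_nonneg[of u] by (auto simp: kern_coeff_def kern_def)

lemma kern_coeff_1: "kern_coeff u 1 = - (u * (1 - exp (- u)))"
  by (simp add: kern_coeff_def algebra_simps)

lemma sums_if_01:
  "(\<lambda>k::nat. if k = 0 then a else if k = 1 then b else (0::'a::real_normed_vector)) sums (a + b)"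
proof -
  have "(\<lambda>k::nat. if k = 0 then a else if k = 1 then b else (0::'a)) sums
      (\<Sum>k\<in>{0,1::nat}. if k = 0 then a else if k = 1 then b else 0)"
    by (rule sums_finite) auto
  then show ?thesis by simp
qed

lemma kern_coeff_sums:
  fixes r :: complex
  shows "(\<lambda>k. of_real (kern_coeff u k) * r ^ k) sums kern (of_real u * (1 - r))"
proof -
  let ?u = "of_real u :: complex"
  have "(\<lambda>k. exp (- ?u) * ((?u * r) ^ k /\<^sub>R fact k)) sums (exp (- ?u) * exp (?u * r))"
    by (intro sums_mult exp_converges)
  from sums_add[OF this sums_if_01[of "?u - 1" "- ?u * r"]]
  have "(\<lambda>k. exp (- ?u) * ((?u * r) ^ k /\<^sub>R fact k) +
      (if k = 0 then ?u - 1 else if k = 1 then - ?u * r else 0)) sums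
      (exp (- ?u) * exp (?u * r) + (?u - 1 + - ?u * r))" .
  also have "exp (- ?u) * exp (?u * r) + (?u - 1 + - ?u * r) = kern (?u * (1 - r))"
    by (simp add: kern_def algebra_simps flip: exp_add)
  also have "(\<lambda>k. exp (- ?u) * ((?u * r) ^ k /\<^sub>R fact k) +
      (if k = 0 then ?u - 1 else if k = 1 then - ?u * r else 0)) =
      (\<lambda>k. of_real (kern_coeff u k) * r ^ k)"
    by (rule ext) (auto simp: kern_coeff_def scaleR_conv_of_real exp_of_real power_mult_distrib
        field_simps simp flip: of_real_minus)
  finally show ?thesis .
qed

text \<open>
  Only the coefficient at 1 is negative, so the absolute sums differ from the signed ones, which
  vanish at \<open>r = 1\<close>, by twice that coefficient.  The same value controls the first moments below.
\<close>

lemma abs_kern_coeff_sums: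
  assumes "0 \<le> u"
  shows "(\<lambda>k. \<bar>kern_coeff u k\<bar>) sums (2 * (u * (1 - exp (- u))))"
proof -
  have "(\<lambda>k. exp (- u) * (u ^ k /\<^sub>R fact k)) sums (exp (- u) * exp u)"
    by (intro sums_mult exp_converges)
  from sums_add[OF this sums_if_01[of "u - 1" "u - 2 * (exp (- u) * u)"]]
  have "(\<lambda>k. exp (- u) * (u ^ k /\<^sub>R fact k) +
      (if k = 0 then u - 1 else if k = 1 then u - 2 * (exp (- u) * u) else 0)) sums
      (exp (- u) * exp u + (u - 1 + (u - 2 * (exp (- u) * u))))" .
  also have "exp (- u) * exp u + (u - 1 + (u - 2 * (exp (- u) * u))) = 2 * (u * (1 - exp (- u)))"
    by (simp add: algebra_simps flip: exp_add)
  also have "(\<lambda>k. exp (- u) * (u ^ k /\<^sub>R fact k) +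
      (if k = 0 then u - 1 else if k = 1 then u - 2 * (exp (- u) * u) else 0)) =
      (\<lambda>k. \<bar>kern_coeff u k\<bar>)"
  proof (rule ext)
    fix k
    have "\<bar>kern_coeff u k\<bar> = (if k = 1 then u * (1 - exp (- u)) else kern_coeff u k)"
      using kern_coeff_nonneg[OF assms, of k] assms kern_coeff_1[of u] by (auto simp: abs_mult)
    then show "exp (- u) * (u ^ k /\<^sub>R fact k) +
      (if k = 0 then u - 1 else if k = 1 then u - 2 * (exp (- u) * u) else 0) = \<bar>kern_coeff u k\<bar>"
      by (auto simp: kern_coeff_def field_simps)
  qed
  finally show ?thesis .
qed

lemma exp_weighted_sums: "(\<lambda>k. real k * (u ^ k / fact k)) sums (u * exp u)" for u :: real
proof -
  have "(\<lambda>k. u * (u ^ k /\<^sub>R fact k)) sums (u * exp u)"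
    by (intro sums_mult exp_converges)
  also have "(\<lambda>k. u * (u ^ k /\<^sub>R fact k)) = (\<lambda>k. real (Suc k) * (u ^ Suc k / fact (Suc k)))"
    by (rule ext) (simp del: of_nat_Suc add: divide_inverse mult_ac)
  finally show ?thesis
    using sums_Suc_iff[of "\<lambda>k. real k * (u ^ k / fact k)" "u * exp u"] by simp
qed

lemma kern_coeff_mean_sums: "(\<lambda>k. real k * kern_coeff u k) sums 0"
proof -
  from sums_add[OF sums_mult[OF exp_weighted_sums[of u], of "exp (- u)"] sums_if_01[of 0 "- u"]]
  have "(\<lambda>k. exp (- u) * (real k * (u ^ k / fact k)) + (if k = 0 then 0 else if k = 1 then - u else 0))
      sums (exp (- u) * (u * exp u) + (0 + - u))" .
  also have "exp (- u) * (u * exp u) + (0 + - u) = 0"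
    by (simp add: exp_minus)
  also have "(\<lambda>k. exp (- u) * (real k * (u ^ k / fact k)) + (if k = 0 then 0 else if k = 1 then - u else 0))
      = (\<lambda>k. real k * kern_coeff u k)"
    by (rule ext) (auto simp: kern_coeff_def algebra_simps)
  finally show ?thesis .
qed

lemma abs_kern_coeff_mean_sums:
  assumes "0 \<le> u"
  shows "(\<lambda>k. real k * \<bar>kern_coeff u k\<bar>) sums (2 * (u * (1 - exp (- u))))"
proof -
  have "(\<lambda>k. real k * kern_coeff u k + (if k = 0 then 0 else if k = 1 then 2 * (u * (1 - exp (- u))) else 0))
      sums (0 + (0 + 2 * (u * (1 - exp (- u)))))"
    by (intro sums_add kern_coeff_mean_sums sums_if_01)
  also have "(\<lambda>k. real k * kern_coeff u k + (if k = 0 then 0 else if k = 1 then 2 * (u * (1 - exp (- u))) else 0))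
      = (\<lambda>k. real k * \<bar>kern_coeff u k\<bar>)"
  proof (rule ext)
    fix k
    show "real k * kern_coeff u k + (if k = 0 then 0 else if k = 1 then 2 * (u * (1 - exp (- u))) else 0)
      = real k * \<bar>kern_coeff u k\<bar>"
      using kern_coeff_nonneg[OF assms, of k] assms kern_coeff_1[of u] by (auto simp: abs_mult)
  qed
  finally show ?thesis by simp
qed

lemma mult_one_minus_exp_le_min: "0 \<le> u \<Longrightarrow> u * (1 - exp (- u)) \<le> min u (u\<^sup>2)" for u :: real
  using exp_ge_add_one_self[of "-u"] mult_left_mono[of "1 - exp (-u)" u u]
    mult_left_mono[of "1 - exp (-u)" 1 u]
  by (simp add: power2_eq_square)

section \<open>Laplace exponents of weighted jumps\<close>

text \<open>
  The Laplace exponent of jumps of size \<open>y x\<close> occurring with intensity \<open>m x M(dx)\<close>.  Keeping weight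
  and size as functions over a fixed measure lets one truncate or move the jumps of a given Levy
  measure without ever constructing a new measure, and puts all approximations on one space for
  dominated convergence.
\<close>

definition jump_exponent ::
  "'b measure \<Rightarrow> ('b \<Rightarrow> real) \<Rightarrow> ('b \<Rightarrow> real) \<Rightarrow> 'a \<Rightarrow> 'a::{real_normed_field,banach,second_countable_topology}" where
  "jump_exponent M m y z = (\<integral>x. m x *\<^sub>R kern (y x *\<^sub>R z) \<partial>M)"

locale jump_family =
  fixes M :: "'b measure" and m y :: "'b \<Rightarrow> real"
  assumes meas_m [measurable]: "m \<in> borel_measurable M"
    and meas_y [measurable]: "y \<in> borel_measurable M"
    and m_nonneg: "x \<in> space M \<Longrightarrow> 0 \<le> m x"
    and y_nonneg: "x \<in> space M \<Longrightarrow> 0 \<le> y x"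
    and integrable_min: "integrable M (\<lambda>x. m x * min (y x) ((y x)\<^sup>2))"

lemma norm_kern_le_min:
  assumes "0 \<le> Re z" "0 \<le> t"
  shows "cmod (kern (t *\<^sub>R z)) \<le> (2 * cmod z + (cmod z)\<^sup>2) * min t (t\<^sup>2)"
proof (cases "t \<le> 1")
  case True
  then have "t\<^sup>2 \<le> t" using assms(2) by (simp add: power2_eq_square mult_left_le)
  moreover have "cmod (kern (t *\<^sub>R z)) \<le> (cmod z)\<^sup>2 * t\<^sup>2"
    using norm_kern_le_square[of "t *\<^sub>R z"] assms by (simp add: power_mult_distrib mult.commute)
  ultimately show ?thesis by (simp add: min_def algebra_simps) (use assms in \<open>auto intro: add_increasing\<close>)
next
  case False
  then have "t \<le> t\<^sup>2" by (simp add: power2_eq_square)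
  moreover have "cmod (kern (t *\<^sub>R z)) \<le> 2 * cmod z * t"
    using norm_kern_le_linear[of "t *\<^sub>R z"] assms by (simp add: mult_ac)
  ultimately show ?thesis
    using False by (simp add: min_def algebra_simps) (use assms in \<open>auto intro: add_increasing2\<close>)
qed

text \<open>
  Weights, sizes and argument may all vary: the bound \<open>norm_kern_le_min\<close> reduces domination of the
  integrands to domination of \<open>m min(y, y\<^sup>2)\<close>.
\<close>

lemma
  fixes m y :: "nat \<Rightarrow> 'b \<Rightarrow> real" and z :: "nat \<Rightarrow> complex"
  assumes [measurable]: "\<And>n. m n \<in> borel_measurable M" "\<And>n. y n \<in> borel_measurable M"
      "m' \<in> borel_measurable M" "y' \<in> borel_measurable M"
    and nonneg: "\<And>n x. x \<in> space M \<Longrightarrow> 0 \<le> m n x" "\<And>n x. x \<in> space M \<Longrightarrow> 0 \<le> y n x"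
    and dom: "\<And>n x. x \<in> space M \<Longrightarrow> m n x * min (y n x) ((y n x)\<^sup>2) \<le> w x" and w: "integrable M w"
    and lim: "\<And>x. x \<in> space M \<Longrightarrow> (\<lambda>n. m n x) \<longlonglongrightarrow> m' x" "\<And>x. x \<in> space M \<Longrightarrow> (\<lambda>n. y n x) \<longlonglongrightarrow> y' x"
    and z: "z \<longlonglongrightarrow> z'" "\<And>n. 0 \<le> Re (z n)"
  shows jump_exponent_tendsto: "(\<lambda>n. jump_exponent M (m n) (y n) (z n)) \<longlonglongrightarrow> jump_exponent M m' y' z'"
    and integrable_jump_exponent_dominated: "integrable M (\<lambda>x. m n x *\<^sub>R kern (y n x *\<^sub>R z n))"
proof -
  from z(1) have "Bseq z" by (rule convergent_imp_Bseq[OF convergentI])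
  then obtain B where B: "\<And>n. cmod (z n) \<le> B" by (auto simp: Bseq_def)
  have B0: "0 \<le> B" using order_trans[OF norm_ge_zero B] .
  have bound: "norm (m n x *\<^sub>R kern (y n x *\<^sub>R z n)) \<le> (2 * B + B\<^sup>2) * w x" if "x \<in> space M" for n x
  proof -
    have "norm (m n x *\<^sub>R kern (y n x *\<^sub>R z n)) \<le>
        m n x * ((2 * cmod (z n) + (cmod (z n))\<^sup>2) * min (y n x) ((y n x)\<^sup>2))"
      using norm_kern_le_min[OF z(2)[of n] nonneg(2)[OF that, of n]] nonneg(1)[OF that, of n]
      by (simp add: mult_left_mono)
    also have "\<dots> = (2 * cmod (z n) + (cmod (z n))\<^sup>2) * (m n x * min (y n x) ((y n x)\<^sup>2))"
      by (simp add: mult_ac)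
    also have "\<dots> \<le> (2 * B + B\<^sup>2) * w x"
      using B[of n] nonneg[OF that, of n] dom[OF that, of n] B0
      by (intro mult_mono add_mono power_mono) auto
    finally show ?thesis .
  qed
  have "(\<lambda>n. \<integral>x. m n x *\<^sub>R kern (y n x *\<^sub>R z n) \<partial>M) \<longlonglongrightarrow> (\<integral>x. m' x *\<^sub>R kern (y' x *\<^sub>R z') \<partial>M)"
    by (rule integral_dominated_convergence[where w = "\<lambda>x. (2 * B + B\<^sup>2) * w x"])
      (use w bound in \<open>auto intro!: tendsto_intros lim z AE_I2\<close>)
  then show "(\<lambda>n. jump_exponent M (m n) (y n) (z n)) \<longlonglongrightarrow> jump_exponent M m' y' z'"
    by (simp add: jump_exponent_def)
  show "integrable M (\<lambda>x. m n x *\<^sub>R kern (y n x *\<^sub>R z n))"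
    by (rule Bochner_Integration.integrable_bound[of _ "\<lambda>x. (2 * B + B\<^sup>2) * w x"])
      (use w bound in \<open>auto intro!: AE_I2 order_trans[OF _ abs_ge_self]\<close>)
qed

text \<open>
  These properties of Laplace exponents on \<open>[0, \<infinity>)\<close> suffice to compare the primitive
  \<open>\<integral>\<^sub>0\<^sup>s f\<close> with \<open>s f s\<close>, hence to reduce statements about primitives to pointwise ones.
\<close>

definition mono_doubling :: "(real \<Rightarrow> real) \<Rightarrow> bool" where
  "mono_doubling f \<longleftrightarrow> continuous_on {0..} f \<and> mono_on {0..} f \<and>
     (\<forall>s\<ge>0. 0 \<le> f s \<and> f (2 * s) \<le> 4 * f s)"

lemma mono_doubling_add: "\<lbrakk>mono_doubling f; mono_doubling g\<rbrakk> \<Longrightarrow> mono_doubling (\<lambda>s. f s + g s)"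
  unfolding mono_doubling_def by (auto intro!: continuous_intros add_mono simp: mono_on_def distrib_left)

lemma mono_doubling_cmult: "\<lbrakk>0 \<le> c; mono_doubling f\<rbrakk> \<Longrightarrow> mono_doubling (\<lambda>s. c * f s)"
  unfolding mono_doubling_def by (auto intro!: continuous_intros mult_left_mono simp: mono_on_def mult.left_commute)

lemma mono_doubling_power2: "mono_doubling (\<lambda>s. s\<^sup>2)"
  unfolding mono_doubling_def by (auto intro!: continuous_intros power_mono simp: mono_on_def power_mult_distrib)

context jump_family
begin

lemma integrable_jump: "0 \<le> Re z \<Longrightarrow> integrable M (\<lambda>x. m x *\<^sub>R kern (y x *\<^sub>R z))"
  using integrable_jump_exponent_dominated[of "\<lambda>_. m" M "\<lambda>_. y" m y "\<lambda>x. m x * min (y x) ((y x)\<^sup>2)" "\<lambda>_. z" z]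
  by (simp add: m_nonneg y_nonneg integrable_min)

lemma jump_exponent_continuous:
  "\<lbrakk>z \<longlonglongrightarrow> z'; \<And>n. 0 \<le> Re (z n)\<rbrakk> \<Longrightarrow> (\<lambda>n. jump_exponent M m y (z n)) \<longlonglongrightarrow> jump_exponent M m y z'"
  by (rule jump_exponent_tendsto[where w="\<lambda>x. m x * min (y x) ((y x)\<^sup>2)"])
    (auto simp: m_nonneg y_nonneg integrable_min)

lemma scaleR_kern_of_real:
  "m x *\<^sub>R kern (y x *\<^sub>R (of_real l :: complex)) = of_real (m x * kern (y x * l))"
  using kern_of_real[of "y x * l", where 'a = complex]
  by (simp add: scaleR_conv_of_real)

lemma integrable_jump_real: "0 \<le> l \<Longrightarrow> integrable M (\<lambda>x. m x * kern (y x * l))"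
  using integrable_jump[of "of_real l"] by (simp only: scaleR_kern_of_real complex_of_real_integrable_eq) simp

lemma jump_exponent_of_real:
  "jump_exponent M m y (of_real l :: complex) = of_real (jump_exponent M m y l)"
  by (simp add: jump_exponent_def scaleR_kern_of_real flip: integral_complex_of_real)

lemma mono_doubling_jump_exponent: "mono_doubling (jump_exponent M m y)"
  unfolding mono_doubling_def
proof (intro conjI allI impI)
  let ?f = "jump_exponent M m y :: real \<Rightarrow> real"
  have f: "?f l = (\<integral>x. m x * kern (y x * l) \<partial>M)" for l by (simp add: jump_exponent_def)
  show "continuous_on {0..} ?f"
    unfolding continuous_on_sequentially
  proof (intro allI ballI impI, elim conjE)
    fix l :: "nat \<Rightarrow> real" and l' assume l: "\<forall>n. l n \<in> {0..}" "l \<longlonglongrightarrow> l'"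
    have "(\<lambda>n. jump_exponent M m y (of_real (l n) :: complex)) \<longlonglongrightarrow> jump_exponent M m y (of_real l')"
      using l by (intro jump_exponent_continuous tendsto_of_real) auto
    then show "(?f \<circ> l) \<longlonglongrightarrow> ?f l'"
      by (simp add: jump_exponent_of_real tendsto_of_real_iff o_def)
  qed
  show "mono_on {0..} ?f"
    unfolding f by (intro mono_onI integral_mono integrable_jump_real mult_left_mono kern_mono_real)
      (auto simp: m_nonneg y_nonneg mult_left_mono)
  fix l :: real assume l: "0 \<le> l"
  show "0 \<le> ?f l"
    unfolding f by (intro integral_nonneg_AE AE_I2) (use l in \<open>auto simp: m_nonneg y_nonneg kern_nonneg\<close>)
  have "?f (2 * l) \<le> (\<integral>x. 4 * (m x * kern (y x * l)) \<partial>M)"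
    unfolding f
  proof (intro integral_mono integrable_jump_real integrable_mult_right)
    fix x assume x: "x \<in> space M"
    show "m x * kern (y x * (2 * l)) \<le> 4 * (m x * kern (y x * l))"
      using mult_left_mono[OF kern_double_le[of "y x * l"] m_nonneg[OF x]] y_nonneg[OF x] l
      by (simp add: mult_ac)
  qed (use l in auto)
  then show "?f (2 * l) \<le> 4 * ?f l" by (simp add: f)
qed

lemma jump_exponent_le_linear:
  assumes "integrable M (\<lambda>x. m x * y x)" "0 \<le> l"
  shows "jump_exponent M m y l \<le> l * (\<integral>x. m x * y x \<partial>M)"
proof -
  have "jump_exponent M m y l \<le> (\<integral>x. l * (m x * y x) \<partial>M)"
    unfolding jump_exponent_def real_scaleR_def
  proof (intro integral_mono integrable_jump_real integrable_mult_right)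
    fix x assume x: "x \<in> space M"
    show "m x * kern (y x * l) \<le> l * (m x * y x)"
      using mult_left_mono[OF kern_le_linear[of "y x * l"] m_nonneg[OF x]] y_nonneg[OF x] assms(2)
      by (simp add: mult_ac)
  qed (use assms in auto)
  then show ?thesis by simp
qed

end

section \<open>Power series expansions of Laplace exponents\<close>

text \<open>
  The family \<open>w\<close> consists of the power series coefficients of \<open>r \<mapsto> \<Psi> (a (1 - r))\<close>, and these have the
  signs and the vanishing derivative at 1 that make \<open>r + c \<Psi> (a (1 - r))\<close> the generating function
  of a critical offspring law for small \<open>c > 0\<close>.  The condition is stable under nonnegative
  combinations, so that exponents can be treated one summand at a time.
\<close>

definition branching_coeffs :: "(complex \<Rightarrow> complex) \<Rightarrow> real \<Rightarrow> (nat \<Rightarrow> real) \<Rightarrow> bool" where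
  "branching_coeffs \<Psi> a w \<longleftrightarrow>
     (\<forall>k. k \<noteq> 1 \<longrightarrow> 0 \<le> w k) \<and>
     (\<forall>r. cmod r \<le> 1 \<longrightarrow> (\<lambda>k. of_real (w k) * r ^ k) sums \<Psi> (of_real a * (1 - r))) \<and>
     (\<lambda>k. real k * w k) sums 0"

lemma branching_coeffs_add:
  assumes "branching_coeffs \<Psi> a w" "branching_coeffs \<Phi> a v"
  shows "branching_coeffs (\<lambda>z. \<Psi> z + \<Phi> z) a (\<lambda>k. w k + v k)"
  using assms unfolding branching_coeffs_def
  by (auto simp: distrib_left distrib_right intro!: sums_add) (metis add_0 sums_add)

lemma branching_coeffs_cmult:
  assumes "branching_coeffs \<Psi> a w" "0 \<le> c"
  shows "branching_coeffs (\<lambda>z. of_real c * \<Psi> z) a (\<lambda>k. c * w k)"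
  using assms unfolding branching_coeffs_def
  by (auto simp: mult.assoc mult.left_commute[of _ c] intro!: sums_mult) (metis mult_zero_right sums_mult)

lemma branching_coeffs_kern:
  assumes "0 \<le> e" "0 \<le> a"
  shows "branching_coeffs (\<lambda>z. kern (of_real e * z)) a (kern_coeff (e * a))"
  unfolding branching_coeffs_def
  using kern_coeff_sums[of "e * a"] kern_coeff_nonneg[of "e * a"] kern_coeff_mean_sums assms
  by (simp add: mult.assoc)

lemma branching_coeffs_power2:
  assumes "0 \<le> a"
  shows "branching_coeffs (\<lambda>z. z\<^sup>2) a
     (\<lambda>k. if k = 0 then a\<^sup>2 else if k = 1 then - 2 * a\<^sup>2 else if k = 2 then a\<^sup>2 else 0)" (is "branching_coeffs _ a ?w")
  unfolding branching_coeffs_def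
proof (intro conjI allI impI)
  show "(\<lambda>k. real k * ?w k) sums 0"
    using sums_finite[of "{0,1,2}" "\<lambda>k. real k * ?w k"] by auto
  show "(\<lambda>k. of_real (?w k) * r ^ k) sums (of_real a * (1 - r))\<^sup>2" for r :: complex
  proof -
    have "(\<lambda>k. of_real (?w k) * r ^ k) sums (\<Sum>k\<in>{0,1,2}. of_real (?w k) * r ^ k)"
      by (rule sums_finite) auto
    also have "(\<Sum>k\<in>{0,1,2}. of_real (?w k) * r ^ k) = (of_real a * (1 - r))\<^sup>2"
      by (simp add: power2_eq_square algebra_simps)
    finally show ?thesis .
  qed
qed (use assms in auto)

text \<open>
  Integrating the expansion of the kernel term by term.  Both interchanges of sum and integral are
  dominated by the same function, because \<open>\<Sum>k. \<bar>kern_coeff u k\<bar>\<close> and \<open>\<Sum>k. k \<bar>kern_coeff u k\<bar>\<close> are both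
  equal to \<open>2 u (1 - exp (- u)) \<le> 2 min(u, u\<^sup>2)\<close>.
\<close>

lemma (in jump_family) branching_coeffs_jump_exponent:
  assumes a: "0 < a"
  shows "branching_coeffs (jump_exponent M m y) a (\<lambda>k. \<integral>x. m x * kern_coeff (a * y x) k \<partial>M)"
  unfolding branching_coeffs_def
proof (intro conjI allI impI)
  show "0 \<le> (\<integral>x. m x * kern_coeff (a * y x) k \<partial>M)" if "k \<noteq> 1" for k
    using a that m_nonneg y_nonneg by (intro integral_nonneg_AE AE_I2 mult_nonneg_nonneg kern_coeff_nonneg) auto
  have [measurable]: "(\<lambda>x. kern_coeff (a * y x) k) \<in> borel_measurable M" for k
    unfolding kern_coeff_def by measurable
  define W where "W x = 2 * (a + a\<^sup>2) * (m x * min (y x) ((y x)\<^sup>2))" for x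
  have W: "integrable M W" unfolding W_def by (intro integrable_mult_right integrable_min)
  have bound: "(\<Sum>k<n. c k * (m x * \<bar>kern_coeff (a * y x) k\<bar>)) \<le> W x"
    if x: "x \<in> space M" and c: "\<And>k. 0 \<le> c k"
      and S: "(\<lambda>k. c k * \<bar>kern_coeff (a * y x) k\<bar>) sums (2 * (a * y x * (1 - exp (- (a * y x)))))"
    for n x and c :: "nat \<Rightarrow> real"
  proof -
    have ay: "0 \<le> a * y x" using a y_nonneg[OF x] by simp
    have "(\<Sum>k<n. c k * (m x * \<bar>kern_coeff (a * y x) k\<bar>)) = m x * (\<Sum>k<n. c k * \<bar>kern_coeff (a * y x) k\<bar>)"
      by (simp add: sum_distrib_left mult_ac)
    also have "(\<Sum>k<n. c k * \<bar>kern_coeff (a * y x) k\<bar>) \<le> 2 * (a * y x * (1 - exp (- (a * y x))))"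
      using sum_le_suminf[OF sums_summable[OF S], of "{..<n}"] c by (simp add: sums_unique[OF S])
    also have "\<dots> \<le> 2 * min (a * y x) ((a * y x)\<^sup>2)"
      using mult_one_minus_exp_le_min[OF ay] by simp
    also have "\<dots> \<le> 2 * ((a + a\<^sup>2) * min (y x) ((y x)\<^sup>2))"
    proof -
      have "min (a * y x) ((a * y x)\<^sup>2) \<le> (a + a\<^sup>2) * y x" "min (a * y x) ((a * y x)\<^sup>2) \<le> (a + a\<^sup>2) * (y x)\<^sup>2"
        using a y_nonneg[OF x] by (auto simp: min_def algebra_simps power_mult_distrib intro: add_increasing2 add_increasing
            order_trans[of _ "y x * a"])
      then show ?thesis by (auto simp: min_def)
    qed
    finally have "(\<Sum>k<n. c k * (m x * \<bar>kern_coeff (a * y x) k\<bar>)) \<le>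
        m x * (2 * ((a + a\<^sup>2) * min (y x) ((y x)\<^sup>2)))"
      using m_nonneg[OF x] by (simp add: mult_left_mono)
    also have "\<dots> = W x" by (simp add: W_def)
    finally show ?thesis .
  qed
  have int: "integrable M (\<lambda>x. m x * kern_coeff (a * y x) k)" for k
  proof (rule Bochner_Integration.integrable_bound[OF W])
    show "AE x in M. norm (m x * kern_coeff (a * y x) k) \<le> norm (W x)"
    proof (rule AE_I2)
      fix x assume x: "x \<in> space M"
      have ay: "0 \<le> a * y x" using a y_nonneg[OF x] by simp
      have "\<bar>m x * kern_coeff (a * y x) k\<bar> \<le> (\<Sum>j<Suc k. 1 * (m x * \<bar>kern_coeff (a * y x) j\<bar>))"
        using m_nonneg[OF x] by (simp add: abs_mult sum_nonneg)
      also have "\<dots> \<le> W x"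
        using bound[OF x, of "\<lambda>_. 1" "Suc k"] abs_kern_coeff_sums[OF ay] by simp
      finally show "norm (m x * kern_coeff (a * y x) k) \<le> norm (W x)" by simp
    qed
  qed simp
  show "(\<lambda>k. of_real (\<integral>x. m x * kern_coeff (a * y x) k \<partial>M) * r ^ k) sums
      jump_exponent M m y (of_real a * (1 - r))" if r: "cmod r \<le> 1" for r
  proof -
    let ?s = "\<lambda>n x. \<Sum>k<n. of_real (m x * kern_coeff (a * y x) k) * r ^ k"
    have "(\<lambda>n. \<integral>x. ?s n x \<partial>M) \<longlonglongrightarrow> (\<integral>x. m x *\<^sub>R kern (y x *\<^sub>R (of_real a * (1 - r))) \<partial>M)"
    proof (rule integral_dominated_convergence[OF _ _ W])
      show "AE x in M. (\<lambda>n. ?s n x) \<longlonglongrightarrow> m x *\<^sub>R kern (y x *\<^sub>R (of_real a * (1 - r)))"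
        using sums_mult[OF kern_coeff_sums[of "a * y x" r for x], of "of_real (m x)" for x]
        by (intro AE_I2) (simp add: sums_def scaleR_conv_of_real mult_ac)
      show "AE x in M. norm (?s n x) \<le> W x" for n
      proof (rule AE_I2)
        fix x assume x: "x \<in> space M"
        have ay: "0 \<le> a * y x" using a y_nonneg[OF x] by simp
        have "norm (?s n x) \<le> (\<Sum>k<n. 1 * (m x * \<bar>kern_coeff (a * y x) k\<bar>))"
        proof (rule order_trans[OF norm_sum sum_mono])
          fix k
          have "m x * \<bar>kern_coeff (a * y x) k\<bar> * cmod r ^ k \<le> m x * \<bar>kern_coeff (a * y x) k\<bar> * 1"
            using m_nonneg[OF x] r by (intro mult_left_mono power_le_one) auto
          then show "norm (of_real (m x * kern_coeff (a * y x) k) * r ^ k) \<le> 1 * (m x * \<bar>kern_coeff (a * y x) k\<bar>)"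
            using m_nonneg[OF x] by (simp add: norm_mult norm_power abs_mult)
        qed
        also have "\<dots> \<le> W x"
          using bound[OF x, of "\<lambda>_. 1" n] abs_kern_coeff_sums[OF ay] by simp
        finally show "norm (?s n x) \<le> W x" .
      qed
    qed measurable
    moreover have "(\<integral>x. ?s n x \<partial>M) = (\<Sum>k<n. of_real (\<integral>x. m x * kern_coeff (a * y x) k \<partial>M) * r ^ k)" for n
      by (subst Bochner_Integration.integral_sum) (auto intro!: integrable_mult_left integrable_of_real int simp del: of_real_mult)
    ultimately show ?thesis by (simp add: sums_def jump_exponent_def)
  qed
  show "(\<lambda>k. real k * (\<integral>x. m x * kern_coeff (a * y x) k \<partial>M)) sums 0"
  proof -
    let ?s = "\<lambda>n x. \<Sum>k<n. real k * (m x * kern_coeff (a * y x) k)"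
    have "(\<lambda>n. \<integral>x. ?s n x \<partial>M) \<longlonglongrightarrow> (\<integral>x. 0 \<partial>M)"
    proof (rule integral_dominated_convergence[OF _ _ W])
      show "AE x in M. (\<lambda>n. ?s n x) \<longlonglongrightarrow> 0"
        using sums_mult[OF kern_coeff_mean_sums[of "a * y x" for x], of "m x" for x]
        by (intro AE_I2) (simp add: sums_def mult_ac)
      show "AE x in M. norm (?s n x) \<le> W x" for n
      proof (rule AE_I2)
        fix x assume x: "x \<in> space M"
        have ay: "0 \<le> a * y x" using a y_nonneg[OF x] by simp
        have "norm (?s n x) \<le> (\<Sum>k<n. real k * (m x * \<bar>kern_coeff (a * y x) k\<bar>))"
          using m_nonneg[OF x] by (intro order_trans[OF norm_sum sum_mono]) (simp add: abs_mult)
        also have "\<dots> \<le> W x"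
          using bound[OF x, of real n] abs_kern_coeff_mean_sums[OF ay] by simp
        finally show "norm (?s n x) \<le> W x" .
      qed
    qed measurable
    moreover have "(\<integral>x. ?s n x \<partial>M) = (\<Sum>k<n. real k * (\<integral>x. m x * kern_coeff (a * y x) k \<partial>M))" for n
      by (subst Bochner_Integration.integral_sum) (auto intro!: integrable_mult_right int)
    ultimately show ?thesis by (simp add: sums_def)
  qed
qed

section \<open>Weak limits from Laplace transforms\<close>

text \<open>
  The functions \<open>exp (- l x)\<close> are unbounded, so weak convergence is applied to their truncations
  \<open>min (exp (- l x)) K\<close>.  The truncation error is at most \<open>exp (- 2 l x) / K\<close>, whose integrals are
  \<open>O(1 / K)\<close> uniformly in \<open>n\<close> because the transforms at \<open>2 l\<close> converge too.
\<close>

lemma laplace_limit_of_weak_limit: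
  assumes M: "\<And>n. real_distribution (M n)" and X: "real_distribution X" and wc: "weak_conv_m M X"
    and int: "\<And>n l. 0 \<le> l \<Longrightarrow> integrable (M n) (\<lambda>x. exp (- l * x))"
    and conv: "\<And>l. 0 \<le> l \<Longrightarrow> (\<lambda>n. \<integral>x. exp (- l * x) \<partial>M n) \<longlonglongrightarrow> F l"
    and l: "(0::real) \<le> l"
  shows "has_bochner_integral X (\<lambda>x. exp (- l * x)) (F l)"
proof -
  interpret M: real_distribution "M n" for n by (rule M)
  interpret X: real_distribution X by (rule X)
  define g where "g K x = min (exp (- l * x)) K" for K x :: real
  have g_cont: "isCont (g K) x" for K x
    unfolding g_def by (intro continuous_intros)
  have g_bd: "norm (g K x) \<le> K" if "0 < K" for K x
    using that by (auto simp: g_def min_def)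
  have [measurable]: "g K \<in> borel_measurable borel" for K
    unfolding g_def by measurable
  have g_int_M: "integrable (M n) (g K)" if "0 < K" for n K
    by (rule M.integrable_const_bound[where B = K]) (use g_bd[OF that] in auto)
  have g_int_X: "integrable X (g K)" if "0 < K" for K
    by (rule X.integrable_const_bound[where B = K]) (use g_bd[OF that] in auto)
  have lim: "(\<lambda>n. integral\<^sup>L (M n) (g K)) \<longlonglongrightarrow> integral\<^sup>L X (g K)" if "0 < K" for K
    using weak_conv_imp_integral_bdd_continuous_conv[OF M X wc g_cont g_bd[OF that]] .
  have upper: "integral\<^sup>L X (g K) \<le> F l" if K: "0 < K" for K
    by (rule LIMSEQ_le[OF lim[OF K] conv[OF l]])
      (intro exI allI impI integral_mono g_int_M K int l, simp add: g_def)
  have lower: "F l - F (2 * l) / K \<le> integral\<^sup>L X (g K)" if K: "0 < K" for K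
  proof (rule LIMSEQ_le[OF tendsto_diff[OF conv[OF l] tendsto_divide[OF conv[of "2 * l"] tendsto_const]] lim[OF K]])
    have "(\<integral>x. exp (- l * x) - exp (- (2 * l) * x) / K \<partial>M n) \<le> integral\<^sup>L (M n) (g K)" for n
    proof (intro integral_mono g_int_M K Bochner_Integration.integrable_diff integrable_divide int l)
      fix x
      define t where "t = exp (- l * x)"
      have "exp (- (2 * l) * x) = t\<^sup>2"
        by (simp add: t_def power2_eq_square flip: exp_add)
      moreover have t: "0 < t" by (simp add: t_def)
      have "2 * (K * t) \<le> K * K + t * t"
        using sum_squares_bound[of K t] by (simp add: power2_eq_square mult.assoc)
      then have "K * t \<le> K * K + t * t"
        using mult_pos_pos[OF K t] by linarith
      then have "t - t\<^sup>2 / K \<le> min t K"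
        using K t
        by (auto simp: min_def field_simps power2_eq_square)
      ultimately show "exp (- l * x) - exp (- (2 * l) * x) / K \<le> g K x"
        by (simp add: g_def t_def)
    qed (use l in auto)
    then show "\<exists>N. \<forall>n\<ge>N. (\<integral>x. exp (- l * x) \<partial>M n) - (\<integral>x. exp (- (2 * l) * x) \<partial>M n) / K \<le> integral\<^sup>L (M n) (g K)"
      using Bochner_Integration.integral_diff[OF int[OF l] integrable_divide[OF int[of "2 * l"]]] l
      by simp
  qed (use l K in auto)
  show ?thesis
  proof (rule has_bochner_integral_monotone_convergence[where f = "\<lambda>i. g (real (Suc i))"])
    show "integrable X (g (real (Suc i)))" for i by (rule g_int_X) simp
    show "AE x in X. mono (\<lambda>i. g (real (Suc i)) x)"
      by (auto simp: g_def mono_def)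
    show "AE x in X. (\<lambda>i. g (real (Suc i)) x) \<longlonglongrightarrow> exp (- l * x)"
    proof (rule AE_I2)
      fix x
      obtain N where N: "exp (- l * x) \<le> real N" using real_arch_simple by blast
      have "\<forall>\<^sub>F i in sequentially. g (real (Suc i)) x = exp (- l * x)"
        unfolding eventually_sequentially by (intro exI[of _ N]) (use N in \<open>auto simp: g_def min_def\<close>)
      then show "(\<lambda>i. g (real (Suc i)) x) \<longlonglongrightarrow> exp (- l * x)"
        by (rule tendsto_eventually)
    qed
    show "(\<lambda>i. integral\<^sup>L X (g (real (Suc i)))) \<longlonglongrightarrow> F l"
    proof (rule tendsto_sandwich)
      show "\<forall>\<^sub>F i in sequentially. F l - F (2 * l) * inverse (real (Suc i)) \<le> integral\<^sup>L X (g (real (Suc i)))"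
        using lower by (auto simp: divide_inverse intro!: always_eventually simp del: of_nat_Suc)
      show "\<forall>\<^sub>F i in sequentially. integral\<^sup>L X (g (real (Suc i))) \<le> F l"
        using upper by (auto intro!: always_eventually simp del: of_nat_Suc)
      show "(\<lambda>i. F l - F (2 * l) * inverse (real (Suc i))) \<longlonglongrightarrow> F l"
        by (rule tendsto_eq_intros LIMSEQ_inverse_real_of_nat refl)+ simp
    qed simp
  qed simp
qed

text \<open>
  Convergence of the transforms on the closed half-plane yields a limit law without knowing one
  beforehand.  Tightness comes from the mean: since \<open>\<bar>x\<bar> \<le> x + 2 exp (- x)\<close> and the laws are centred,
  their first absolute moments are at most twice their transforms at 1.  On the imaginary axis the
  transforms are characteristic functions, so all subsequential limits coincide; on the positive
  real axis they give the Laplace transform of the limit.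
\<close>

theorem weak_limit_of_laplace_transforms:
  fixes M :: "nat \<Rightarrow> real measure" and F :: "complex \<Rightarrow> complex"
  assumes M: "\<And>n. real_distribution (M n)"
    and int: "\<And>n l. 0 \<le> l \<Longrightarrow> integrable (M n) (\<lambda>x. exp (- l * x))"
    and conv: "\<And>z. 0 \<le> Re z \<Longrightarrow> (\<lambda>n. \<integral>x. exp (- z * of_real x) \<partial>M n) \<longlonglongrightarrow> F z"
    and mean: "\<And>n. has_bochner_integral (M n) (\<lambda>x. x) 0"
  shows "\<exists>X. real_distribution X \<and> weak_conv_m M X \<and>
    (\<forall>l\<ge>0. has_bochner_integral X (\<lambda>x. exp (- l * x)) (Re (F (of_real l))))"
proof -
  interpret M: real_distribution "M n" for n by (rule M)
  have conv_real: "(\<lambda>n. \<integral>x. exp (- l * x) \<partial>M n) \<longlonglongrightarrow> Re (F (of_real l))" if "0 \<le> l" for l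
  proof -
    have "(\<integral>x. exp (- of_real l * of_real x) \<partial>M n) = complex_of_real (\<integral>x. exp (- l * x) \<partial>M n)" for n
      by (simp add: exp_of_real flip: of_real_minus of_real_mult integral_complex_of_real)
    with tendsto_Re[OF conv[of "of_real l"]] that show ?thesis by simp
  qed
  obtain C where C: "\<And>n. (\<integral>x. exp (- x) \<partial>M n) \<le> C" "0 < C"
  proof -
    have "Bseq (\<lambda>n. \<integral>x. exp (- x) \<partial>M n)"
      using convergent_imp_Bseq[OF convergentI[OF conv_real[of 1]]] by simp
    then show ?thesis using that by (auto simp: Bseq_def dest: abs_le_D1)
  qed
  have abs_mean: "integrable (M n) (\<lambda>x. \<bar>x\<bar>)" "(\<integral>x. \<bar>x\<bar> \<partial>M n) \<le> 2 * C" for n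
  proof -
    have i: "integrable (M n) (\<lambda>x. x)" using mean[of n] by (rule integrable.intros)
    then show "integrable (M n) (\<lambda>x. \<bar>x\<bar>)" by simp
    have e: "integrable (M n) (\<lambda>x. exp (- x))" using int[of 1 n] by simp
    have "(\<integral>x. \<bar>x\<bar> \<partial>M n) \<le> (\<integral>x. x + 2 * exp (- x) \<partial>M n)"
    proof (intro integral_mono)
      fix x :: real
      show "\<bar>x\<bar> \<le> x + 2 * exp (- x)"
        using exp_ge_add_one_self[of "-x"] exp_gt_zero[of "-x"] by linarith
    qed (use i e in auto)
    also have "\<dots> = 2 * (\<integral>x. exp (- x) \<partial>M n)"
      using i e has_bochner_integral_integral_eq[OF mean[of n]] by simp
    finally show "(\<integral>x. \<bar>x\<bar> \<partial>M n) \<le> 2 * C" using C(1)[of n] by simp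
  qed
  have "tight M"
    unfolding tight_def
  proof (intro conjI allI impI M)
    fix \<epsilon> :: real assume \<epsilon>: "0 < \<epsilon>"
    define K where "K = 4 * C / \<epsilon>"
    have K: "0 < K" using C \<epsilon> by (simp add: K_def)
    have "1 - \<epsilon> < measure (M n) {- K<..K}" for n
    proof -
      have "measure (M n) {x \<in> space (M n). \<bar>x\<bar> \<ge> K} \<le> (\<integral>x. \<bar>x\<bar> \<partial>M n) / K"
        by (rule integral_Markov_inequality_measure[where A = "{}"]) (use abs_mean K in auto)
      also have "\<dots> \<le> 2 * C / K" using abs_mean(2)[of n] K by (simp add: divide_right_mono)
      also have "\<dots> < \<epsilon>" using \<epsilon> C by (simp add: K_def)
      finally have 1: "measure (M n) {x. \<bar>x\<bar> \<ge> K} < \<epsilon>" by simp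
      have "1 = measure (M n) UNIV" using M.prob_space[of n] by simp
      also have "\<dots> \<le> measure (M n) ({- K<..K} \<union> {x. \<bar>x\<bar> \<ge> K})"
        by (intro M.finite_measure_mono) auto
      also have "\<dots> \<le> measure (M n) {- K<..K} + measure (M n) {x. \<bar>x\<bar> \<ge> K}"
        by (intro measure_Un_le) auto
      finally show ?thesis using 1 by simp
    qed
    then show "\<exists>a b. a < b \<and> (\<forall>n. 1 - \<epsilon> < measure (M n) {a<..b})"
      using K by (intro exI[of _ "-K"] exI[of _ K]) auto
  qed
  then obtain r X where r: "strict_mono r" and X: "real_distribution X" and wX: "weak_conv_m (M \<circ> r) X"
    using tight_imp_convergent_subsubsequence[of M id] by (auto simp: strict_mono_def)
  have char_lim: "char \<nu> t = F (- (\<i> * of_real t))"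
    if s: "strict_mono s" and \<nu>: "real_distribution \<nu>" and w: "weak_conv_m (M \<circ> s) \<nu>" for s \<nu> t
  proof (rule LIMSEQ_unique)
    show "(\<lambda>n. char ((M \<circ> s) n) t) \<longlonglongrightarrow> char \<nu> t"
      by (rule levy_continuity1[OF _ \<nu> w]) (simp add: M)
    have "(\<lambda>n. char (M n) t) \<longlonglongrightarrow> F (- (\<i> * of_real t))"
      using conv[of "- (\<i> * of_real t)"] by (simp add: char_def mult.assoc)
    from LIMSEQ_subseq_LIMSEQ[OF this s]
    show "(\<lambda>n. char ((M \<circ> s) n) t) \<longlonglongrightarrow> F (- (\<i> * of_real t))" by (simp add: o_def)
  qed
  have "weak_conv_m M X"
  proof (rule tight_subseq_weak_converge[OF M X \<open>tight M\<close>])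
    fix s \<nu> assume s: "strict_mono s" "real_distribution \<nu>" "weak_conv_m (M \<circ> s) \<nu>"
    have "\<nu> = X"
      by (rule Levy_uniqueness[OF s(2) X]) (simp add: fun_eq_iff char_lim[OF s] char_lim[OF r X wX])
    with s(3) show "weak_conv_m (M \<circ> s) X" by simp
  qed
  then show ?thesis
    using X laplace_limit_of_weak_limit[OF M X _ int conv_real] by blast
qed

section \<open>The rescaled random walk\<close>

lemma prob_space_jump_space: "prob_space (jump_space p)"
  unfolding jump_space_def by (intro prob_space_PiM prob_space_measure_pmf)

lemma measurable_jump [measurable]: "(\<lambda>\<xi>. \<xi> i) \<in> measurable (jump_space p) (count_space UNIV)"
proof -
  have "(\<lambda>\<xi>. \<xi> i) \<in> measurable (jump_space p) (measure_pmf (map_pmf (\<lambda>k. int k - 1) p))"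
    unfolding jump_space_def by (rule measurable_component_singleton) simp
  then show ?thesis by (simp cong: measurable_cong_sets)
qed

lemma distr_jump: "distr (jump_space p) (count_space UNIV) (\<lambda>\<xi>. \<xi> i) = measure_pmf (map_pmf (\<lambda>k. int k - 1) p)"
proof -
  have "distr (jump_space p) (measure_pmf (map_pmf (\<lambda>k. int k - 1) p)) (\<lambda>\<xi>. \<xi> i)
      = measure_pmf (map_pmf (\<lambda>k. int k - 1) p)"
    unfolding jump_space_def
    by (rule distr_PiM_component) (auto intro: prob_space_measure_pmf)
  moreover have "distr (jump_space p) (measure_pmf (map_pmf (\<lambda>k. int k - 1) p)) (\<lambda>\<xi>. \<xi> i) =
      distr (jump_space p) (count_space UNIV) (\<lambda>\<xi>. \<xi> i)"
    by (rule distr_cong) simp_all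
  ultimately show ?thesis by simp
qed

lemma indep_vars_jumps:
  fixes f :: "int \<Rightarrow> 'b::topological_space"
  shows "prob_space.indep_vars (jump_space p) (\<lambda>_. borel) (\<lambda>i \<xi>. f (\<xi> i)) I"
proof -
  interpret prob_space "jump_space p" by (rule prob_space_jump_space)
  let ?P = "measure_pmf (map_pmf (\<lambda>k. int k - 1) p)"
  have ms: "(\<lambda>\<xi>. \<xi> i) \<in> measurable (jump_space p) ?P" for i
    unfolding jump_space_def by (rule measurable_component_singleton) simp
  have "indep_vars (\<lambda>_. ?P) (\<lambda>i \<xi>. \<xi> i) UNIV"
  proof (subst indep_vars_iff_distr_eq_PiM)
    have "distr (jump_space p) (Pi\<^sub>M UNIV (\<lambda>_. ?P)) (\<lambda>x. \<lambda>i\<in>UNIV. x i) = jump_space p"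
      unfolding jump_space_def restrict_UNIV by (rule distr_id)
    also have "\<dots> = Pi\<^sub>M UNIV (\<lambda>i. distr (jump_space p) ?P (\<lambda>\<xi>. \<xi> i))"
    proof -
      have "distr (jump_space p) ?P (\<lambda>\<xi>. \<xi> i) = ?P" for i
        unfolding jump_space_def
        by (rule distr_PiM_component) (auto intro: prob_space_measure_pmf)
      then show ?thesis by (simp add: jump_space_def)
    qed
    finally show "distr (jump_space p) (Pi\<^sub>M UNIV (\<lambda>_. ?P)) (\<lambda>x. \<lambda>i\<in>UNIV. x i) =
      Pi\<^sub>M UNIV (\<lambda>i. distr (jump_space p) ?P (\<lambda>\<xi>. \<xi> i))" .
  qed (use ms in auto)
  then have "indep_vars (\<lambda>_. borel) (\<lambda>i. f \<circ> (\<lambda>\<xi>. \<xi> i)) UNIV"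
    by (rule indep_vars_compose) simp
  then show ?thesis using indep_vars_subset[of _ _ UNIV I] by (simp add: comp_def)
qed

lemma pmf_nat_sums_1: "(\<lambda>k::nat. pmf p k) sums 1"
  using sums_integral_count_space_nat[OF integrable_pmf[of UNIV p]] integral_pmf[of UNIV p]
  by simp

lemma has_bochner_integral_pmf_nat:
  fixes f :: "nat \<Rightarrow> 'a::{banach, second_countable_topology}"
  assumes s: "(\<lambda>k. pmf p k *\<^sub>R f k) sums S" and abs: "summable (\<lambda>k. pmf p k * norm (f k))"
  shows "has_bochner_integral (measure_pmf p) f S"
proof -
  have i: "integrable (count_space UNIV) (\<lambda>k. pmf p k *\<^sub>R f k)"
    using abs by (simp add: integrable_count_space_nat_iff)
  from sums_integral_count_space_nat[OF i] s
  have "(\<integral>k. pmf p k *\<^sub>R f k \<partial>count_space UNIV) = S" by (rule sums_unique2)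
  with i show ?thesis
    by (simp add: measure_pmf_eq_density has_bochner_integral_iff integrable_density integral_density)
qed

lemma has_bochner_integral_jump:
  fixes f :: "int \<Rightarrow> 'a::{banach, second_countable_topology}"
  assumes "(\<lambda>k. pmf p k *\<^sub>R f (int k - 1)) sums S" and "summable (\<lambda>k. pmf p k * norm (f (int k - 1)))"
  shows "has_bochner_integral (jump_space p) (\<lambda>\<xi>. f (\<xi> i)) S"
proof -
  have "has_bochner_integral (measure_pmf p) (\<lambda>k. f (int k - 1)) S"
    using assms by (rule has_bochner_integral_pmf_nat)
  then have "has_bochner_integral (measure_pmf (map_pmf (\<lambda>k. int k - 1) p)) f S"
    by (simp add: has_bochner_integral_iff map_pmf_rep_eq integrable_distr_eq integral_distr)
  then have "has_bochner_integral (distr (jump_space p) (count_space UNIV) (\<lambda>\<xi>. \<xi> i)) f S"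
    by (simp add: distr_jump)
  then show ?thesis
    by (simp add: has_bochner_integral_iff integrable_distr_eq integral_distr)
qed

lemma walk_mean:
  assumes "critical_offspring p"
  shows "has_bochner_integral (jump_space p) (\<lambda>\<xi>. c * real_of_int (walk N \<xi>)) 0"
proof -
  have m: "(\<lambda>k. real k * pmf p k) sums 1" using assms by (simp add: critical_offspring_def)
  note one = pmf_nat_sums_1[of p]
  have "has_bochner_integral (jump_space p) (\<lambda>\<xi>. real_of_int (\<xi> i)) 0" for i
  proof (rule has_bochner_integral_jump)
    show "(\<lambda>k. pmf p k *\<^sub>R real_of_int (int k - 1)) sums 0"
      using sums_diff[OF m one] by (simp add: algebra_simps)
    have "summable (\<lambda>k. real k * pmf p k + pmf p k)"
      using m one by (intro summable_add) (auto dest: sums_summable)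
    then show "summable (\<lambda>k. pmf p k * norm (real_of_int (int k - 1)))"
    proof (rule summable_comparison_test')
      fix k :: nat
      have "pmf p k * \<bar>real k - 1\<bar> \<le> pmf p k * (real k + 1)" by (rule mult_left_mono) auto
      then show "norm (pmf p k * norm (real_of_int (int k - 1))) \<le> real k * pmf p k + pmf p k"
        by (simp add: abs_mult algebra_simps)
    qed
  qed
  then have "has_bochner_integral (jump_space p) (\<lambda>\<xi>. \<Sum>i<N. real_of_int (\<xi> i)) (\<Sum>i<N. 0)"
    by (rule has_bochner_integral_sum)
  then have "has_bochner_integral (jump_space p) (\<lambda>\<xi>. c * (\<Sum>i<N. real_of_int (\<xi> i))) (c * 0)"
    by (intro has_bochner_integral_mult_right) simp
  then show ?thesis by (simp add: walk_def)
qed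

text \<open>
  The law of the jump is shifted by one, which produces the factor \<open>exp (c z)\<close> in front of the
  generating function \<open>G\<close>.
\<close>

lemma walk_laplace:
  fixes z :: complex
  assumes c: "0 \<le> c" and z: "0 \<le> Re z"
    and g: "(\<lambda>k. of_real (pmf p k) * exp (- (of_real c * z)) ^ k) sums G"
  shows "has_bochner_integral (jump_space p) (\<lambda>\<xi>. exp (- z * of_real (c * real_of_int (walk N \<xi>))))
    ((exp (of_real c * z) * G) ^ N)"
proof -
  interpret prob_space "jump_space p" by (rule prob_space_jump_space)
  let ?f = "\<lambda>j::int. exp (- z * of_real (c * real_of_int j))"
  have eq: "?f (int k - 1) = exp (of_real c * z) * exp (- (of_real c * z)) ^ k" for k
    by (simp add: algebra_simps flip: exp_add exp_of_nat_mult)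
  have j: "has_bochner_integral (jump_space p) (\<lambda>\<xi>. ?f (\<xi> i)) (exp (of_real c * z) * G)" for i
  proof (rule has_bochner_integral_jump)
    show "(\<lambda>k. pmf p k *\<^sub>R ?f (int k - 1)) sums (exp (of_real c * z) * G)"
      using sums_mult[OF g, of "exp (of_real c * z)"] unfolding eq scaleR_conv_of_real
      by (simp add: mult_ac)
    have "summable (\<lambda>k. cmod (exp (of_real c * z)) * pmf p k)"
      by (intro summable_mult sums_summable[OF pmf_nat_sums_1])
    then show "summable (\<lambda>k. pmf p k * norm (?f (int k - 1)))"
    proof (rule summable_comparison_test')
      fix k :: nat
      have "cmod (exp (- (of_real c * z)) ^ k) \<le> 1"
        using c z by (simp add: norm_power power_le_one)
      then show "norm (pmf p k * norm (?f (int k - 1))) \<le> cmod (exp (of_real c * z)) * pmf p k"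
        unfolding eq norm_mult by (simp add: mult_left_le mult_left_mono mult_ac)
    qed
  qed
  have ind: "indep_vars (\<lambda>_. borel) (\<lambda>i \<xi>. ?f (\<xi> i)) {..<N}" by (rule indep_vars_jumps)
  have int: "integrable (jump_space p) (\<lambda>\<xi>. ?f (\<xi> i))" for i using j by (rule integrable.intros)
  have "has_bochner_integral (jump_space p) (\<lambda>\<xi>. \<Prod>i<N. ?f (\<xi> i)) (\<Prod>i<N. exp (of_real c * z) * G)"
    using indep_vars_lebesgue_integral[OF _ ind int] indep_vars_integrable[OF _ ind int]
      has_bochner_integral_integral_eq[OF j]
    by (simp add: has_bochner_integral_iff)
  moreover have "(\<Prod>i<N. ?f (\<xi> i)) = exp (- z * of_real (c * real_of_int (walk N \<xi>)))" for \<xi>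
    by (simp add: walk_def sum_distrib_left flip: exp_sum)
  ultimately show ?thesis by simp
qed

section \<open>Offspring laws with prescribed exponent\<close>

text \<open>
  Take \<open>D = - w 1\<close>, \<open>b = D / (1 - q)\<close> and \<open>p(k) = [k = 1] + w k / b\<close>: this choice gives mass \<open>q\<close> to 1.  The
  sums \<open>\<Sum>k. w k = \<Psi> 0 = 0\<close> and \<open>\<Sum>k. k w k = 0\<close> make \<open>p\<close> a probability with mean 1.  They also give
  \<open>\<Psi> a \<le> D \<le> 2 \<Psi> a\<close>: as \<open>w 0 = \<Psi> a\<close>, the first one says that the coefficients from 2 on add up to
  \<open>D - \<Psi> a\<close>, and by the second one they add up to \<open>D\<close> once weighted by \<open>k \<ge> 2\<close>.
\<close>

lemma offspring_law_of_branching_coeffs: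
  assumes bc: "branching_coeffs \<Psi> a w" and \<Psi>0: "\<Psi> 0 = 0"
    and pos: "0 < Re (\<Psi> (of_real a))" and q: "0 < q" "q < 1"
  obtains b p where "Re (\<Psi> (of_real a)) \<le> (1 - q) * b" "(1 - q) * b \<le> 2 * Re (\<Psi> (of_real a))"
    "critical_offspring p" "pmf p 1 = q"
    "\<And>r. cmod r \<le> 1 \<Longrightarrow>
       (\<lambda>k. of_real (pmf p k) * r ^ k) sums (r + \<Psi> (of_real a * (1 - r)) / of_real b)"
proof -
  have w_nonneg: "0 \<le> w k" if "k \<noteq> 1" for k
    using bc that by (auto simp: branching_coeffs_def)
  have gen: "(\<lambda>k. of_real (w k) * r ^ k) sums \<Psi> (of_real a * (1 - r))" if "cmod r \<le> 1" for r
    using bc that by (auto simp: branching_coeffs_def)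
  have mean: "(\<lambda>k. real k * w k) sums 0" using bc by (simp add: branching_coeffs_def)
  have \<Psi>a: "\<Psi> (of_real a) = of_real (w 0)"
    using sums_unique2[OF gen[of 0] powser_sums_zero[of "\<lambda>k. of_real (w k)"]] by simp
  then have w0: "0 < w 0" using pos by simp
  have total: "w sums 0"
    using gen[of 1] \<Psi>0 sums_of_real_iff[where c = 0 and f = w and 'a = complex] by simp
  define D where "D = - w 1"
  have tail_total: "(\<lambda>k. w (Suc (Suc k))) sums (D - w 0)"
    using total sums_Suc_iff[of w "- w 0"] sums_Suc_iff[of "\<lambda>k. w (Suc k)" "D - w 0"]
    by (simp add: D_def)
  have tail_mean: "(\<lambda>k. real (Suc (Suc k)) * w (Suc (Suc k))) sums D"
    using mean sums_Suc_iff[of "\<lambda>k. real k * w k" 0] sums_Suc_iff[of "\<lambda>k. real (Suc k) * w (Suc k)" D]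
    by (simp add: D_def)
  have D_ge: "w 0 \<le> D"
    using sums_le[OF _ sums_zero tail_total] w_nonneg by simp
  have D_le: "D \<le> 2 * w 0"
  proof -
    have "2 * (D - w 0) \<le> D"
    proof (rule sums_le[OF _ sums_mult[OF tail_total] tail_mean])
      show "2 * w (Suc (Suc k)) \<le> real (Suc (Suc k)) * w (Suc (Suc k))" for k
        using w_nonneg[of "Suc (Suc k)"] by (intro mult_right_mono) auto
    qed
    then show ?thesis by simp
  qed
  have D_pos: "0 < D" using D_ge w0 by simp
  define b where "b = D / (1 - q)"
  have b: "(1 - q) * b = D" "0 < b" using q D_pos by (auto simp: b_def)
  define f where "f k = (if k = 1 then 1 else 0) + w k / b" for k
  have f1: "f 1 = q" using q D_pos by (simp add: f_def b_def D_def field_simps)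
  have f_nonneg: "0 \<le> f k" for k
    using f1 q w_nonneg[of k] b by (cases "k = 1") (auto simp: f_def)
  have f_gen: "(\<lambda>k. of_real (f k) * r ^ k) sums (r + \<Psi> (of_real a * (1 - r)) / of_real b)"
    if "cmod r \<le> 1" for r :: complex
  proof -
    have "(\<lambda>k. (if k = 0 then 0 else if k = 1 then r else 0) + of_real (w k) * r ^ k / of_real b) sums
       ((0 + r) + \<Psi> (of_real a * (1 - r)) / of_real b)"
      by (intro sums_add sums_if_01 sums_divide gen that)
    also have "(\<lambda>k. (if k = 0 then 0 else if k = 1 then r else 0) + of_real (w k) * r ^ k / of_real b)
      = (\<lambda>k. of_real (f k) * r ^ k)"
      by (auto simp: f_def algebra_simps)
    finally show ?thesis by simp
  qed
  have f_sums: "f sums 1"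
    using f_gen[of 1] \<Psi>0 sums_of_real_iff[where c = 1 and f = f and 'a = complex] by simp
  have f_mean: "(\<lambda>k. real k * f k) sums 1"
  proof -
    have "(\<lambda>k. (if k = 0 then 0 else if k = 1 then 1 else 0) + real k * w k / b) sums ((0 + 1) + 0 / b)"
      by (intro sums_add sums_if_01 sums_divide mean)
    also have "(\<lambda>k. (if k = 0 then 0 else if k = 1 then 1 else 0) + real k * w k / b) = (\<lambda>k. real k * f k)"
      by (auto simp: f_def algebra_simps)
    finally show ?thesis by simp
  qed
  define p where "p = embed_pmf f"
  have p: "pmf p k = f k" for k
    unfolding p_def
  proof (rule pmf_embed_pmf)
    show "(\<integral>\<^sup>+k. ennreal (f k) \<partial>count_space UNIV) = 1"
      using f_sums f_nonneg
      by (simp add: nn_integral_count_space_nat suminf_ennreal2 sums_summable sums_unique[symmetric])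
  qed (rule f_nonneg)
  \<comment> \<open>If \<open>w 0 = D\<close>, all coefficients from 2 on vanish, and so does their weighted sum \<open>D\<close>.
    This is what makes the masses of 0 and 1 add up to less than 1.\<close>
  have "w 0 \<noteq> D"
  proof
    assume "w 0 = D"
    with tail_total have 0: "(\<lambda>k. w (Suc (Suc k))) sums 0" by simp
    have "w (Suc (Suc k)) = 0" for k
      using suminf_eq_zero_iff[OF sums_summable[OF 0]] sums_unique[OF 0] w_nonneg by simp
    with tail_mean have "(\<lambda>k. 0) sums D" by simp
    then have "D = 0" by (rule sums_unique2[OF _ sums_zero])
    with D_pos show False by simp
  qed
  then have "w 0 / D < 1" using D_ge D_pos by simp
  then have "(1 - q) * (w 0 / D) < (1 - q) * 1" using q by (intro mult_strict_left_mono) auto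
  then have "w 0 / b < 1 - q" by (simp add: b_def mult.commute)
  then have "critical_offspring p"
    using f_mean f1 by (simp add: critical_offspring_def p) (simp add: f_def)
  then show ?thesis
    using that[of b p] D_ge D_le f1 f_gen b by (simp add: p \<Psi>a)
qed

section \<open>Convergence in law of the rescaled walk\<close>

lemma tendsto_nat_floor_divide:
  assumes "filterlim b at_top F"
  shows "((\<lambda>n. real (nat \<lfloor>b n\<rfloor>) / b n) \<longlongrightarrow> (1::real)) F"
proof (rule tendsto_sandwich)
  have ev: "\<forall>\<^sub>F n in F. 0 < b n" using assms by (simp add: filterlim_at_top_dense)
  show "\<forall>\<^sub>F n in F. 1 - inverse (b n) \<le> real (nat \<lfloor>b n\<rfloor>) / b n"
    using ev
  proof eventually_elim
    case (elim n)
    have "b n - 1 \<le> real (nat \<lfloor>b n\<rfloor>)" by linarith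
    then have "(b n - 1) / b n \<le> real (nat \<lfloor>b n\<rfloor>) / b n" using elim by (intro divide_right_mono) auto
    then show ?case using elim by (simp add: diff_divide_distrib inverse_eq_divide)
  qed
  show "\<forall>\<^sub>F n in F. real (nat \<lfloor>b n\<rfloor>) / b n \<le> 1"
    using ev by eventually_elim (auto simp: divide_le_eq_1)
  have "((\<lambda>n. inverse (b n)) \<longlongrightarrow> 0) F" by (rule tendsto_inverse_0_at_top[OF assms])
  from tendsto_diff[OF tendsto_const this, of 1]
  show "((\<lambda>n. 1 - inverse (b n)) \<longlongrightarrow> 1) F" by simp
qed simp

text \<open>
  The complex version of \<open>(1 + w / b)\<^sup>b \<longrightarrow> exp w\<close> with a varying \<open>w\<close>.  The power is written as the
  exponential of \<open>\<lfloor>b\<rfloor> Ln (1 + w / b)\<close>, and \<open>Ln (1 + t) / t\<close> extends continuously to \<open>t = 0\<close>.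
\<close>

lemma tendsto_power_nat_floor_exp:
  fixes w :: "nat \<Rightarrow> complex"
  assumes w: "w \<longlonglongrightarrow> w'" and b: "filterlim b at_top sequentially"
  shows "(\<lambda>n. (1 + w n / of_real (b n)) ^ nat \<lfloor>b n\<rfloor>) \<longlonglongrightarrow> exp w'"
proof -
  define h where "h t = (if t = 0 then 1 else Ln (1 + t) / t)" for t :: complex
  have "(Ln has_field_derivative inverse 1) (at 1)"
    by (rule has_field_derivative_Ln) simp
  then have "((\<lambda>t. Ln (1 + t) / t) \<longlongrightarrow> 1) (at 0)"
    by (simp add: DERIV_def)
  then have "(h \<longlongrightarrow> 1) (at 0)"
    by (rule Lim_transform_eventually) (auto simp: h_def eventually_at_filter)
  then have h: "isCont h 0" by (simp add: isCont_def h_def)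
  define t where "t n = w n / of_real (b n)" for n
  have "filterlim (\<lambda>n. complex_of_real (b n)) at_infinity sequentially"
    by (rule filterlim_compose[OF filterlim_of_real_at_infinity b])
  have t0: "t \<longlonglongrightarrow> 0"
    unfolding t_def using w by (rule tendsto_divide_0) fact
  have ht: "(\<lambda>n. h (t n)) \<longlonglongrightarrow> 1"
    using isCont_tendsto_compose[OF h t0] by (simp add: h_def)
  have b_pos: "\<forall>\<^sub>F n in sequentially. 0 < b n" using b by (simp add: filterlim_at_top_dense)
  have "(\<lambda>n. of_real (real (nat \<lfloor>b n\<rfloor>) / b n) * w n * h (t n)) \<longlonglongrightarrow> of_real 1 * w' * 1"
    by (intro tendsto_mult tendsto_of_real tendsto_nat_floor_divide b w ht)
  then have "(\<lambda>n. exp (of_real (real (nat \<lfloor>b n\<rfloor>) / b n) * w n * h (t n))) \<longlonglongrightarrow> exp w'"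
    by (auto intro: tendsto_exp)
  moreover have "\<forall>\<^sub>F n in sequentially. cmod (t n) < 1"
    using order_tendstoD(2)[OF tendsto_norm_zero[OF t0], of 1] by simp
  then have "\<forall>\<^sub>F n in sequentially. exp (of_real (real (nat \<lfloor>b n\<rfloor>) / b n) * w n * h (t n)) =
      (1 + w n / of_real (b n)) ^ nat \<lfloor>b n\<rfloor>"
    using b_pos
  proof eventually_elim
    case (elim n)
    have "1 + t n \<noteq> 0"
      using elim(1) by (metis add_eq_0_iff less_irrefl norm_minus_cancel norm_one)
    then have "(1 + t n) ^ nat \<lfloor>b n\<rfloor> = exp (of_nat (nat \<lfloor>b n\<rfloor>) * Ln (1 + t n))"
      by (simp add: exp_of_nat_mult)
    also have "Ln (1 + t n) = t n * h (t n)" by (simp add: h_def)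
    also have "of_nat (nat \<lfloor>b n\<rfloor>) * (t n * h (t n)) = of_real (real (nat \<lfloor>b n\<rfloor>) / b n) * w n * h (t n)"
      using elim(2) by (simp add: t_def)
    finally show ?case by (simp add: t_def)
  qed
  ultimately show ?thesis by (rule Lim_transform_eventually)
qed

lemma Re_nonneg_one_minus_exp:
  assumes "0 \<le> Re w"
  shows "0 \<le> Re (1 - exp (- w))"
  using complex_Re_le_cmod[of "exp (- w)"] assms by (simp add: order_trans)

lemma tendsto_rescaled_one_minus_exp:
  assumes z: "0 \<le> Re z" and a: "filterlim a at_top sequentially"
  shows "(\<lambda>n. of_real (a n) * (1 - exp (- (z / of_real (a n))))) \<longlonglongrightarrow> z"
proof -
  have "(\<lambda>n. of_real (a n) * kern (z / of_real (a n))) \<longlonglongrightarrow> 0"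
  proof (rule Lim_null_comparison)
    show "\<forall>\<^sub>F n in sequentially. cmod (of_real (a n) * kern (z / of_real (a n))) \<le> (cmod z)\<^sup>2 * inverse (a n)"
      using filterlim_at_top_dense[THEN iffD1, OF a, rule_format, of 0]
    proof eventually_elim
      case (elim n)
      have "cmod (kern (z / of_real (a n))) \<le> (cmod z / a n)\<^sup>2"
        using norm_kern_le_square[of "z / of_real (a n)"] z elim by (simp add: norm_divide)
      then have "a n * cmod (kern (z / of_real (a n))) \<le> a n * (cmod z / a n)\<^sup>2"
        using elim by (simp add: mult_left_mono)
      then show ?case using elim by (simp add: norm_mult power2_eq_square field_simps)
    qed
    show "(\<lambda>n. (cmod z)\<^sup>2 * inverse (a n)) \<longlonglongrightarrow> 0"
      using tendsto_mult_right_zero[OF tendsto_inverse_0_at_top[OF a]] .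
  qed
  from tendsto_diff[OF tendsto_const this, of z]
  have "(\<lambda>n. z - of_real (a n) * kern (z / of_real (a n))) \<longlonglongrightarrow> z" by simp
  moreover have "\<forall>\<^sub>F n in sequentially. z - of_real (a n) * kern (z / of_real (a n)) =
      of_real (a n) * (1 - exp (- (z / of_real (a n))))"
    using filterlim_at_top_dense[THEN iffD1, OF a, rule_format, of 0]
    by eventually_elim (simp add: kern_def algebra_simps)
  ultimately show ?thesis by (rule Lim_transform_eventually)
qed

text \<open>
  With \<open>r = exp (- z / a\<^sub>n)\<close> the transform of the rescaled walk at \<open>z\<close> is
  \<open>(1 + \<Psi>\<^sub>n (a\<^sub>n (1 - r)) / (r b\<^sub>n))\<close> to the power \<open>\<lfloor>b\<^sub>n\<rfloor>\<close>.  Since \<open>a\<^sub>n (1 - r)\<close> only tends to \<open>z\<close>, the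
  convergence of \<open>\<Psi>\<^sub>n\<close> is required along convergent arguments.
\<close>

theorem Luka_of_exponent_convergence:
  fixes \<Psi> :: "nat \<Rightarrow> complex \<Rightarrow> complex"
  assumes a: "\<And>n. 0 < a n" "filterlim a at_top sequentially"
    and b: "filterlim b at_top sequentially"
    and crit: "\<And>n. critical_offspring (\<mu> n)"
    and gen: "\<And>n r. cmod r \<le> 1 \<Longrightarrow> (\<lambda>k. of_real (pmf (\<mu> n) k) * r ^ k) sums
        (r + \<Psi> n (of_real (a n) * (1 - r)) / of_real (b n))"
    and conv: "\<And>z z'. \<lbrakk>z \<longlonglongrightarrow> z'; \<And>n. 0 \<le> Re (z n)\<rbrakk> \<Longrightarrow> (\<lambda>n. \<Psi> n (z n)) \<longlonglongrightarrow> \<Psi>' z'"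
    and real: "\<And>l. 0 \<le> l \<Longrightarrow> \<Psi>' (of_real l) = of_real (\<psi> l)"
  shows "Luka a b \<mu> \<psi>"
proof -
  let ?V = "\<lambda>n \<xi>. 1 / a n * real_of_int (walk (nat \<lfloor>b n\<rfloor>) \<xi>)"
  define M where "M n = distr (jump_space (\<mu> n)) borel (?V n)" for n
  have V [measurable]: "?V n \<in> borel_measurable (jump_space (\<mu> n))" for n
    unfolding walk_def by simp
  have M: "real_distribution (M n)" for n
    unfolding M_def real_distribution_def real_distribution_axioms_def
    using prob_space.prob_space_distr[OF prob_space_jump_space V] by simp
  define r where "r n z = exp (- (z / of_real (a n)))" for n and z :: complex
  define E where "E n z = (1 + \<Psi> n (of_real (a n) * (1 - r n z)) / r n z / of_real (b n)) ^ nat \<lfloor>b n\<rfloor>" for n z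
  have laplace: "has_bochner_integral (M n) (\<lambda>x. exp (- z * of_real x)) (E n z)" if z: "0 \<le> Re z" for n z
  proof -
    have "cmod (r n z) \<le> 1" using z a(1)[of n] by (simp add: r_def)
    from gen[OF this, of n] have "has_bochner_integral (jump_space (\<mu> n)) (\<lambda>\<xi>. exp (- z * of_real (?V n \<xi>)))
      ((exp (of_real (1 / a n) * z) * (r n z + \<Psi> n (of_real (a n) * (1 - r n z)) / of_real (b n))) ^ nat \<lfloor>b n\<rfloor>)"
      using a(1)[of n] z by (intro walk_laplace) (auto simp: r_def)
    also have "exp (of_real (1 / a n) * z) * (r n z + \<Psi> n (of_real (a n) * (1 - r n z)) / of_real (b n)) =
        1 + \<Psi> n (of_real (a n) * (1 - r n z)) / r n z / of_real (b n)"
      by (simp add: r_def exp_minus field_simps)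
    finally show ?thesis
      unfolding M_def E_def by (intro has_bochner_integral_distr V) measurable
  qed
  have E_lim: "(\<lambda>n. E n z) \<longlonglongrightarrow> exp (\<Psi>' z)" if z: "0 \<le> Re z" for z
    unfolding E_def
  proof (rule tendsto_power_nat_floor_exp[OF _ b])
    have "(\<lambda>n. \<Psi> n (of_real (a n) * (1 - r n z))) \<longlonglongrightarrow> \<Psi>' z"
    proof (rule conv)
      show "(\<lambda>n. of_real (a n) * (1 - r n z)) \<longlonglongrightarrow> z"
        unfolding r_def by (rule tendsto_rescaled_one_minus_exp[OF z a(2)])
      show "0 \<le> Re (of_real (a n) * (1 - r n z))" for n
        using Re_nonneg_one_minus_exp[of "z / of_real (a n)"] a(1)[of n] z by (simp add: r_def)
    qed
    moreover have "(\<lambda>n. r n z) \<longlonglongrightarrow> exp (- 0)"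
      unfolding r_def
      by (intro tendsto_exp tendsto_minus tendsto_divide_0[OF tendsto_const]
          filterlim_compose[OF filterlim_of_real_at_infinity a(2)])
    ultimately show "(\<lambda>n. \<Psi> n (of_real (a n) * (1 - r n z)) / r n z) \<longlonglongrightarrow> \<Psi>' z"
      using tendsto_divide[of _ "\<Psi>' z" sequentially _ 1] by simp
  qed
  have "\<exists>X. real_distribution X \<and> weak_conv_m M X \<and>
    (\<forall>l\<ge>0. has_bochner_integral X (\<lambda>x. exp (- l * x)) (Re (exp (\<Psi>' (of_real l)))))"
  proof (rule weak_limit_of_laplace_transforms[OF M])
    show "integrable (M n) (\<lambda>x. exp (- l * x))" if "0 \<le> l" for n and l :: real
    proof -
      have "integrable (M n) (\<lambda>x. exp (- of_real l * of_real x) :: complex)"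
        using laplace[of "of_real l" n] that by (auto intro: integrable.intros)
      also have "(\<lambda>x. exp (- of_real l * of_real x) :: complex) = (\<lambda>x. of_real (exp (- l * x)))"
        by (simp add: exp_of_real flip: of_real_minus of_real_mult)
      finally show ?thesis by (simp only: complex_of_real_integrable_eq)
    qed
    show "(\<lambda>n. \<integral>x. exp (- z * of_real x) \<partial>M n) \<longlonglongrightarrow> exp (\<Psi>' z)" if "0 \<le> Re z" for z
      unfolding has_bochner_integral_integral_eq[OF laplace[OF that]] by (rule E_lim[OF that])
    show "has_bochner_integral (M n) (\<lambda>x. x) 0" for n
      using walk_mean[OF crit[of n], of "1 / a n" "nat \<lfloor>b n\<rfloor>"] unfolding M_def
      by (intro has_bochner_integral_distr V) measurable
  qed
  then obtain X where X: "real_distribution X" "weak_conv_m M X"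
    "\<And>l. 0 \<le> l \<Longrightarrow> has_bochner_integral X (\<lambda>x. exp (- l * x)) (Re (exp (\<Psi>' (of_real l))))"
    by blast
  have "value_at_one \<psi> X"
    unfolding value_at_one_def using X(1,3) by (simp add: real exp_of_real)
  with X(2) show ?thesis unfolding Luka_def M_def by blast
qed

section \<open>Clumping and truncating the jumps of a Levy measure\<close>

locale levy_data =
  fixes \<beta> :: real and \<pi> :: "real measure"
  assumes \<beta>_nonneg: "0 \<le> \<beta>"
    and sets_\<pi>: "sets \<pi> = sets (restrict_space borel {0<..})"
    and finite_min: "(\<integral>\<^sup>+x. ennreal (min x (x\<^sup>2)) \<partial>\<pi>) < \<infinity>"

definition exponent :: "real \<Rightarrow> real measure \<Rightarrow> 'a \<Rightarrow> 'a::{real_normed_field,banach,second_countable_topology}" where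
  "exponent \<beta> \<pi> z = \<beta> *\<^sub>R z\<^sup>2 + jump_exponent \<pi> (\<lambda>_. 1) (\<lambda>x. x) z"

text \<open>
  Each jump of size \<open>x < e\<close> is replaced by jumps of size \<open>e\<close> whose intensity is multiplied by
  \<open>x\<^sup>2 / e\<^sup>2\<close>, and the quadratic part is replaced by jumps of size \<open>e\<close> with intensity \<open>2 \<beta> / e\<^sup>2\<close>.
  Second moments are preserved, which keeps the exponent unchanged up to a factor 2 on
  \<open>[0, 1 / e]\<close>, but the result has finite variation and therefore grows linearly.
\<close>

definition clumped_exponent ::
  "real \<Rightarrow> real measure \<Rightarrow> real \<Rightarrow> 'a \<Rightarrow> 'a::{real_normed_field,banach,second_countable_topology}" where
  "clumped_exponent \<beta> \<pi> e z =
     (2 * \<beta> / e\<^sup>2) *\<^sub>R kern (e *\<^sub>R z) + jump_exponent \<pi> (\<lambda>x. min 1 (x\<^sup>2 / e\<^sup>2)) (\<lambda>x. max x e) z"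

text \<open>
  The quadratic part and the jumps smaller than \<open>d\<close> are kept.  This negligible part of the jumps for
  bounded arguments nevertheless carries half of the exponent at infinity if the variation is infinite.
\<close>

definition small_exponent ::
  "real \<Rightarrow> real measure \<Rightarrow> real \<Rightarrow> 'a \<Rightarrow> 'a::{real_normed_field,banach,second_countable_topology}" where
  "small_exponent \<beta> \<pi> d z = \<beta> *\<^sub>R z\<^sup>2 + jump_exponent \<pi> (indicator {..<d}) (\<lambda>x. x) z"

lemma class_L_levy_data:
  assumes "class_L \<psi> \<beta> \<pi>"
  shows "levy_data \<beta> \<pi>" and "0 \<le> z \<Longrightarrow> \<psi> z = exponent \<beta> \<pi> z"
proof -
  show "levy_data \<beta> \<pi>" using assms by (simp add: levy_data_def class_L_def)
  show "\<psi> z = exponent \<beta> \<pi> z" if "0 \<le> z"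
    using assms that by (simp add: class_L_def exponent_def jump_exponent_def kern_def mult.commute)
qed

context levy_data
begin

lemma space_\<pi>: "space \<pi> = {0<..}"
  using sets_eq_imp_space_eq[OF sets_\<pi>] by (simp add: space_restrict_space)

lemma measurable_\<pi> [measurable]: "f \<in> borel_measurable borel \<Longrightarrow> f \<in> borel_measurable \<pi>"
  using measurable_restrict_space1[of f borel borel "{0<..}"] measurable_cong_sets[OF sets_\<pi> refl] by blast

lemma integrable_min_square: "integrable \<pi> (\<lambda>x. min x (x\<^sup>2))"
proof (rule integrableI_nonneg)
  show "AE x in \<pi>. 0 \<le> min x (x\<^sup>2)" by (rule AE_I2) (simp add: space_\<pi>)
qed (use finite_min measurable_\<pi>[of "\<lambda>x. min x (x\<^sup>2)"] in auto)

lemma integrable_dominated_min_square: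
  assumes "f \<in> borel_measurable borel" and "\<And>x. 0 < x \<Longrightarrow> \<bar>f x\<bar> \<le> C * min x (x\<^sup>2)"
  shows "integrable \<pi> f"
proof (rule Bochner_Integration.integrable_bound)
  show "integrable \<pi> (\<lambda>x. C * min x (x\<^sup>2))" using integrable_min_square by simp
  show "AE x in \<pi>. norm (f x) \<le> norm (C * min x (x\<^sup>2))"
  proof (rule AE_I2)
    fix x assume "x \<in> space \<pi>"
    then have "\<bar>f x\<bar> \<le> C * min x (x\<^sup>2)" using assms(2) by (simp add: space_\<pi>)
    also note abs_ge_self
    finally show "norm (f x) \<le> norm (C * min x (x\<^sup>2))" by simp
  qed
qed (rule measurable_\<pi>[OF assms(1)])

lemma jump_family_all: "jump_family \<pi> (\<lambda>_. 1) (\<lambda>x. x)"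
  by unfold_locales (use integrable_min_square in \<open>auto simp: space_\<pi> intro: measurable_\<pi>\<close>)

lemma jump_family_small: "jump_family \<pi> (indicator {..<d}) (\<lambda>x. x)"
proof unfold_locales
  show "integrable \<pi> (\<lambda>x. indicator {..<d} x * min x (x\<^sup>2))"
    by (rule integrable_dominated_min_square[where C = 1]) (auto simp: indicator_def)
qed (auto simp: space_\<pi> intro: measurable_\<pi>)

text \<open>
  The weight \<open>m min(y, y\<^sup>2)\<close> of the clumped jumps does not depend on \<open>e\<close>, so that \<open>min x (x\<^sup>2)\<close>
  dominates uniformly; the first moment \<open>m y\<close> is integrable for each fixed \<open>e\<close>.
\<close>

lemma clumped_weight:
  fixes x e :: real
  assumes "0 < e" "e \<le> 1" "0 < x"
  shows "min 1 (x\<^sup>2 / e\<^sup>2) * min (max x e) ((max x e)\<^sup>2) = min x (x\<^sup>2)"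
    and "min 1 (x\<^sup>2 / e\<^sup>2) * max x e \<le> min x (x\<^sup>2) / e"
proof -
  show "min 1 (x\<^sup>2 / e\<^sup>2) * min (max x e) ((max x e)\<^sup>2) = min x (x\<^sup>2)"
  proof (cases "x < e")
    case True
    then have "x\<^sup>2 \<le> e\<^sup>2" "x\<^sup>2 \<le> x" "e\<^sup>2 \<le> e"
      using assms power_mono[of x e 2] mult_left_le[of x x] mult_left_le[of e e]
      by (simp_all add: power2_eq_square)
    then show ?thesis using True assms by (simp add: min_def max_def)
  next
    case False
    then have "e\<^sup>2 \<le> x\<^sup>2" using assms by (auto intro!: power_mono)
    then show ?thesis using False assms by (simp add: min_def max_def)
  qed
  show "min 1 (x\<^sup>2 / e\<^sup>2) * max x e \<le> min x (x\<^sup>2) / e"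
  proof (cases "x < e")
    case True
    then have "x\<^sup>2 \<le> e\<^sup>2" "x\<^sup>2 \<le> x"
      using assms power_mono[of x e 2] mult_left_le[of x x]
      by (simp_all add: power2_eq_square)
    then show ?thesis using True assms by (simp add: min_def max_def power2_eq_square field_simps)
  next
    case False
    then have "e\<^sup>2 \<le> x\<^sup>2" using assms by (auto intro!: power_mono)
    then have "min 1 (x\<^sup>2 / e\<^sup>2) * max x e = x" using False assms by (simp add: min_def max_def)
    also have "x \<le> min x (x\<^sup>2) / e"
      using False assms by (auto simp: min_def power2_eq_square field_simps mult_left_le)
    finally show ?thesis .
  qed
qed

lemma jump_family_clumped:
  assumes "0 < e" "e \<le> 1"
  shows "jump_family \<pi> (\<lambda>x. min 1 (x\<^sup>2 / e\<^sup>2)) (\<lambda>x. max x e)"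
proof unfold_locales
  show "integrable \<pi> (\<lambda>x. min 1 (x\<^sup>2 / e\<^sup>2) * min (max x e) ((max x e)\<^sup>2))"
    by (rule integrable_dominated_min_square[where C = 1]) (auto simp: clumped_weight[OF assms])
qed (use assms in \<open>auto simp: space_\<pi> intro: measurable_\<pi>\<close>)

lemma exponent_of_real: "exponent \<beta> \<pi> (of_real l :: complex) = of_real (exponent \<beta> \<pi> l)"
  by (simp add: exponent_def jump_family.jump_exponent_of_real[OF jump_family_all] scaleR_conv_of_real)

lemma small_exponent_of_real:
  "small_exponent \<beta> \<pi> d (of_real l :: complex) = of_real (small_exponent \<beta> \<pi> d l)"
  by (simp add: small_exponent_def jump_family.jump_exponent_of_real[OF jump_family_small] scaleR_conv_of_real)

lemma clumped_exponent_of_real: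
  assumes "0 < e" "e \<le> 1"
  shows "clumped_exponent \<beta> \<pi> e (of_real l :: complex) = of_real (clumped_exponent \<beta> \<pi> e l)"
  using kern_of_real[of "e * l", where 'a = complex]
  by (simp add: clumped_exponent_def jump_family.jump_exponent_of_real[OF jump_family_clumped[OF assms]] scaleR_conv_of_real)

lemma mono_doubling_exponent: "mono_doubling (exponent \<beta> \<pi>)"
  unfolding exponent_def[abs_def] real_scaleR_def
  by (intro mono_doubling_add mono_doubling_cmult \<beta>_nonneg mono_doubling_power2 jump_family.mono_doubling_jump_exponent[OF jump_family_all])

lemma mono_doubling_small_exponent: "mono_doubling (small_exponent \<beta> \<pi> d)"
  unfolding small_exponent_def[abs_def] real_scaleR_def
  by (intro mono_doubling_add mono_doubling_cmult \<beta>_nonneg mono_doubling_power2 jump_family.mono_doubling_jump_exponent[OF jump_family_small])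

lemma mono_doubling_clumped_exponent:
  assumes "0 < e" "e \<le> 1"
  shows "mono_doubling (clumped_exponent \<beta> \<pi> e)"
proof -
  have "mono_doubling (\<lambda>l. kern (e * l))"
    unfolding mono_doubling_def
  proof (intro conjI allI impI continuous_on_kern continuous_on_mult_left continuous_on_id)
    show "mono_on {0..} (\<lambda>l. kern (e * l))"
      using assms by (intro mono_onI kern_mono_real mult_left_mono) auto
    fix s :: real assume "0 \<le> s"
    then show "0 \<le> kern (e * s)" "kern (e * (2 * s)) \<le> 4 * kern (e * s)"
      using assms kern_nonneg[of "e * s"] kern_double_le[of "e * s"] by (simp_all add: mult_ac)
  qed
  then show ?thesis
    unfolding clumped_exponent_def[abs_def] real_scaleR_def using \<beta>_nonneg
    by (intro mono_doubling_add mono_doubling_cmult jump_family.mono_doubling_jump_exponent[OF jump_family_clumped] assms) auto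
qed

lemma branching_coeffs_small_exponent:
  assumes "0 < a" obtains w where "branching_coeffs (small_exponent \<beta> \<pi> d) a w"
proof -
  have "branching_coeffs (\<lambda>z. of_real \<beta> * z\<^sup>2 + jump_exponent \<pi> (indicator {..<d}) (\<lambda>x. x) z) a
     (\<lambda>k. \<beta> * (if k = 0 then a\<^sup>2 else if k = 1 then - 2 * a\<^sup>2 else if k = 2 then a\<^sup>2 else 0) +
        (\<integral>x. indicator {..<d} x * kern_coeff (a * x) k \<partial>\<pi>))"
    by (rule branching_coeffs_add[OF
          branching_coeffs_cmult[OF branching_coeffs_power2[OF less_imp_le[OF assms]] \<beta>_nonneg]
          jump_family.branching_coeffs_jump_exponent[OF jump_family_small assms]])
  also have "(\<lambda>z. of_real \<beta> * z\<^sup>2 + jump_exponent \<pi> (indicator {..<d}) (\<lambda>x. x) z) = small_exponent \<beta> \<pi> d"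
    unfolding small_exponent_def[abs_def] scaleR_conv_of_real ..
  finally show ?thesis by (rule that)
qed

lemma branching_coeffs_clumped_exponent:
  assumes "0 < a" "0 < e" "e \<le> 1" obtains w where "branching_coeffs (clumped_exponent \<beta> \<pi> e) a w"
proof -
  have "branching_coeffs (\<lambda>z. of_real (2 * \<beta> / e\<^sup>2) * kern (of_real e * z) +
      jump_exponent \<pi> (\<lambda>x. min 1 (x\<^sup>2 / e\<^sup>2)) (\<lambda>x. max x e) z) a
     (\<lambda>k. 2 * \<beta> / e\<^sup>2 * kern_coeff (e * a) k + (\<integral>x. min 1 (x\<^sup>2 / e\<^sup>2) * kern_coeff (a * max x e) k \<partial>\<pi>))"
    by (rule branching_coeffs_add[OF branching_coeffs_cmult[OF branching_coeffs_kern]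
          jump_family.branching_coeffs_jump_exponent[OF jump_family_clumped[OF assms(2,3)] assms(1)]])
      (use assms \<beta>_nonneg in auto)
  also have "(\<lambda>z. of_real (2 * \<beta> / e\<^sup>2) * kern (of_real e * z) +
      jump_exponent \<pi> (\<lambda>x. min 1 (x\<^sup>2 / e\<^sup>2)) (\<lambda>x. max x e) z) = clumped_exponent \<beta> \<pi> e"
    unfolding clumped_exponent_def[abs_def] scaleR_conv_of_real ..
  finally show ?thesis by (rule that)
qed

lemma small_exponent_tendsto:
  assumes d: "d \<longlonglongrightarrow> 0" and z: "z \<longlonglongrightarrow> z'" "\<And>n. 0 \<le> Re (z n)"
  shows "(\<lambda>n. small_exponent \<beta> \<pi> (d n) (z n)) \<longlonglongrightarrow> of_real \<beta> * z'\<^sup>2"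
proof -
  have "(\<lambda>n. jump_exponent \<pi> (indicator {..<d n}) (\<lambda>x. x) (z n)) \<longlonglongrightarrow> jump_exponent \<pi> (\<lambda>_. 0) (\<lambda>x. x) z'"
  proof (rule jump_exponent_tendsto[where w = "\<lambda>x. min x (x\<^sup>2)"])
    fix x assume "x \<in> space \<pi>"
    then have "\<forall>\<^sub>F n in sequentially. d n < x" by (intro order_tendstoD(2)[OF d]) (simp add: space_\<pi>)
    then have "\<forall>\<^sub>F n in sequentially. indicator {..<d n} x = (0 :: real)"
      by eventually_elim simp
    then show "(\<lambda>n. indicator {..<d n} x :: real) \<longlonglongrightarrow> 0" by (rule tendsto_eventually)
  qed (use z integrable_min_square in \<open>auto simp: space_\<pi> indicator_def intro: measurable_\<pi>\<close>)
  then have "(\<lambda>n. small_exponent \<beta> \<pi> (d n) (z n)) \<longlonglongrightarrow> \<beta> *\<^sub>R z'\<^sup>2 + 0"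
    unfolding small_exponent_def by (intro tendsto_intros z) (simp add: jump_exponent_def)
  then show ?thesis by (simp add: scaleR_conv_of_real)
qed

lemma rescaled_kern_tendsto:
  assumes e: "e \<longlonglongrightarrow> 0" "\<And>n. 0 < e n" and z: "z \<longlonglongrightarrow> z'" "\<And>n. 0 \<le> Re (z n)"
  shows "(\<lambda>n. kern (of_real (e n) * z n) / of_real ((e n)\<^sup>2)) \<longlonglongrightarrow> z'\<^sup>2 / 2"
proof -
  have "(\<lambda>n. kern (of_real (e n) * z n) / of_real ((e n)\<^sup>2) - (z n)\<^sup>2 / 2) \<longlonglongrightarrow> 0"
  proof (rule Lim_null_comparison)
    show "\<forall>\<^sub>F n in sequentially.
        cmod (kern (of_real (e n) * z n) / of_real ((e n)\<^sup>2) - (z n)\<^sup>2 / 2) \<le> cmod (z n) ^ 3 * e n"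
    proof (rule always_eventually, rule allI)
      fix n
      have e0: "complex_of_real (e n) \<noteq> 0" using e(2)[of n] by simp
      have "kern (of_real (e n) * z n) / of_real ((e n)\<^sup>2) - (z n)\<^sup>2 / 2 =
          (kern (of_real (e n) * z n) - (of_real (e n) * z n)\<^sup>2 / 2) / of_real ((e n)\<^sup>2)"
        using e0 by (simp add: field_simps power_mult_distrib)
      also have "cmod \<dots> \<le> cmod (of_real (e n) * z n) ^ 3 / (e n)\<^sup>2"
        using norm_kern_minus_square[of "of_real (e n) * z n"] e(2)[of n] z(2)[of n]
        by (simp add: norm_divide norm_power divide_right_mono)
      also have "\<dots> = cmod (z n) ^ 3 * e n"
        using e(2)[of n] by (simp add: norm_mult power_mult_distrib power2_eq_square power3_eq_cube)
      finally show "cmod (kern (of_real (e n) * z n) / of_real ((e n)\<^sup>2) - (z n)\<^sup>2 / 2) \<le> cmod (z n) ^ 3 * e n" .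
    qed
    show "(\<lambda>n. cmod (z n) ^ 3 * e n) \<longlonglongrightarrow> 0"
      using tendsto_mult[OF tendsto_power[OF tendsto_norm[OF z(1)], of 3] e(1)] by simp
  qed
  from tendsto_add[OF this tendsto_divide[OF tendsto_power[OF z(1), of 2] tendsto_const[of 2]]]
  show ?thesis by simp
qed

lemma clumped_exponent_tendsto:
  assumes e: "e \<longlonglongrightarrow> 0" "\<And>n. 0 < e n" "\<And>n. e n \<le> 1" and z: "z \<longlonglongrightarrow> z'" "\<And>n. 0 \<le> Re (z n)"
  shows "(\<lambda>n. clumped_exponent \<beta> \<pi> (e n) (z n)) \<longlonglongrightarrow> exponent \<beta> \<pi> (z' :: complex)"
proof -
  have ev: "\<forall>\<^sub>F n in sequentially. e n < x" if "x \<in> space \<pi>" for x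
    using that by (intro order_tendstoD(2)[OF e(1)]) (simp add: space_\<pi>)
  have "(\<lambda>n. jump_exponent \<pi> (\<lambda>x. min 1 (x\<^sup>2 / (e n)\<^sup>2)) (\<lambda>x. max x (e n)) (z n)) \<longlonglongrightarrow>
      jump_exponent \<pi> (\<lambda>_. 1) (\<lambda>x. x) z'"
  proof (rule jump_exponent_tendsto[where w = "\<lambda>x. min x (x\<^sup>2)"])
    fix x assume x: "x \<in> space \<pi>"
    have "\<forall>\<^sub>F n in sequentially. min 1 (x\<^sup>2 / (e n)\<^sup>2) = 1"
      using ev[OF x]
    proof eventually_elim
      case (elim n)
      then have "(e n)\<^sup>2 \<le> x\<^sup>2" using e(2)[of n] by (intro power_mono) auto
      then show ?case using e(2)[of n] by (simp add: min_def)
    qed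
    then show "(\<lambda>n. min 1 (x\<^sup>2 / (e n)\<^sup>2)) \<longlonglongrightarrow> 1" by (rule tendsto_eventually)
    have "\<forall>\<^sub>F n in sequentially. max x (e n) = x"
      using ev[OF x] by eventually_elim simp
    then show "(\<lambda>n. max x (e n)) \<longlonglongrightarrow> x" by (rule tendsto_eventually)
  next
    fix n x assume x: "x \<in> space \<pi>"
    then show "min 1 (x\<^sup>2 / (e n)\<^sup>2) * min (max x (e n)) ((max x (e n))\<^sup>2) \<le> min x (x\<^sup>2)"
      using clumped_weight(1)[of "e n" x] e by (simp add: space_\<pi>)
    show "0 \<le> min 1 (x\<^sup>2 / (e n)\<^sup>2)" "0 \<le> max x (e n)" using x by (auto simp: space_\<pi>)
  qed (use z integrable_min_square in \<open>auto intro: measurable_\<pi>\<close>)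
  moreover have "(\<lambda>n. (2 * \<beta> / (e n)\<^sup>2) *\<^sub>R kern (e n *\<^sub>R z n)) \<longlonglongrightarrow> \<beta> *\<^sub>R z'\<^sup>2"
    using tendsto_mult[OF tendsto_const[of "of_real (2 * \<beta>)"] rescaled_kern_tendsto[OF e(1,2) z]]
    by (simp add: scaleR_conv_of_real mult_ac)
  ultimately show ?thesis
    unfolding clumped_exponent_def exponent_def by (intro tendsto_add)
qed

text \<open>
  For \<open>l \<le> 1 / e\<close> both \<open>e l\<close> and \<open>x l\<close> with \<open>x < e\<close> lie in the range where the kernel is between
  a quarter and a half of the square, and the clumped jumps have the same second moment.
\<close>

lemma clumped_exponent_ge:
  assumes e: "0 < e" "e \<le> 1" and l: "0 \<le> l" "l \<le> 1 / e"
  shows "exponent \<beta> \<pi> l / 2 \<le> clumped_exponent \<beta> \<pi> e l"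
proof -
  have el: "0 \<le> e * l" "e * l \<le> 1" using e l by (auto simp: field_simps)
  note kq = kern_ge_quarter_square[OF el]
  have "\<beta> * l\<^sup>2 / 2 = 2 * \<beta> / e\<^sup>2 * ((e * l)\<^sup>2 / 4)"
    using e by (simp add: power_mult_distrib)
  also have "\<dots> \<le> 2 * \<beta> / e\<^sup>2 * kern (e * l)"
    using kq \<beta>_nonneg by (intro mult_left_mono) auto
  finally have 1: "\<beta> * l\<^sup>2 / 2 \<le> 2 * \<beta> / e\<^sup>2 * kern (e * l)" .
  have "(\<integral>x. 1 * kern (x * l) / 2 \<partial>\<pi>) \<le> (\<integral>x. min 1 (x\<^sup>2 / e\<^sup>2) * kern (max x e * l) \<partial>\<pi>)"
  proof (intro integral_mono integrable_divide)
    show "integrable \<pi> (\<lambda>x. 1 * kern (x * l))"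
      by (rule jump_family.integrable_jump_real[OF jump_family_all l(1)])
    show "integrable \<pi> (\<lambda>x. min 1 (x\<^sup>2 / e\<^sup>2) * kern (max x e * l))"
      by (rule jump_family.integrable_jump_real[OF jump_family_clumped[OF e] l(1)])
    fix x assume "x \<in> space \<pi>"
    then have x: "0 < x" by (simp add: space_\<pi>)
    show "1 * kern (x * l) / 2 \<le> min 1 (x\<^sup>2 / e\<^sup>2) * kern (max x e * l)"
    proof (cases "x < e")
      case True
      have "kern (x * l) / 2 \<le> x\<^sup>2 * l\<^sup>2 / 4"
        using kern_le_half_square[of "x * l"] x l by (simp add: power_mult_distrib)
      also have "\<dots> = x\<^sup>2 / e\<^sup>2 * ((e * l)\<^sup>2 / 4)" using e by (simp add: power_mult_distrib)
      also have "\<dots> \<le> x\<^sup>2 / e\<^sup>2 * kern (e * l)" using kq by (intro mult_left_mono) auto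
      also have "x\<^sup>2 / e\<^sup>2 = min 1 (x\<^sup>2 / e\<^sup>2)"
        using power_mono[of x e 2] True x e by (simp add: min_def)
      finally show ?thesis using True by (simp add: max_def)
    next
      case False
      then have "min 1 (x\<^sup>2 / e\<^sup>2) = 1" using power_mono[of e x 2] e by (simp add: min_def)
      then show ?thesis using False kern_nonneg[of "x * l"] x l by (simp add: max_def)
    qed
  qed
  with 1 show ?thesis
    by (simp add: exponent_def clumped_exponent_def jump_exponent_def)
qed

lemma clumped_exponent_le_linear:
  assumes e: "0 < e" "e \<le> 1"
  obtains C where "\<And>l::real. 0 \<le> l \<Longrightarrow> clumped_exponent \<beta> \<pi> e l \<le> C * l"
proof -
  let ?I = "\<integral>x. min 1 (x\<^sup>2 / e\<^sup>2) * max x e \<partial>\<pi>"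
  have "clumped_exponent \<beta> \<pi> e l \<le> (2 * \<beta> / e\<^sup>2 * e + ?I) * l" if l: "0 \<le> l" for l
  proof -
    have "integrable \<pi> (\<lambda>x. min 1 (x\<^sup>2 / e\<^sup>2) * max x e)"
      by (rule integrable_dominated_min_square[where C = "1 / e"])
        (use clumped_weight(2)[OF e] e in auto)
    from jump_family.jump_exponent_le_linear[OF jump_family_clumped[OF e] this l]
    have "jump_exponent \<pi> (\<lambda>x. min 1 (x\<^sup>2 / e\<^sup>2)) (\<lambda>x. max x e) l \<le> l * ?I" .
    moreover have "2 * \<beta> / e\<^sup>2 * kern (e * l) \<le> 2 * \<beta> / e\<^sup>2 * (e * l)"
      using \<beta>_nonneg e l by (intro mult_left_mono kern_le_linear) auto
    ultimately show ?thesis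
      by (simp add: clumped_exponent_def algebra_simps)
  qed
  then show ?thesis by (rule that)
qed

lemma small_exponent_le:
  fixes l :: real
  assumes "0 \<le> l" shows "small_exponent \<beta> \<pi> d l \<le> exponent \<beta> \<pi> l"
proof -
  have "(\<integral>x. indicator {..<d} x * kern (x * l) \<partial>\<pi>) \<le> (\<integral>x. 1 * kern (x * l) \<partial>\<pi>)"
    by (intro integral_mono jump_family.integrable_jump_real[OF jump_family_all assms]
        jump_family.integrable_jump_real[OF jump_family_small assms])
      (use assms in \<open>auto simp: indicator_def kern_nonneg space_\<pi>\<close>)
  then show ?thesis by (simp add: small_exponent_def exponent_def jump_exponent_def)
qed

end

locale levy_data_infinite_variation = levy_data +
  assumes var: "Var_infty \<beta> \<pi>"
begin

text \<open>
  If \<open>\<beta> = 0\<close>, one uses that \<open>kern (l x) \<ge> l x / 2\<close> as soon as \<open>l x \<ge> 2\<close>: the ratio of the exponent to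
  \<open>l\<close> is at least half of the variation of the jumps in \<open>[2 / l, 1)\<close>, which tends to infinity.
\<close>

lemma exponent_superlinear:
  obtains K where "0 < K" "\<And>l::real. K \<le> l \<Longrightarrow> C * l \<le> exponent \<beta> \<pi> l"
proof (cases "0 < \<beta>")
  case True
  show ?thesis
  proof (rule that[of "max 1 (C / \<beta>)"])
    fix l :: real assume "max 1 (C / \<beta>) \<le> l"
    then have l: "C \<le> l * \<beta>" "1 \<le> l" using True by (auto simp: field_simps)
    then have "C * l \<le> \<beta> * l\<^sup>2" by (simp add: power2_eq_square mult_ac mult_left_mono)
    moreover have "0 \<le> jump_exponent \<pi> (\<lambda>_. 1) (\<lambda>x. x) l"
      using jump_family.mono_doubling_jump_exponent[OF jump_family_all] l by (simp add: mono_doubling_def)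
    ultimately show "C * l \<le> exponent \<beta> \<pi> l" by (simp add: exponent_def)
  qed simp
next
  case False
  with var have inf: "(\<integral>\<^sup>+x\<in>{0<..<1}. ennreal x \<partial>\<pi>) = \<infinity>" by (simp add: Var_infty_def)
  define f where "f n x = ennreal x * indicator {2 / real (Suc n)..<1} x" for n and x :: real
  have "(\<integral>\<^sup>+x. (SUP n. f n x) \<partial>\<pi>) = (SUP n. \<integral>\<^sup>+x. f n x \<partial>\<pi>)"
  proof (rule nn_integral_monotone_convergence_SUP)
    show "incseq f"
      unfolding incseq_def le_fun_def f_def
    proof (intro allI impI mult_left_mono)
      fix m n :: nat and x :: real assume "m \<le> n"
      then have "2 / real (Suc n) \<le> 2 / real (Suc m)" by (intro divide_left_mono) auto
      then show "indicator {2 / real (Suc m)..<1} x \<le> (indicator {2 / real (Suc n)..<1} x :: ennreal)"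
        by (auto simp: indicator_def)
    qed simp
    show "f n \<in> borel_measurable \<pi>" for n unfolding f_def by (rule measurable_\<pi>) measurable
  qed
  moreover have "(\<integral>\<^sup>+x. (SUP n. f n x) \<partial>\<pi>) = (\<integral>\<^sup>+x\<in>{0<..<1}. ennreal x \<partial>\<pi>)"
  proof (rule nn_integral_cong)
    fix x assume "x \<in> space \<pi>"
    then have x: "0 < x" by (simp add: space_\<pi>)
    obtain n where n: "2 / x < real (Suc n)" using reals_Archimedean2[of "2 / x"] by (meson less_trans lessI of_nat_less_iff)
    show "(SUP n. f n x) = ennreal x * indicator {0<..<1} x"
    proof (rule antisym)
      show "(SUP n. f n x) \<le> ennreal x * indicator {0<..<1} x"
        using x by (auto simp: f_def indicator_def intro!: SUP_least)
      have "2 / real (Suc n) \<le> x" using n x by (simp add: field_simps)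
      then have "ennreal x * indicator {0<..<1} x = f n x"
        using x by (auto simp: f_def indicator_def)
      then show "ennreal x * indicator {0<..<1} x \<le> (SUP n. f n x)" by (auto intro: SUP_upper)
    qed
  qed
  ultimately have "(SUP n. \<integral>\<^sup>+x. f n x \<partial>\<pi>) = \<infinity>" using inf by simp
  then have "ennreal (2 * \<bar>C\<bar>) < (SUP n. \<integral>\<^sup>+x. f n x \<partial>\<pi>)"
    by (simp only: infinity_ennreal_def ennreal_less_top)
  then obtain n where n: "ennreal (2 * \<bar>C\<bar>) < (\<integral>\<^sup>+x. f n x \<partial>\<pi>)" by (auto simp: less_SUP_iff)
  show ?thesis
  proof (rule that[of "real (Suc n)"])
    fix l :: real assume l: "real (Suc n) \<le> l"
    then have l0: "0 < l" using of_nat_0_less_iff[of "Suc n"] by linarith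
    have "ennreal (C * l) \<le> ennreal (2 * \<bar>C\<bar>) * ennreal (l / 2)"
      using l0 by (subst ennreal_mult[symmetric]) (auto intro!: ennreal_leI mult_right_mono)
    also have "\<dots> \<le> (\<integral>\<^sup>+x. f n x \<partial>\<pi>) * ennreal (l / 2)"
      using n by (intro mult_right_mono) auto
    also have "\<dots> = (\<integral>\<^sup>+x. f n x * ennreal (l / 2) \<partial>\<pi>)"
      by (rule nn_integral_multc[symmetric]) (unfold f_def, rule measurable_\<pi>, measurable)
    also have "\<dots> \<le> (\<integral>\<^sup>+x. ennreal (1 * kern (x * l)) \<partial>\<pi>)"
    proof (rule nn_integral_mono)
      fix x assume "x \<in> space \<pi>"
      then have x: "0 < x" by (simp add: space_\<pi>)
      show "f n x * ennreal (l / 2) \<le> ennreal (1 * kern (x * l))"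
      proof (cases "x \<in> {2 / real (Suc n)..<1}")
        case True
        have "2 \<le> x * real (Suc n)" using True by (simp add: field_simps)
        also have "\<dots> \<le> x * l" using l x by (intro mult_left_mono) auto
        finally have "ennreal (x * l / 2) \<le> ennreal (kern (x * l))"
          by (intro ennreal_leI kern_ge_half)
        moreover have "f n x * ennreal (l / 2) = ennreal (x * l / 2)"
          using True x l0 by (simp add: f_def ennreal_mult[symmetric] del: of_nat_Suc)
        ultimately show ?thesis by simp
      qed (simp add: f_def)
    qed
    also have "\<dots> = ennreal (\<integral>x. 1 * kern (x * l) \<partial>\<pi>)"
      by (intro nn_integral_eq_integral jump_family.integrable_jump_real[OF jump_family_all] AE_I2)
        (use l0 in \<open>auto simp: kern_nonneg space_\<pi>\<close>)
    finally have "C * l \<le> (\<integral>x. 1 * kern (x * l) \<partial>\<pi>)"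
      using l0 by (subst (asm) ennreal_le_iff)
        (auto intro!: integral_nonneg_AE AE_I2 simp: kern_nonneg space_\<pi>)
    moreover have "0 \<le> \<beta> * l\<^sup>2" using \<beta>_nonneg by (rule mult_nonneg_nonneg) simp
    ultimately show "C * l \<le> exponent \<beta> \<pi> l"
      unfolding exponent_def jump_exponent_def real_scaleR_def by linarith
  qed simp
qed

text \<open>
  The exponent is positive at \<open>2\<^sup>k l\<close> for large \<open>k\<close>, and halving the argument divides it by at most 4.
\<close>

lemma exponent_pos:
  fixes l :: real
  assumes "0 < l" shows "0 < exponent \<beta> \<pi> l"
proof -
  obtain K where K: "0 < K" "\<And>l::real. K \<le> l \<Longrightarrow> 1 * l \<le> exponent \<beta> \<pi> l"
    using exponent_superlinear[of 1] by blast
  obtain k where "K / l < 2 ^ k" using real_arch_pow[of 2 "K / l"] by auto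
  then have k: "K < 2 ^ k * l" using assms by (simp add: field_simps)
  have "exponent \<beta> \<pi> (2 ^ k * l) \<le> 4 ^ k * exponent \<beta> \<pi> l"
  proof (induction k)
    case (Suc k)
    have "exponent \<beta> \<pi> (2 * (2 ^ k * l)) \<le> 4 * exponent \<beta> \<pi> (2 ^ k * l)"
      using mono_doubling_exponent assms by (simp add: mono_doubling_def)
    with Suc show ?case by (simp add: mult.assoc)
  qed simp
  moreover have "0 < exponent \<beta> \<pi> (2 ^ k * l)" using K(2)[of "2 ^ k * l"] k K(1) by linarith
  ultimately have "0 < 4 ^ k * exponent \<beta> \<pi> l" by linarith
  then show ?thesis by (simp add: zero_less_mult_iff)
qed

text \<open>
  The jumps of size at least \<open>d\<close> contribute at most a linear function, hence eventually at most
  half of the superlinear exponent.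
\<close>

lemma small_exponent_ge:
  assumes d: "0 < d"
  obtains K where "0 < K" "\<And>l::real. K \<le> l \<Longrightarrow> exponent \<beta> \<pi> l / 2 \<le> small_exponent \<beta> \<pi> d l"
proof -
  let ?big = "\<lambda>x. indicator {d..} x :: real"
  have big_le: "\<bar>?big x * x\<bar> \<le> (1 / d + 1) * min x (x\<^sup>2)" if "0 < x" for x
  proof (cases "d \<le> x")
    case True
    have "x \<le> (1 / d + 1) * x" using d that by (simp add: field_simps)
    moreover have "x \<le> (1 / d + 1) * x\<^sup>2"
    proof -
      have "d * x \<le> x * x" using True that by (intro mult_right_mono) auto
      then have "x \<le> x\<^sup>2 / d" using d by (simp add: field_simps power2_eq_square)
      also have "\<dots> \<le> (1 / d + 1) * x\<^sup>2" by (simp add: algebra_simps)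
      finally show ?thesis .
    qed
    ultimately show ?thesis using True that by (simp add: min_def)
  qed (use d that in simp)
  have int_x: "integrable \<pi> (\<lambda>x. ?big x * x)"
    by (rule integrable_dominated_min_square[OF _ big_le]) auto
  have jf: "jump_family \<pi> ?big (\<lambda>x. x)"
  proof unfold_locales
    show "integrable \<pi> (\<lambda>x. ?big x * min x (x\<^sup>2))"
      by (rule integrable_dominated_min_square[where C = 1]) (auto simp: indicator_def)
  qed (auto simp: space_\<pi> intro: measurable_\<pi>)
  define I where "I = (\<integral>x. ?big x * x \<partial>\<pi>)"
  obtain K where K: "0 < K" "\<And>l. K \<le> l \<Longrightarrow> (2 * I) * l \<le> exponent \<beta> \<pi> l"
    using exponent_superlinear[of "2 * I"] by blast
  show ?thesis
  proof (rule that[OF K(1)])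
    fix l :: real assume "K \<le> l"
    with K have l: "0 \<le> l" "(2 * I) * l \<le> exponent \<beta> \<pi> l" by auto
    have "(\<integral>x. 1 * kern (x * l) \<partial>\<pi>) = (\<integral>x. indicator {..<d} x * kern (x * l) + ?big x * kern (x * l) \<partial>\<pi>)"
      by (rule Bochner_Integration.integral_cong) (auto simp: indicator_def)
    also have "\<dots> = (\<integral>x. indicator {..<d} x * kern (x * l) \<partial>\<pi>) + (\<integral>x. ?big x * kern (x * l) \<partial>\<pi>)"
      by (intro Bochner_Integration.integral_add jump_family.integrable_jump_real[OF jf]
          jump_family.integrable_jump_real[OF jump_family_small] l)
    finally have "exponent \<beta> \<pi> l = small_exponent \<beta> \<pi> d l + jump_exponent \<pi> ?big (\<lambda>x. x) l"
      by (simp add: exponent_def small_exponent_def jump_exponent_def)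
    moreover have "jump_exponent \<pi> ?big (\<lambda>x. x) l \<le> l * I"
      unfolding I_def by (rule jump_family.jump_exponent_le_linear[OF jf int_x l(1)])
    moreover have "2 * (l * I) \<le> exponent \<beta> \<pi> l" using l(2) by (simp add: mult_ac)
    ultimately show "exponent \<beta> \<pi> l / 2 \<le> small_exponent \<beta> \<pi> d l" by linarith
  qed
qed

end

section \<open>Integral tests\<close>

lemma mono_doubling_nonneg: "\<lbrakk>mono_doubling f; 0 \<le> s\<rbrakk> \<Longrightarrow> 0 \<le> f s"
  by (simp add: mono_doubling_def)

lemma mono_doubling_mono: "\<lbrakk>mono_doubling f; 0 \<le> r; r \<le> s\<rbrakk> \<Longrightarrow> f r \<le> f s"
  by (simp add: mono_doubling_def mono_on_def)

lemma mono_doubling_double: "\<lbrakk>mono_doubling f; 0 \<le> s\<rbrakk> \<Longrightarrow> f (2 * s) \<le> 4 * f s"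
  by (simp add: mono_doubling_def)

lemma mono_doubling_set_integrable: "mono_doubling f \<Longrightarrow> set_integrable lborel {0..s} f"
  by (rule borel_integrable_atLeastAtMost') (auto simp: mono_doubling_def intro: continuous_on_subset)

lemma mono_doubling_integral_mono_set:
  assumes f: "mono_doubling f" and "B \<in> sets borel" "B \<subseteq> {0..s}"
  shows "(LINT r:B|lborel. f r) \<le> (LINT r:{0..s}|lborel. f r)"
  unfolding set_lebesgue_integral_def
proof (rule integral_mono)
  show "integrable lborel (\<lambda>r. indicator B r *\<^sub>R f r)"
    using set_integrable_subset[OF mono_doubling_set_integrable[OF f], of B s] assms
    by (simp add: set_integrable_def)
  show "integrable lborel (\<lambda>r. indicator {0..s} r *\<^sub>R f r)"
    using mono_doubling_set_integrable[OF f, of s] by (simp add: set_integrable_def)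
  show "indicator B r *\<^sub>R f r \<le> indicator {0..s} r *\<^sub>R f r" for r
    using assms by (auto simp: indicator_def mono_doubling_nonneg)
qed

lemma set_integral_const_atLeastAtMost:
  "a \<le> b \<Longrightarrow> (LINT r:{a..b}|lborel. c) = (b - a) * (c::real)"
  by (simp add: set_lebesgue_integral_def)

lemma mono_doubling_integral_le:
  assumes "mono_doubling f" "0 \<le> s" shows "(LINT r:{0..s}|lborel. f r) \<le> s * f s"
proof -
  have "(LINT r:{0..s}|lborel. f r) \<le> (LINT r:{0..s}|lborel. f s)"
    by (rule set_integral_mono)
      (use assms in \<open>auto intro: mono_doubling_set_integrable mono_doubling_mono continuous_on_const borel_integrable_atLeastAtMost'\<close>)
  then show ?thesis using assms by (simp add: set_integral_const_atLeastAtMost)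
qed

lemma mono_doubling_integral_ge:
  assumes "mono_doubling f" "0 \<le> s" shows "s * f s / 8 \<le> (LINT r:{0..s}|lborel. f r)"
proof -
  have "f s \<le> 4 * f (s / 2)" using mono_doubling_double[of f "s / 2"] assms by simp
  then have "s / 2 * (f s / 4) \<le> s / 2 * f (s / 2)"
    using assms by (intro mult_left_mono) auto
  also have "\<dots> = (LINT r:{s / 2..s}|lborel. f (s / 2))"
    using assms by (simp add: set_integral_const_atLeastAtMost)
  also have "\<dots> \<le> (LINT r:{s / 2..s}|lborel. f r)"
  proof (rule set_integral_mono)
    show "set_integrable lborel {s / 2..s} f"
      by (rule set_integrable_subset[OF mono_doubling_set_integrable[OF assms(1), of s]]) (use assms in auto)
  qed (use assms in \<open>auto intro: mono_doubling_mono continuous_on_const borel_integrable_atLeastAtMost'\<close>)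
  also have "\<dots> \<le> (LINT r:{0..s}|lborel. f r)"
    by (rule mono_doubling_integral_mono_set[OF assms(1)]) (use assms in auto)
  finally show ?thesis by simp
qed

text \<open>
  With this transformation the condition \<open>Sheu\<close> for \<open>f\<close> is the integral test of \<open>Grey\<close> for
  \<open>root_primitive f\<close>, so that the criteria below cover both.
\<close>

definition root_primitive :: "(real \<Rightarrow> real) \<Rightarrow> real \<Rightarrow> real" where
  "root_primitive f s = sqrt (LINT r:{0..s}|lborel. f r)"

lemma root_primitive_cong:
  "(\<And>r. \<lbrakk>0 \<le> r; r \<le> s\<rbrakk> \<Longrightarrow> f r = g r) \<Longrightarrow> root_primitive f s = root_primitive g s"
  unfolding root_primitive_def by (intro arg_cong[where f = sqrt] set_lebesgue_integral_cong) auto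

text \<open>
  A comparison at the single point \<open>s\<close> is enough, because for both functions the primitive at \<open>s\<close>
  is \<open>s f s\<close> up to a factor 8.
\<close>

lemma root_primitive_le:
  assumes f: "mono_doubling f" and g: "mono_doubling g" and s: "0 \<le> s" and le: "f s \<le> 2 * g s"
  shows "root_primitive f s \<le> 4 * root_primitive g s"
proof -
  have "(LINT r:{0..s}|lborel. f r) \<le> s * f s" by (rule mono_doubling_integral_le[OF f s])
  also have "\<dots> \<le> s * (2 * g s)" using le s by (rule mult_left_mono)
  also have "\<dots> \<le> 16 * (LINT r:{0..s}|lborel. g r)" using mono_doubling_integral_ge[OF g s] by simp
  finally have "sqrt (LINT r:{0..s}|lborel. f r) \<le> sqrt (4\<^sup>2 * (LINT r:{0..s}|lborel. g r))"
    by (intro real_sqrt_le_mono) simp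
  then show ?thesis unfolding root_primitive_def real_sqrt_mult by simp
qed

lemma root_primitive_pos:
  assumes "mono_doubling f" "0 < s" "0 < f s" shows "0 < root_primitive f s"
proof -
  have "0 < s * f s / 8" using assms by simp
  also have "\<dots> \<le> (LINT r:{0..s}|lborel. f r)" using assms by (intro mono_doubling_integral_ge) auto
  finally show ?thesis by (simp add: root_primitive_def)
qed

lemma root_primitive_mono:
  assumes f: "mono_doubling f" shows "mono (root_primitive f)"
proof (rule monoI)
  fix s t :: real assume "s \<le> t"
  then show "root_primitive f s \<le> root_primitive f t"
    unfolding root_primitive_def
    by (intro real_sqrt_le_mono mono_doubling_integral_mono_set[OF f]) auto
qed

lemma mono_doubling_extension_mono: "mono_doubling f \<Longrightarrow> mono (\<lambda>s. f (max 0 s))"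
  by (rule monoI, rule mono_doubling_mono) auto

text \<open>
  Includes nonpositive \<open>f\<close>, where the right-hand side is infinite.
\<close>

lemma inverse_ennreal_le:
  assumes "0 < c" "c * f \<le> g" shows "1 / ennreal g \<le> ennreal (1 / c) * (1 / ennreal f)"
proof (cases "0 < f")
  case True
  then have g: "0 < g" using assms by (auto intro: less_le_trans[OF mult_pos_pos])
  have "1 / g \<le> 1 / c * (1 / f)" using True assms g by (simp add: divide_simps mult_ac)
  then have "ennreal (1 / g) \<le> ennreal (1 / c) * ennreal (1 / f)"
    using assms(1) True by (subst ennreal_mult[symmetric]) (auto intro: ennreal_leI)
  then show ?thesis using divide_ennreal[of 1 g] divide_ennreal[of 1 f] True g by simp
next
  case False
  then have "ennreal f = 0" by (simp add: ennreal_neg)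
  then show ?thesis using assms by (simp add: ennreal_mult_top)
qed

lemma tail_nn_integral_tendsto_0:
  fixes G :: "real \<Rightarrow> ennreal"
  assumes [measurable]: "G \<in> borel_measurable borel" and fin: "(\<integral>\<^sup>+s\<in>{1..}. G s \<partial>lborel) < \<infinity>"
  shows "((\<lambda>y. \<integral>\<^sup>+s\<in>{y..}. G s \<partial>lborel) \<longlongrightarrow> 0) at_top"
proof -
  have "((\<lambda>y. \<integral>\<^sup>+s\<in>{max 1 y..}. G s \<partial>lborel) \<longlongrightarrow> 0) at_top"
  proof (rule tendsto_at_topI_sequentially)
    fix X :: "nat \<Rightarrow> real" assume X: "filterlim X at_top sequentially"
    have "(\<lambda>n. \<integral>\<^sup>+s\<in>{max 1 (X n)..}. G s \<partial>lborel) \<longlonglongrightarrow> (\<integral>\<^sup>+s. 0 \<partial>(lborel :: real measure))"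
    proof (rule nn_integral_dominated_convergence[where w = "\<lambda>s. G s * indicator {1..} s"])
      show "AE s in lborel. (\<lambda>n. G s * indicator {max 1 (X n)..} s) \<longlonglongrightarrow> 0"
      proof (rule AE_I2)
        fix s
        have "\<forall>\<^sub>F n in sequentially. s < X n" using X by (simp add: filterlim_at_top_dense)
        then have "\<forall>\<^sub>F n in sequentially. G s * indicator {max 1 (X n)..} s = 0"
          by eventually_elim (simp add: indicator_def)
        then show "(\<lambda>n. G s * indicator {max 1 (X n)..} s) \<longlonglongrightarrow> 0" by (rule tendsto_eventually)
      qed
    qed (use fin in \<open>auto simp: indicator_def\<close>)
    then show "(\<lambda>n. \<integral>\<^sup>+s\<in>{max 1 (X n)..}. G s \<partial>lborel) \<longlonglongrightarrow> 0" by simp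
  qed
  moreover have "\<forall>\<^sub>F y in at_top. (\<integral>\<^sup>+s\<in>{max 1 y..}. G s \<partial>lborel) = (\<integral>\<^sup>+s\<in>{y..}. G s \<partial>lborel)"
    using eventually_ge_at_top[of "1::real"] by eventually_elim (simp add: max_def)
  ultimately show ?thesis by (rule Lim_transform_eventually)
qed

text \<open>
  The function that bounds \<open>F n\<close> from below may depend on the point: \<open>1 / F n\<close> is dominated by
  a multiple of \<open>1 / f + 1 / g\<close> in either case, uniformly in \<open>n\<close>.
\<close>

lemma limsup_tail_integrals_tendsto_0:
  fixes F :: "nat \<Rightarrow> real \<Rightarrow> real"
  assumes [measurable]: "f \<in> borel_measurable borel" "g \<in> borel_measurable borel"
    and fin: "(\<integral>\<^sup>+s\<in>{1..}. 1 / ennreal (f s) \<partial>lborel) < \<infinity>" "(\<integral>\<^sup>+s\<in>{1..}. 1 / ennreal (g s) \<partial>lborel) < \<infinity>"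
    and c: "0 < c"
    and le: "\<And>n s. \<lbrakk>1 \<le> s; s \<le> a n\<rbrakk> \<Longrightarrow> c * f s \<le> F n s \<or> c * g s \<le> F n s"
  shows "((\<lambda>y::real. limsup (\<lambda>n. \<integral>\<^sup>+s\<in>{y..a n}. 1 / ennreal (F n s) \<partial>lborel)) \<longlongrightarrow> 0) at_top"
proof -
  define G where "G s = ennreal (1 / c) * (1 / ennreal (f s)) + ennreal (1 / c) * (1 / ennreal (g s))" for s
  have [measurable]: "G \<in> borel_measurable borel" unfolding G_def by measurable
  have "(\<integral>\<^sup>+s\<in>{1..}. G s \<partial>lborel) =
      ennreal (1 / c) * (\<integral>\<^sup>+s\<in>{1..}. 1 / ennreal (f s) \<partial>lborel) +
      ennreal (1 / c) * (\<integral>\<^sup>+s\<in>{1..}. 1 / ennreal (g s) \<partial>lborel)"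
    unfolding G_def distrib_right mult.assoc by (simp add: nn_integral_add nn_integral_cmult)
  also have "\<dots> < \<infinity>" using fin by (simp add: ennreal_mult_less_top)
  finally have "((\<lambda>y. \<integral>\<^sup>+s\<in>{y..}. G s \<partial>lborel) \<longlongrightarrow> 0) at_top"
    by (intro tail_nn_integral_tendsto_0) simp_all
  then show ?thesis
  proof (rule tendsto_sandwich[OF _ _ tendsto_const, rotated 2])
    show "\<forall>\<^sub>F y in at_top. limsup (\<lambda>n. \<integral>\<^sup>+s\<in>{y..a n}. 1 / ennreal (F n s) \<partial>lborel) \<le> (\<integral>\<^sup>+s\<in>{y..}. G s \<partial>lborel)"
      using eventually_ge_at_top[of "1::real"]
    proof eventually_elim
      case (elim y)
      have "(\<integral>\<^sup>+s\<in>{y..a n}. 1 / ennreal (F n s) \<partial>lborel) \<le> (\<integral>\<^sup>+s\<in>{y..}. G s \<partial>lborel)" for n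
      proof (rule nn_integral_mono)
        fix s
        show "1 / ennreal (F n s) * indicator {y..a n} s \<le> G s * indicator {y..} s"
        proof (cases "s \<in> {y..a n}")
          case True
          then have "c * f s \<le> F n s \<or> c * g s \<le> F n s" using elim by (intro le) auto
          then have "1 / ennreal (F n s) \<le> G s"
            unfolding G_def using c
            by (auto intro: order_trans[OF inverse_ennreal_le] add_increasing add_increasing2)
          then show ?thesis using True by simp
        qed simp
      qed
      then show ?case by (intro Limsup_bounded always_eventually) auto
    qed
  qed simp
qed

text \<open>
  Each window \<open>[t m, A m]\<close> carries a unit of the integral of \<open>1 / g\<close>, and for large \<open>n\<close> the window of
  index \<open>k n\<close> is contained in \<open>[y, a n]\<close> whatever \<open>y\<close> is.
\<close>

lemma not_limsup_tail_integrals_tendsto_0: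
  fixes F :: "nat \<Rightarrow> real \<Rightarrow> real" and k :: "nat \<Rightarrow> nat"
  assumes [measurable]: "g \<in> borel_measurable borel"
    and c: "0 < c" and k: "filterlim k at_top sequentially"
    and t: "\<And>m. real m \<le> t m"
    and one: "\<And>m. 1 \<le> (\<integral>\<^sup>+s\<in>{t m..A m}. 1 / ennreal (g s) \<partial>lborel)"
    and A: "\<forall>\<^sub>F n in sequentially. A (k n) \<le> a n"
    and le: "\<And>n s. \<lbrakk>t (k n) \<le> s; s \<le> a n\<rbrakk> \<Longrightarrow> F n s \<le> c * g s"
  shows "\<not> ((\<lambda>y::real. limsup (\<lambda>n. \<integral>\<^sup>+s\<in>{y..a n}. 1 / ennreal (F n s) \<partial>lborel)) \<longlongrightarrow> 0) at_top"
proof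
  assume lim: "((\<lambda>y::real. limsup (\<lambda>n. \<integral>\<^sup>+s\<in>{y..a n}. 1 / ennreal (F n s) \<partial>lborel)) \<longlongrightarrow> 0) at_top"
  have "ennreal (1 / c) \<le> limsup (\<lambda>n. \<integral>\<^sup>+s\<in>{y..a n}. 1 / ennreal (F n s) \<partial>lborel)" for y
  proof (rule le_Limsup)
    have "\<forall>\<^sub>F n in sequentially. nat \<lceil>y\<rceil> \<le> k n" 
      using k[unfolded filterlim_at_top] by blast
    then show "\<forall>\<^sub>F n in sequentially. ennreal (1 / c) \<le> (\<integral>\<^sup>+s\<in>{y..a n}. 1 / ennreal (F n s) \<partial>lborel)"
      using A
    proof eventually_elim
      case (elim n)
      have y: "y \<le> t (k n)" using elim(1) t[of "k n"] by linarith
      have "ennreal (1 / c) \<le> ennreal (1 / c) * (\<integral>\<^sup>+s\<in>{t (k n)..A (k n)}. 1 / ennreal (g s) \<partial>lborel)"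
        using mult_left_mono[OF one[of "k n"], of "ennreal (1 / c)"] by simp
      also have "\<dots> = (\<integral>\<^sup>+s. ennreal (1 / c) * (1 / ennreal (g s) * indicator {t (k n)..A (k n)} s) \<partial>lborel)"
        by (rule nn_integral_cmult[symmetric]) measurable
      also have "\<dots> \<le> (\<integral>\<^sup>+s\<in>{y..a n}. 1 / ennreal (F n s) \<partial>lborel)"
      proof (rule nn_integral_mono)
        fix s
        show "ennreal (1 / c) * (1 / ennreal (g s) * indicator {t (k n)..A (k n)} s) \<le>
          1 / ennreal (F n s) * indicator {y..a n} s"
        proof (cases "s \<in> {t (k n)..A (k n)}")
          case True
          then have "(1 / c) * F n s \<le> g s" using le[of n s] elim c by (simp add: field_simps)
          from inverse_ennreal_le[OF _ this] c have "1 / ennreal (g s) \<le> ennreal c * (1 / ennreal (F n s))"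
            by simp
          then have "ennreal (1 / c) * (1 / ennreal (g s)) \<le> ennreal (1 / c) * (ennreal c * (1 / ennreal (F n s)))"
            by (rule mult_left_mono) simp
          also have "\<dots> = 1 / ennreal (F n s)"
            using c by (simp add: mult.assoc[symmetric] ennreal_mult[symmetric])
          finally show ?thesis using True y elim by simp
        qed simp
      qed
      finally show ?case .
    qed
  qed simp
  then have "ennreal (1 / c) \<le> 0"
    by (intro tendsto_lowerbound[OF lim]) auto
  then show False using c by simp
qed

lemma infinite_integral_escapes:
  fixes h :: "real \<Rightarrow> ennreal"
  assumes [measurable]: "h \<in> borel_measurable borel"
    and inf: "(\<integral>\<^sup>+s\<in>{1..}. h s \<partial>lborel) = \<infinity>"
    and bd: "\<And>s. 1 \<le> s \<Longrightarrow> h s \<le> ennreal H"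
  obtains A where "1 \<le> (\<integral>\<^sup>+s\<in>{t..A}. h s \<partial>lborel)"
proof -
  have "(\<integral>\<^sup>+s\<in>{1..}. h s \<partial>lborel) \<le> (\<integral>\<^sup>+s. ennreal H * indicator {1..t} s + h s * indicator {t..} s \<partial>lborel)"
    by (rule nn_integral_mono) (auto simp: indicator_def bd intro: add_increasing2 order_trans[OF bd])
  also have "\<dots> = ennreal H * emeasure lborel {1..t} + (\<integral>\<^sup>+s\<in>{t..}. h s \<partial>lborel)"
    by (subst nn_integral_add) (auto simp: nn_integral_cmult_indicator)
  finally have tail: "(\<integral>\<^sup>+s\<in>{t..}. h s \<partial>lborel) = \<infinity>"
    using inf by (cases "1 \<le> t") (auto simp: top_unique ennreal_mult_eq_top_iff)
  have "(\<integral>\<^sup>+s. (SUP n. h s * indicator {t..real n} s) \<partial>lborel) =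
      (SUP n. \<integral>\<^sup>+s\<in>{t..real n}. h s \<partial>lborel)"
    by (rule nn_integral_monotone_convergence_SUP)
      (auto simp: incseq_def le_fun_def indicator_def)
  moreover have "(SUP n. h s * indicator {t..real n} s) = h s * indicator {t..} s" for s
  proof (rule antisym)
    show "(SUP n. h s * indicator {t..real n} s) \<le> h s * indicator {t..} s"
      by (auto simp: indicator_def intro!: SUP_least)
    obtain n where "s \<le> real n" using real_arch_simple by blast
    then have "h s * indicator {t..} s = h s * indicator {t..real n} s" by (simp add: indicator_def)
    then show "h s * indicator {t..} s \<le> (SUP n. h s * indicator {t..real n} s)"
      by (auto intro: SUP_upper)
  qed
  ultimately have "1 < (SUP n. \<integral>\<^sup>+s\<in>{t..real n}. h s \<partial>lborel)"
    using tail by (simp add: infinity_ennreal_def)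
  then obtain n where "1 < (\<integral>\<^sup>+s\<in>{t..real n}. h s \<partial>lborel)" by (auto simp: less_SUP_iff)
  then show ?thesis using that[of "real n"] by simp
qed

text \<open>
  Take for \<open>k n\<close> the largest \<open>m \<le> n\<close> such that \<open>A m \<le> a i\<close> for all \<open>i \<ge> n\<close>.
\<close>

lemma slow_index:
  fixes a :: "nat \<Rightarrow> real"
  assumes a: "filterlim a at_top sequentially"
  obtains k :: "nat \<Rightarrow> nat" where "filterlim k at_top sequentially" "\<forall>\<^sub>F n in sequentially. A (k n) \<le> a n"
proof -
  define S where "S n = {m. m \<le> n \<and> (\<forall>i\<ge>n. A m \<le> a i)}" for n
  define k where "k n = Max (insert 0 (S n))" for n
  have fin: "finite (S n)" for n by (rule finite_subset[of _ "{..n}"]) (auto simp: S_def)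
  have S: "\<forall>\<^sub>F n in sequentially. m \<in> S n" for m
  proof -
    have "\<forall>\<^sub>F n in sequentially. A m \<le> a n" using a by (simp add: filterlim_at_top)
    then obtain N where "\<forall>n\<ge>N. A m \<le> a n" by (auto simp: eventually_sequentially)
    then show ?thesis unfolding eventually_sequentially by (intro exI[of _ "max N m"]) (auto simp: S_def)
  qed
  show ?thesis
  proof (rule that)
    show "filterlim k at_top sequentially"
      unfolding filterlim_at_top
    proof
      fix m show "\<forall>\<^sub>F n in sequentially. m \<le> k n"
        using S[of m] by eventually_elim (auto simp: k_def fin intro!: Max_ge)
    qed
    show "\<forall>\<^sub>F n in sequentially. A (k n) \<le> a n"
      using S[of 0]
    proof eventually_elim
      case (elim n)
      have "k n \<in> insert 0 (S n)" unfolding k_def by (rule Max_in) (auto simp: fin)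
      with elim have "k n \<in> S n" by auto
      then show ?case by (auto simp: S_def)
    qed
  qed
qed

section \<open>Offspring laws interpolating between two exponents\<close>

text \<open>
  The exponent from which the offspring laws are built: the clumped part makes it look like the
  limit for moderate arguments, the small jumps make it look like the driving exponent for large ones.
\<close>

definition mixed_exponent ::
  "real \<Rightarrow> real measure \<Rightarrow> real \<Rightarrow> real measure \<Rightarrow> real \<Rightarrow> real \<Rightarrow> 'a \<Rightarrow>
    'a::{real_normed_field,banach,second_countable_topology}" where
  "mixed_exponent \<gamma> \<rho> \<beta> \<pi> e d z = clumped_exponent \<gamma> \<rho> e z + small_exponent \<beta> \<pi> d z"

lemma exponent_add: "exponent (\<gamma> + \<beta>) \<rho> z = exponent \<gamma> \<rho> z + \<beta> *\<^sub>R z\<^sup>2"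
  by (simp add: exponent_def scaleR_add_left)

text \<open>
  The limit is \<open>exponent (\<gamma> + \<beta>) \<rho>\<close> and the driving exponent is \<open>exponent \<beta> \<pi>\<close>.  The quadratic part
  of the latter survives in the limit, so it has to be contained in that of the former.
\<close>

locale interpolation =
  coarse: levy_data \<gamma> \<rho> + fine: levy_data_infinite_variation \<beta> \<pi>
  for \<gamma> \<rho> \<beta> \<pi>
begin

abbreviation mixed where "mixed \<equiv> mixed_exponent \<gamma> \<rho> \<beta> \<pi>"

lemma mixed_of_real:
  assumes "0 < e" "e \<le> 1"
  shows "mixed e d (of_real l :: complex) = of_real (mixed e d l)"
  by (simp add: mixed_exponent_def coarse.clumped_exponent_of_real[OF assms] fine.small_exponent_of_real)

lemma mono_doubling_mixed:
  assumes "0 < e" "e \<le> 1" shows "mono_doubling (mixed e d)"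
  unfolding mixed_exponent_def[abs_def]
  by (intro mono_doubling_add coarse.mono_doubling_clumped_exponent[OF assms] fine.mono_doubling_small_exponent)

lemma branching_coeffs_mixed:
  assumes "0 < a" "0 < e" "e \<le> 1" obtains w where "branching_coeffs (mixed e d) a w"
proof -
  obtain u v where "branching_coeffs (clumped_exponent \<gamma> \<rho> e) a u"
    "branching_coeffs (small_exponent \<beta> \<pi> d) a v"
    using coarse.branching_coeffs_clumped_exponent[OF assms]
      fine.branching_coeffs_small_exponent[OF assms(1)] by metis
  from branching_coeffs_add[OF this] show ?thesis
    by (intro that) (simp add: mixed_exponent_def[abs_def])
qed

lemma mixed_tendsto:
  assumes e: "e \<longlonglongrightarrow> 0" "\<And>n. 0 < e n" "\<And>n. e n \<le> 1" and d: "d \<longlonglongrightarrow> 0"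
    and z: "z \<longlonglongrightarrow> z'" "\<And>n. 0 \<le> Re (z n)"
  shows "(\<lambda>n. mixed (e n) (d n) (z n)) \<longlonglongrightarrow> exponent (\<gamma> + \<beta>) \<rho> z'"
  using tendsto_add[OF coarse.clumped_exponent_tendsto[OF e z] fine.small_exponent_tendsto[OF d z]]
  by (simp add: mixed_exponent_def exponent_add scaleR_conv_of_real)

lemma mixed_ge_coarse:
  assumes e: "0 < e" "e \<le> 1" and s: "0 \<le> s" "s \<le> 1 / e"
  shows "exponent (\<gamma> + \<beta>) \<rho> s \<le> 2 * mixed e d s"
proof -
  have "0 \<le> jump_exponent \<pi> (indicator {..<d}) (\<lambda>x. x) s"
    by (rule mono_doubling_nonneg[OF jump_family.mono_doubling_jump_exponent[OF fine.jump_family_small] s(1)])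
  moreover have "0 \<le> \<beta> * s\<^sup>2" using fine.\<beta>_nonneg by simp
  ultimately show ?thesis
    using coarse.clumped_exponent_ge[OF e s]
    by (simp add: mixed_exponent_def exponent_add small_exponent_def)
qed

lemma mono_doubling_target: "mono_doubling (exponent (\<gamma> + \<beta>) \<rho>)"
  unfolding exponent_add[abs_def] real_scaleR_def
  by (intro mono_doubling_add mono_doubling_cmult coarse.mono_doubling_exponent mono_doubling_power2 fine.\<beta>_nonneg)

text \<open>
  The size \<open>e\<close> is chosen after \<open>d\<close>: as the small jumps dominate from some \<open>K\<close> on, taking \<open>e \<le> 1 / K\<close>
  leaves no gap between the range \<open>s \<le> 1 / e\<close>, where the clumped part is large enough, and the range
  where the small jumps are.  The clumped part grows linearly, hence is below the driving exponent
  from some \<open>t\<close> on.  Finally \<open>A\<close> is so large that \<open>[t, A]\<close> carries a unit of each divergent integral.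
\<close>

lemma mixing_scales:
  fixes d \<delta> \<tau> :: real
  assumes d: "0 < d" and \<delta>: "0 < \<delta>" "\<delta> \<le> 1"
  obtains e t A where "0 < e" "e \<le> \<delta>" "\<tau> \<le> t" "t \<le> A" "1 / e \<le> A"
    "\<And>s. 1 / e \<le> s \<Longrightarrow> exponent \<beta> \<pi> s \<le> 2 * mixed e d s"
    "\<And>s. t \<le> s \<Longrightarrow> mixed e d s \<le> 2 * exponent \<beta> \<pi> s"
    "(\<integral>\<^sup>+s\<in>{1..}. 1 / ennreal (exponent \<beta> \<pi> (max 0 s)) \<partial>lborel) = \<infinity> \<Longrightarrow>
      1 \<le> (\<integral>\<^sup>+s\<in>{t..A}. 1 / ennreal (exponent \<beta> \<pi> (max 0 s)) \<partial>lborel)"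
    "(\<integral>\<^sup>+s\<in>{1..}. 1 / ennreal (root_primitive (exponent \<beta> \<pi>) s) \<partial>lborel) = \<infinity> \<Longrightarrow>
      1 \<le> (\<integral>\<^sup>+s\<in>{t..A}. 1 / ennreal (root_primitive (exponent \<beta> \<pi>) s) \<partial>lborel)"
proof -
  obtain K where K: "0 < K" "\<And>s::real. K \<le> s \<Longrightarrow> exponent \<beta> \<pi> s / 2 \<le> small_exponent \<beta> \<pi> d s"
    using fine.small_exponent_ge[OF d] by blast
  define e where "e = min \<delta> (1 / K)"
  have e: "0 < e" "e \<le> \<delta>" "e \<le> 1" "K \<le> 1 / e"
  proof -
    show "0 < e" "e \<le> \<delta>" using \<delta> K(1) by (simp_all add: e_def)
    then show "e \<le> 1" using \<delta>(2) by simp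
    have "e \<le> 1 / K" by (simp add: e_def)
    then show "K \<le> 1 / e" using K(1) \<open>0 < e\<close> by (simp add: field_simps)
  qed
  obtain C where C: "\<And>s::real. 0 \<le> s \<Longrightarrow> clumped_exponent \<gamma> \<rho> e s \<le> C * s"
    using coarse.clumped_exponent_le_linear[OF e(1,3)] by blast
  obtain T where T: "0 < T" "\<And>s::real. T \<le> s \<Longrightarrow> C * s \<le> exponent \<beta> \<pi> s"
    using fine.exponent_superlinear[of C] by blast
  define t where "t = max \<tau> T"
  have lower: "exponent \<beta> \<pi> s \<le> 2 * mixed e d s" if "1 / e \<le> s" for s
  proof -
    have "0 \<le> s" using that e K(1) by linarith
    then have "0 \<le> clumped_exponent \<gamma> \<rho> e s"
      by (rule mono_doubling_nonneg[OF coarse.mono_doubling_clumped_exponent[OF e(1,3)]])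
    then show ?thesis using K(2)[of s] that e by (simp add: mixed_exponent_def)
  qed
  have upper: "mixed e d s \<le> 2 * exponent \<beta> \<pi> s" if "t \<le> s" for s
    using that C[of s] T(2)[of s] T(1) fine.small_exponent_le[of s d]
    by (simp add: mixed_exponent_def t_def)
  have escape: "\<exists>A. (\<integral>\<^sup>+s\<in>{1..}. 1 / ennreal (h s) \<partial>lborel) = \<infinity> \<longrightarrow>
      1 \<le> (\<integral>\<^sup>+s\<in>{t..A}. 1 / ennreal (h s) \<partial>lborel)"
    if h: "mono h" "0 < h 1" for h :: "real \<Rightarrow> real"
  proof -
    have meas: "(\<lambda>s. 1 / ennreal (h s)) \<in> borel_measurable borel"
      using borel_measurable_mono[OF h(1)] by measurable
    have bd: "1 / ennreal (h s) \<le> ennreal (1 / h 1)" if "1 \<le> s" for s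
      using inverse_ennreal_le[of "h 1" 1 "h s"] h monoD[OF h(1) that] by simp
    show ?thesis
    proof (cases "(\<integral>\<^sup>+s\<in>{1..}. 1 / ennreal (h s) \<partial>lborel) = \<infinity>")
      case True
      from infinite_integral_escapes[OF meas this bd] show ?thesis by blast
    qed simp
  qed
  obtain A1 where A1: "(\<integral>\<^sup>+s\<in>{1..}. 1 / ennreal (exponent \<beta> \<pi> (max 0 s)) \<partial>lborel) = \<infinity> \<Longrightarrow>
      1 \<le> (\<integral>\<^sup>+s\<in>{t..A1}. 1 / ennreal (exponent \<beta> \<pi> (max 0 s)) \<partial>lborel)"
    using escape[OF mono_doubling_extension_mono[OF fine.mono_doubling_exponent]] fine.exponent_pos[of 1] by auto
  obtain A2 where A2: "(\<integral>\<^sup>+s\<in>{1..}. 1 / ennreal (root_primitive (exponent \<beta> \<pi>) s) \<partial>lborel) = \<infinity> \<Longrightarrow>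
      1 \<le> (\<integral>\<^sup>+s\<in>{t..A2}. 1 / ennreal (root_primitive (exponent \<beta> \<pi>) s) \<partial>lborel)"
    using escape[OF root_primitive_mono[OF fine.mono_doubling_exponent]]
      root_primitive_pos[OF fine.mono_doubling_exponent _ fine.exponent_pos[of 1]] by auto
  define A where "A = Max {t, 1 / e, A1, A2}"
  have A: "t \<le> A" "1 / e \<le> A" "A1 \<le> A" "A2 \<le> A" by (auto simp: A_def)
  show ?thesis
  proof (rule that[OF e(1,2) _ A(1,2) lower upper])
    show "\<tau> \<le> t" by (simp add: t_def)
    show "1 \<le> (\<integral>\<^sup>+s\<in>{t..A}. 1 / ennreal (exponent \<beta> \<pi> (max 0 s)) \<partial>lborel)"
      if "(\<integral>\<^sup>+s\<in>{1..}. 1 / ennreal (exponent \<beta> \<pi> (max 0 s)) \<partial>lborel) = \<infinity>"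
      by (rule order_trans[OF A1[OF that] nn_set_integral_set_mono]) (use A in auto)
    show "1 \<le> (\<integral>\<^sup>+s\<in>{t..A}. 1 / ennreal (root_primitive (exponent \<beta> \<pi>) s) \<partial>lborel)"
      if "(\<integral>\<^sup>+s\<in>{1..}. 1 / ennreal (root_primitive (exponent \<beta> \<pi>) s) \<partial>lborel) = \<infinity>"
      by (rule order_trans[OF A2[OF that] nn_set_integral_set_mono]) (use A in auto)
  qed auto
qed

end

lemma psi_n_eq:
  assumes gen: "\<And>r. cmod r \<le> 1 \<Longrightarrow>
       (\<lambda>k. of_real (pmf (\<mu> n) k) * r ^ k) sums (r + \<Psi> (of_real (a n) * (1 - r)) / of_real (b n))"
    and \<Psi>: "\<Psi> (of_real s) = of_real (\<psi> s)"
    and a: "0 < a n" and b: "0 < b n" and s: "0 \<le> s" "s \<le> a n"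
  shows "psi_n a b \<mu> n s = \<psi> s"
proof -
  let ?r = "1 - s / a n"
  have "\<bar>?r\<bar> \<le> 1" using a s by (auto simp: abs_le_iff)
  then have "cmod (of_real ?r) \<le> 1" by (simp only: norm_of_real)
  from gen[OF this] have "(\<lambda>k. complex_of_real (?r ^ k * pmf (\<mu> n) k)) sums
      (of_real ?r + \<Psi> (of_real (a n) * (1 - of_real ?r)) / of_real (b n))"
    by (simp add: mult.commute)
  also have "complex_of_real (a n) * (1 - of_real ?r) = of_real s" using a by simp
  also have "of_real ?r + \<Psi> (of_real s) / of_real (b n) = complex_of_real (?r + \<psi> s / b n)" by (simp add: \<Psi>)
  finally have "(\<lambda>k. ?r ^ k * pmf (\<mu> n) k) sums (?r + \<psi> s / b n)" by (simp only: sums_of_real_iff)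
  then have "pgf (\<mu> n) ?r = ?r + \<psi> s / b n" unfolding pgf_def by (rule sums_unique[symmetric])
  then show ?thesis using b by (simp add: psi_n_def)
qed

context interpolation
begin

text \<open>
  The index \<open>k n\<close> picks scales whose bound \<open>A\<close> is below \<open>a\<^sub>n\<close>.  Hence \<open>a\<^sub>n\<close> belongs to the range where the
  mixed exponent is within a factor 2 of \<open>\<phi>\<close>, which makes \<open>b\<^sub>n\<close> comparable to \<open>\<phi> (a\<^sub>n)\<close>, and
  \<open>[y, a\<^sub>n]\<close> contains a window that carries a unit of any divergent integral.  Convergent integrals are
  transferred by the lower bound by \<open>\<psi> / 2\<close> or \<open>\<phi> / 2\<close>, which holds at every point.
\<close>

lemma interpolating_offspring_laws:
  fixes a :: "nat \<Rightarrow> real" and \<psi> \<phi> :: "real \<Rightarrow> real"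
  assumes \<psi>: "\<And>s. 0 \<le> s \<Longrightarrow> \<psi> s = exponent (\<gamma> + \<beta>) \<rho> s"
    and \<phi>: "\<And>s. 0 \<le> s \<Longrightarrow> \<phi> s = exponent \<beta> \<pi> s"
    and \<psi>_pos: "\<And>s. 0 < s \<Longrightarrow> 0 < \<psi> s"
    and a: "\<And>n. 0 < a n" "filterlim a at_top sequentially"
    and q: "0 < q" "q < 1"
  obtains b \<mu> where "admissible_seqs b \<mu>" "Luka a b \<mu> \<psi>" "\<And>n. pmf (\<mu> n) 1 = q"
    "asymp_infty b (\<lambda>n. \<phi> (a n))"
    "Grey \<psi> \<Longrightarrow> Grey \<phi> \<Longrightarrow> Grey_seq a b \<mu>"
    "Sheu \<psi> \<Longrightarrow> Sheu \<phi> \<Longrightarrow> Sheu_seq a b \<mu>"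
    "\<not> Grey \<phi> \<Longrightarrow> \<not> Grey_seq a b \<mu>"
    "\<not> Sheu \<phi> \<Longrightarrow> \<not> Sheu_seq a b \<mu>"
proof -
  define \<delta> where "\<delta> m = inverse (real (Suc m))" for m
  \<comment> \<open>The exponents are only monotone on \<open>[0, \<infinity>)\<close>; the extension by a constant is monotone everywhere,
    hence measurable.\<close>
  define f where "f s = exponent (\<gamma> + \<beta>) \<rho> (max 0 s)" for s :: real
  define g where "g s = exponent \<beta> \<pi> (max 0 s)" for s :: real
  define F where "F = root_primitive (exponent (\<gamma> + \<beta>) \<rho>)"
  define G where "G = root_primitive (exponent \<beta> \<pi>)"
  have meas: "f \<in> borel_measurable borel" "g \<in> borel_measurable borel"
      "F \<in> borel_measurable borel" "G \<in> borel_measurable borel"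
    unfolding f_def[abs_def] g_def[abs_def] F_def G_def
    by (intro borel_measurable_mono mono_doubling_extension_mono root_primitive_mono mono_doubling_target fine.mono_doubling_exponent)+
  have Grey: "Grey \<psi> \<longleftrightarrow> (\<integral>\<^sup>+s\<in>{1..}. 1 / ennreal (f s) \<partial>lborel) < \<infinity>"
      "Grey \<phi> \<longleftrightarrow> (\<integral>\<^sup>+s\<in>{1..}. 1 / ennreal (g s) \<partial>lborel) < \<infinity>"
    unfolding Grey_def f_def g_def
    by (intro arg_cong[where f = "\<lambda>x. x < \<infinity>"] nn_integral_cong; auto simp: indicator_def max_def \<psi> \<phi>)+
  have "root_primitive \<psi> = F" "root_primitive \<phi> = G"
    unfolding F_def G_def by (intro ext root_primitive_cong \<psi> \<phi>; simp)+
  then have Sheu: "Sheu \<psi> \<longleftrightarrow> (\<integral>\<^sup>+s\<in>{1..}. 1 / ennreal (F s) \<partial>lborel) < \<infinity>"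
      "Sheu \<phi> \<longleftrightarrow> (\<integral>\<^sup>+s\<in>{1..}. 1 / ennreal (G s) \<partial>lborel) < \<infinity>"
    unfolding Sheu_def root_primitive_def[symmetric] by simp_all
  define admissible_scales where "admissible_scales m e t A \<longleftrightarrow> 0 < e \<and> e \<le> \<delta> m \<and> real m \<le> t \<and> t \<le> A \<and> 1 / e \<le> A \<and>
      (\<forall>s. 1 / e \<le> s \<longrightarrow> exponent \<beta> \<pi> s \<le> 2 * mixed e (\<delta> m) s) \<and>
      (\<forall>s. t \<le> s \<longrightarrow> mixed e (\<delta> m) s \<le> 2 * exponent \<beta> \<pi> s) \<and>
      (\<not> Grey \<phi> \<longrightarrow> 1 \<le> (\<integral>\<^sup>+s\<in>{t..A}. 1 / ennreal (g s) \<partial>lborel)) \<and>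
      (\<not> Sheu \<phi> \<longrightarrow> 1 \<le> (\<integral>\<^sup>+s\<in>{t..A}. 1 / ennreal (G s) \<partial>lborel))" for m e t A
  have "\<exists>e t A. admissible_scales m e t A" for m
  proof -
    have \<delta>: "0 < \<delta> m" "\<delta> m \<le> 1" by (simp_all add: \<delta>_def divide_simps)
    have inf: "\<not> Grey \<phi> \<Longrightarrow> (\<integral>\<^sup>+s\<in>{1..}. 1 / ennreal (g s) \<partial>lborel) = \<infinity>"
      "\<not> Sheu \<phi> \<Longrightarrow> (\<integral>\<^sup>+s\<in>{1..}. 1 / ennreal (G s) \<partial>lborel) = \<infinity>"
      by (simp_all add: Grey Sheu not_less top_unique)
    show ?thesis
    proof (rule mixing_scales[OF \<delta>(1) \<delta>, of "real m", folded g_def G_def], goal_cases)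
      case (1 e t A)
      have "admissible_scales m e t A"
        unfolding admissible_scales_def by (intro conjI allI impI) (fact 1 | rule 1, simp add: inf)+
      then show ?case by blast
    qed
  qed
  then obtain E T A where "\<And>m. admissible_scales m (E m) (T m) (A m)" by metis
  then have scales: "\<And>m. 0 < E m" "\<And>m. E m \<le> \<delta> m" "\<And>m. real m \<le> T m" "\<And>m. T m \<le> A m"
      "\<And>m. 1 / E m \<le> A m"
      "\<And>m s. 1 / E m \<le> s \<Longrightarrow> exponent \<beta> \<pi> s \<le> 2 * mixed (E m) (\<delta> m) s"
      "\<And>m s. T m \<le> s \<Longrightarrow> mixed (E m) (\<delta> m) s \<le> 2 * exponent \<beta> \<pi> s"
      "\<And>m. \<not> Grey \<phi> \<Longrightarrow> 1 \<le> (\<integral>\<^sup>+s\<in>{T m..A m}. 1 / ennreal (g s) \<partial>lborel)"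
      "\<And>m. \<not> Sheu \<phi> \<Longrightarrow> 1 \<le> (\<integral>\<^sup>+s\<in>{T m..A m}. 1 / ennreal (G s) \<partial>lborel)"
    unfolding admissible_scales_def by blast+
  have E1: "E m \<le> 1" for m
    using scales(2)[of m] by (rule order_trans) (simp add: \<delta>_def divide_simps)
  obtain k :: "nat \<Rightarrow> nat" where k: "filterlim k at_top sequentially"
      and A: "\<forall>\<^sub>F n in sequentially. A (k n) \<le> a n"
    using slow_index[OF a(2)] by blast
  define \<Psi> where "\<Psi> n = (mixed (E (k n)) (\<delta> (k n)) :: real \<Rightarrow> real)" for n
  define \<Psi>c where "\<Psi>c n = (mixed (E (k n)) (\<delta> (k n)) :: complex \<Rightarrow> complex)" for n
  have \<Psi>c: "\<Psi>c n (of_real s) = of_real (\<Psi> n s)" for n s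
    unfolding \<Psi>c_def \<Psi>_def by (rule mixed_of_real[OF scales(1) E1])
  have mono_doubling_\<Psi>: "mono_doubling (\<Psi> n)" for n
    unfolding \<Psi>_def by (rule mono_doubling_mixed[OF scales(1) E1])
  have lower: "exponent (\<gamma> + \<beta>) \<rho> s \<le> 2 * \<Psi> n s \<or> exponent \<beta> \<pi> s \<le> 2 * \<Psi> n s" if "0 \<le> s" for n s
    unfolding \<Psi>_def using mixed_ge_coarse[OF scales(1) E1 that] scales(6) by (meson linear)
  have upper: "\<Psi> n s \<le> 2 * exponent \<beta> \<pi> s" if "T (k n) \<le> s" for n s
    unfolding \<Psi>_def using scales(7)[OF that] .
  have \<Psi>_pos: "0 < \<Psi> n s" if "0 < s" for n s
    using lower[of s n] fine.exponent_pos[OF that] \<psi>_pos[OF that] \<psi>[of s] that by auto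
  define offspring where "offspring n b p \<longleftrightarrow> \<Psi> n (a n) \<le> (1 - q) * b \<and> (1 - q) * b \<le> 2 * \<Psi> n (a n) \<and>
      critical_offspring p \<and> pmf p 1 = q \<and>
      (\<forall>r. cmod r \<le> 1 \<longrightarrow>
        (\<lambda>k. of_real (pmf p k) * r ^ k) sums (r + \<Psi>c n (of_real (a n) * (1 - r)) / of_real b))" for n b p
  have "\<exists>b p. offspring n b p" for n
  proof -
    obtain w where w: "branching_coeffs (\<Psi>c n) (a n) w"
      unfolding \<Psi>c_def using branching_coeffs_mixed[OF a(1) scales(1) E1] by blast
    have 0: "\<Psi>c n 0 = 0" using \<Psi>c[of n 0] by (simp add: \<Psi>_def mixed_exponent_def
        clumped_exponent_def small_exponent_def jump_exponent_def)
    have "0 < Re (\<Psi>c n (of_real (a n)))" using \<Psi>_pos[OF a(1)] by (simp add: \<Psi>c)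
    from offspring_law_of_branching_coeffs[OF w 0 this q, unfolded \<Psi>c Re_complex_of_real]
    show ?thesis
      unfolding offspring_def by blast
  qed
  then obtain b \<mu> where "\<And>n. offspring n (b n) (\<mu> n)" by metis
  then have b: "\<And>n. \<Psi> n (a n) \<le> (1 - q) * b n" "\<And>n. (1 - q) * b n \<le> 2 * \<Psi> n (a n)"
      and crit: "\<And>n. critical_offspring (\<mu> n)" and \<mu>1: "\<And>n. pmf (\<mu> n) 1 = q"
      and gen: "\<And>n r. cmod r \<le> 1 \<Longrightarrow> (\<lambda>k. of_real (pmf (\<mu> n) k) * r ^ k) sums
          (r + \<Psi>c n (of_real (a n) * (1 - r)) / of_real (b n))"
    unfolding offspring_def by blast+
  have b_pos: "0 < b n" for n
  proof -
    have "0 < (1 - q) * b n" using b(1)[of n] \<Psi>_pos[OF a(1)[of n], of n] by linarith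
    then show ?thesis using q by (simp add: zero_less_mult_iff)
  qed
  have psi_n: "psi_n a b \<mu> n s = \<Psi> n s" if "0 \<le> s" "s \<le> a n" for n s
    using gen \<Psi>c a(1) b_pos that by (rule psi_n_eq)
  have root_psi_n: "root_primitive (psi_n a b \<mu> n) s = root_primitive (\<Psi> n) s" if "s \<le> a n" for n s
    using that by (intro root_primitive_cong psi_n) auto
  have sandwich: "\<forall>\<^sub>F n in sequentially. \<phi> (a n) \<le> 2 * \<Psi> n (a n) \<and> \<Psi> n (a n) \<le> 2 * \<phi> (a n)"
    using A
  proof eventually_elim
    case (elim n)
    show ?case
      using upper[of n "a n"] scales(6)[of "k n" "a n"] scales(4,5)[of "k n"] elim \<phi>[of "a n"] a(1)[of n]
      by (simp add: \<Psi>_def)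
  qed
  have \<phi>_lim: "filterlim (\<lambda>n. \<phi> (a n)) at_top sequentially"
  proof -
    obtain K where K: "0 < K" "\<And>s::real. K \<le> s \<Longrightarrow> 1 * s \<le> exponent \<beta> \<pi> s"
      using fine.exponent_superlinear[of 1] by blast
    have "\<forall>\<^sub>F n in sequentially. K \<le> a n" using a(2) unfolding filterlim_at_top by blast
    then have "\<forall>\<^sub>F n in sequentially. a n \<le> \<phi> (a n)"
      by eventually_elim (use K \<phi> a(1) in \<open>simp add: less_imp_le\<close>)
    with a(2) show ?thesis by (rule filterlim_at_top_mono)
  qed
  show ?thesis
  proof (rule that)
    show "pmf (\<mu> n) 1 = q" for n by (rule \<mu>1)
    show "admissible_seqs b \<mu>"
      unfolding admissible_seqs_def
    proof (intro conjI allI b_pos crit)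
      have "\<forall>\<^sub>F n in sequentially. \<phi> (a n) \<le> 2 * b n"
        using sandwich
      proof eventually_elim
        case (elim n)
        have "(1 - q) * b n \<le> 1 * b n" using q b_pos[of n] by (intro mult_right_mono) auto
        then show ?case using elim b(1)[of n] by linarith
      qed
      then have le: "\<forall>\<^sub>F n in sequentially. \<phi> (a n) \<le> 2 * b n" .
      show "filterlim b at_top sequentially"
        unfolding filterlim_at_top
      proof
        fix Z
        have "\<forall>\<^sub>F n in sequentially. 2 * Z \<le> \<phi> (a n)"
          using \<phi>_lim unfolding filterlim_at_top by blast
        with le show "\<forall>\<^sub>F n in sequentially. Z \<le> b n" by eventually_elim linarith
      qed
    qed
    then have b_lim: "filterlim b at_top sequentially" by (simp add: admissible_seqs_def)
    have \<delta>_lim: "(\<lambda>n. \<delta> (k n)) \<longlonglongrightarrow> 0"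
      unfolding \<delta>_def by (rule filterlim_compose[OF LIMSEQ_inverse_real_of_nat k])
    have E_lim: "(\<lambda>n. E (k n)) \<longlonglongrightarrow> 0"
      by (rule tendsto_sandwich[OF _ _ tendsto_const \<delta>_lim])
        (auto intro!: always_eventually simp: scales(1,2) less_imp_le)
    show "Luka a b \<mu> \<psi>"
    proof (rule Luka_of_exponent_convergence[OF a b_lim crit gen])
      show "(\<lambda>n. \<Psi>c n (z n)) \<longlonglongrightarrow> exponent (\<gamma> + \<beta>) \<rho> z'" if "z \<longlonglongrightarrow> z'" "\<And>n. 0 \<le> Re (z n)" for z z'
        unfolding \<Psi>c_def by (rule mixed_tendsto[OF E_lim scales(1) E1 \<delta>_lim that])
      show "exponent (\<gamma> + \<beta>) \<rho> (of_real l) = complex_of_real (\<psi> l)" if "0 \<le> l" for l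
        using coarse.exponent_of_real[of l] \<psi>[OF that] by (simp add: exponent_add scaleR_conv_of_real)
    qed auto
    show "asymp_infty b (\<lambda>n. \<phi> (a n))"
      unfolding asymp_infty_def
    proof (intro exI conjI)
      let ?C = "4 / (1 - q)"
      show "1 \<le> ?C" using q by simp
      show "\<forall>\<^sub>F n in sequentially. inverse ?C * b n \<le> \<phi> (a n) \<and> \<phi> (a n) \<le> ?C * b n"
        using sandwich
      proof eventually_elim
        case (elim n)
        have "inverse ?C * b n = (1 - q) * b n / 4" by simp
        also have "\<dots> \<le> \<phi> (a n)" using elim b(2)[of n] by linarith
        finally have 1: "inverse ?C * b n \<le> \<phi> (a n)" .
        have "(1 - q) * b n \<le> 1 * b n" "b n * 2 \<le> b n * ?C"
          using q b_pos[of n] by (intro mult_right_mono mult_left_mono; simp add: field_simps)+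
        then have "\<phi> (a n) \<le> ?C * b n" using elim b(1)[of n] by (simp add: mult.commute)
        with 1 show ?case ..
      qed
    qed
    show "Grey_seq a b \<mu>" if "Grey \<psi>" "Grey \<phi>"
      unfolding Grey_seq_def
    proof (rule limsup_tail_integrals_tendsto_0[OF meas(1,2) that[unfolded Grey], of "1 / 2"])
      show "1 / 2 * f s \<le> psi_n a b \<mu> n s \<or> 1 / 2 * g s \<le> psi_n a b \<mu> n s" if s: "1 \<le> s" "s \<le> a n" for n s
      proof -
        have "0 \<le> s" using s by simp
        from lower[OF this, of n] show ?thesis
          unfolding psi_n[OF \<open>0 \<le> s\<close> s(2)] f_def g_def max_absorb2[OF \<open>0 \<le> s\<close>] by linarith
      qed
    qed simp
    show "Sheu_seq a b \<mu>" if "Sheu \<psi>" "Sheu \<phi>"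
      unfolding Sheu_seq_def root_primitive_def[symmetric]
    proof (rule limsup_tail_integrals_tendsto_0[OF meas(3,4) that[unfolded Sheu], of "1 / 4"])
      show "1 / 4 * F s \<le> root_primitive (psi_n a b \<mu> n) s \<or> 1 / 4 * G s \<le> root_primitive (psi_n a b \<mu> n) s"
        if s: "1 \<le> s" "s \<le> a n" for n s
      proof -
        have s0: "0 \<le> s" using s by simp
        from lower[OF this, of n] show ?thesis
        proof
          assume "exponent (\<gamma> + \<beta>) \<rho> s \<le> 2 * \<Psi> n s"
          from root_primitive_le[OF mono_doubling_target mono_doubling_\<Psi> s0 this] show ?thesis
            unfolding root_psi_n[OF s(2)] F_def G_def by linarith
        next
          assume "exponent \<beta> \<pi> s \<le> 2 * \<Psi> n s"
          from root_primitive_le[OF fine.mono_doubling_exponent mono_doubling_\<Psi> s0 this] show ?thesis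
            unfolding root_psi_n[OF s(2)] F_def G_def by linarith
        qed
      qed
    qed simp
    have T_nonneg: "0 \<le> s" if "T (k n) \<le> s" for n s
      using scales(3)[of "k n"] that by linarith
    show "\<not> Grey_seq a b \<mu>" if "\<not> Grey \<phi>"
      unfolding Grey_seq_def
    proof (rule not_limsup_tail_integrals_tendsto_0[OF meas(2) _ k scales(3) scales(8)[OF that] A, of 2])
      show "psi_n a b \<mu> n s \<le> 2 * g s" if "T (k n) \<le> s" "s \<le> a n" for n s
        using upper[OF that(1)]
        unfolding psi_n[OF T_nonneg[OF that(1)] that(2)] g_def max_absorb2[OF T_nonneg[OF that(1)]] .
    qed simp
    show "\<not> Sheu_seq a b \<mu>" if "\<not> Sheu \<phi>"
      unfolding Sheu_seq_def root_primitive_def[symmetric]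
    proof (rule not_limsup_tail_integrals_tendsto_0[OF meas(4) _ k scales(3) scales(9)[OF that] A, of 4])
      show "root_primitive (psi_n a b \<mu> n) s \<le> 4 * G s" if "T (k n) \<le> s" "s \<le> a n" for n s
        using root_primitive_le[OF mono_doubling_\<Psi> fine.mono_doubling_exponent T_nonneg[OF that(1)] upper[OF that(1)]]
        unfolding root_psi_n[OF that(2)] G_def .
    qed simp
  qed
qed

end

text \<open>
  The quadratic part \<open>\<beta>\<^sub>\<phi> z\<^sup>2\<close> is split off \<open>\<psi>\<close> and supplied by the small part of \<open>\<phi>\<close>; this is where
  \<open>\<beta>\<^sub>\<phi> \<le> \<beta>\<^sub>\<psi>\<close> enters.  Each part of the statement is then a combination of the properties of the
  one pair of sequences.
\<close>

theorem proposition1p12: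
  fixes \<psi> \<phi> :: "real \<Rightarrow> real"
    and \<beta>\<^sub>\<psi> \<beta>\<^sub>\<phi> q :: real
    and \<pi>\<^sub>\<psi> \<pi>\<^sub>\<phi> :: "real measure"
    and a :: "nat \<Rightarrow> real"
  assumes "class_L \<psi> \<beta>\<^sub>\<psi> \<pi>\<^sub>\<psi>" and "class_L \<phi> \<beta>\<^sub>\<phi> \<pi>\<^sub>\<phi>"
    and "Var_infty \<beta>\<^sub>\<psi> \<pi>\<^sub>\<psi>" and "Var_infty \<beta>\<^sub>\<phi> \<pi>\<^sub>\<phi>"
    and "\<beta>\<^sub>\<phi> \<le> \<beta>\<^sub>\<psi>"
    and "0 < q" and "q < 1"
    and "\<forall>n. a n > 0" and "filterlim a at_top sequentially"
  shows
    "(Sheu \<psi> \<and> Sheu \<phi> \<longrightarrow>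
        (\<exists>b \<mu>. admissible_seqs b \<mu> \<and> Luka a b \<mu> \<psi> \<and> (\<lambda>n. pmf (\<mu> n) 1) \<longlonglongrightarrow> q \<and>
           asymp_infty b (\<lambda>n. \<phi> (a n)) \<and> Sheu_seq a b \<mu>)) \<and>
     (Grey \<psi> \<and> Grey \<phi> \<and> \<not> Sheu \<phi> \<longrightarrow>
        (\<exists>b \<mu>. admissible_seqs b \<mu> \<and> Luka a b \<mu> \<psi> \<and> (\<lambda>n. pmf (\<mu> n) 1) \<longlonglongrightarrow> q \<and>
           asymp_infty b (\<lambda>n. \<phi> (a n)) \<and> Grey_seq a b \<mu> \<and> \<not> Sheu_seq a b \<mu>)) \<and>
     (\<not> Grey \<phi> \<longrightarrow>
        (\<exists>b \<mu>. admissible_seqs b \<mu> \<and> Luka a b \<mu> \<psi> \<and> (\<lambda>n. pmf (\<mu> n) 1) \<longlonglongrightarrow> q \<and>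
           asymp_infty b (\<lambda>n. \<phi> (a n)) \<and> \<not> Grey_seq a b \<mu>))"
proof -
  interpret psi: levy_data_infinite_variation \<beta>\<^sub>\<psi> \<pi>\<^sub>\<psi>
    using class_L_levy_data(1)[OF assms(1)] assms(3)
    by (simp add: levy_data_infinite_variation_def levy_data_infinite_variation_axioms_def)
  interpret phi: levy_data_infinite_variation \<beta>\<^sub>\<phi> \<pi>\<^sub>\<phi>
    using class_L_levy_data(1)[OF assms(2)] assms(4)
    by (simp add: levy_data_infinite_variation_def levy_data_infinite_variation_axioms_def)
  interpret interpolation "\<beta>\<^sub>\<psi> - \<beta>\<^sub>\<phi>" \<pi>\<^sub>\<psi> \<beta>\<^sub>\<phi> \<pi>\<^sub>\<phi>
    using assms(5) psi.sets_\<pi> psi.finite_min by unfold_locales simp_all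
  have \<psi>: "\<psi> s = exponent (\<beta>\<^sub>\<psi> - \<beta>\<^sub>\<phi> + \<beta>\<^sub>\<phi>) \<pi>\<^sub>\<psi> s" if "0 \<le> s" for s
    using class_L_levy_data(2)[OF assms(1) that] by simp
  have \<phi>: "\<phi> s = exponent \<beta>\<^sub>\<phi> \<pi>\<^sub>\<phi> s" if "0 \<le> s" for s
    by (rule class_L_levy_data(2)[OF assms(2) that])
  have \<psi>_pos: "0 < \<psi> s" if "0 < s" for s
    using psi.exponent_pos[OF that] \<psi>[of s] that by simp
  obtain b \<mu> where "admissible_seqs b \<mu>" "Luka a b \<mu> \<psi>" and \<mu>: "\<And>n. pmf (\<mu> n) 1 = q"
    and "asymp_infty b (\<lambda>n. \<phi> (a n))"
    and "Grey \<psi> \<Longrightarrow> Grey \<phi> \<Longrightarrow> Grey_seq a b \<mu>" "Sheu \<psi> \<Longrightarrow> Sheu \<phi> \<Longrightarrow> Sheu_seq a b \<mu>"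
      "\<not> Grey \<phi> \<Longrightarrow> \<not> Grey_seq a b \<mu>" "\<not> Sheu \<phi> \<Longrightarrow> \<not> Sheu_seq a b \<mu>"
    using interpolating_offspring_laws[OF \<psi> \<phi> \<psi>_pos assms(8)[rule_format] assms(9,6,7)] by blast
  moreover have "(\<lambda>n. pmf (\<mu> n) 1) \<longlonglongrightarrow> q" unfolding \<mu> by (rule tendsto_const)
  ultimately show ?thesis by blast
qed

end
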